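(* Let $\pi$ be any irreducible admissible genuine (complex) representation of the $n$-fold metaplectic cover $\widetilde{G}$ of $G=\mathrm{GL}(2,F)$. For $\alpha\in F^{\times}$, let $\sigma_{\alpha}:\widetilde{G}\to\widetilde{G}$ be the lift of the standard involution $\tau$ of $G$ defined by $\sigma_\alpha(h)=\langle\alpha,\Delta(h)\rangle\,\tilde u(\Delta(h))\,h^{-1}\,\tilde u(1)$. Then $$\pi^{\sigma_{\alpha}}\simeq \pi^{\vee}$$ if and only if $n=2$.
   Context: $F$ is a non-Archimedean local field of characteristic zero, $n\geq 2$ is an integer, $\mu_n=\{x\in F^\times : x^n=1\}$, and it is assumed that $|\mu_n|=n$. $\langle\,,\,\rangle:F^\times\times F^\times\to\mu_n$ is the $n$-th order Hilbert symbol; it is bimultiplicative, $\langle a,b\rangle\langle b,a\rangle=1$, $\langle a,1-a\rangle=1$ if $1-a\in F^\times$, and $\{a : \langle a,x\rangle=1 \text{ for all } x\in F^\times\}=(F^\times)^n$. $G=\mathrm{GL}(2,F)$. For $m\in G$ put $X(m)=m_{21}$ if $m_{21}\neq 0$ and $X(m)=m_{22}$ otherwise, and $\Delta(m)=\det m$. The Kubota cocycle (in the form of Kazhdan–Patterson) is $$c(g_1,g_2)=\left\langle \frac{X(g_1g_2)}{X(g_1)},\frac{X(g_1g_2)}{X(g_2)\Delta(g_1)}\right\rangle .$$ The $n$-fold metaplectic cover $\widetilde G$ is the set $G\times\mu_n$ with multiplication $(g_1,\epsilon_1)(g_2,\epsilon_2)=(g_1g_2,c(g_1,g_2)\epsilon_1\epsilon_2)$.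 $p:\widetilde G\to G$ is the projection, $\epsilon\in\mu_n$ is identified with the central element $(I_2,\epsilon)$, and $\Delta((g,\epsilon))=\Delta(g)$. Topology: $\widetilde G$ is a locally compact topological group, a topological central extension of $G$ by $\mu_n$. Let $\mathfrak o$ be the ring of integers of $F$, $\varpi$ a uniformizer, $\mathrm{ord}$ the valuation, $K_0=\mathrm{GL}(2,\mathfrak o)$, $K_\lambda=1+\varpi^\lambda \mathrm M(2,\mathfrak o)$ for $\lambda\ge1$. For $g=\begin{bmatrix}a&b\\c&d\end{bmatrix}$ let $s(g)=\langle c,d\Delta(g)\rangle$ if $cd\ne0$ and $\mathrm{ord}(c)$ is odd, and $s(g)=1$ otherwise. For a suitable $\lambda_0$, $k\mapsto(k,s(k))$ is a homomorphism $K_{\lambda_0}\to\widetilde G$, and the sets $K_\lambda^*=\{(k,s(k)):k\in K_\lambda\}$, $\lambda\ge\lambda_0$, form a neighborhood base at the identity of $\widetilde G$ consisting of compact open subgroups. $\tau(g)=w_0g^{\top}w_0$, where $g^\top$ is the transpose and $w_0$ is the matrix with anti-diagonal entries $1$ and other entries $0$; it is an involutive anti-automorphism of $G$ (the standard involution). $u(\lambda)=\begin{bmatrix}\lambda&0\\0&-\lambda\end{bmatrix}$ and $\tilde u(\lambda)=(u(\lambda),1)$ for $\lambda\in F^\times$. A lift of $\tau$ is an anti-automorphism $\tilde f$ of $\widetilde G$ with $p(\tilde f(h))=\tau(p(h))$ for all $h$; each $\sigma_\alpha$ is an involutive lift of $\tau$. Fix an injective character $\xi:\mu_n\to\mathbb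 C^\times$; a representation $\pi$ of $\widetilde G$ is genuine if $\pi(\epsilon g)=\xi(\epsilon)\pi(g)$ for $\epsilon\in\mu_n$, $g\in\widetilde G$. $\pi^\vee$ is the smooth contragredient. For an anti-automorphism $\beta$ with $\beta^2=1$, $\pi^\beta(g)=\pi(\beta(g^{-1}))$. *)

theory Defs
  imports "HOL-Analysis.Analysis" "HOL-Algebra.Group" "HOL-Library.Function_Algebras"
begin

section \<open>Non-Archimedean local fields of characteristic zero\<close>

text \<open>
  The field is the whole type \<open>'f\<close>. The normalized valuation is an integer-valued function whose
  value at \<open>0\<close> (mathematically infinite) is irrelevant: every use is guarded by \<open>x \<noteq> 0\<close>.
\<close>

definition ideal_pow :: "('f::field_char_0 \<Rightarrow> int) \<Rightarrow> int \<Rightarrow> 'f set" where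
  "ideal_pow ord k = {x. x = 0 \<or> k \<le> ord x}"

abbreviation integers :: "('f::field_char_0 \<Rightarrow> int) \<Rightarrow> 'f set" where
  "integers ord \<equiv> ideal_pow ord 0"

locale nonarch_local_field =
  fixes ord :: "'f::field_char_0 \<Rightarrow> int"
  assumes ord_mult: "x \<noteq> 0 \<Longrightarrow> y \<noteq> 0 \<Longrightarrow> ord (x * y) = ord x + ord y"
    and ord_add: "x \<noteq> 0 \<Longrightarrow> y \<noteq> 0 \<Longrightarrow> x + y \<noteq> 0 \<Longrightarrow> min (ord x) (ord y) \<le> ord (x + y)"
    and uniformizer_exists: "\<exists>\<pi>. \<pi> \<noteq> 0 \<and> ord \<pi> = 1"
    and ord_complete:
      "(\<And>k. \<exists>N. \<forall>i\<ge>N. \<forall>j\<ge>N. X i - X j \<in> ideal_pow ord k)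
        \<Longrightarrow> \<exists>L. \<forall>k. \<exists>N. \<forall>i\<ge>N. (X :: nat \<Rightarrow> 'f) i - L \<in> ideal_pow ord k"
    and finite_residue_field:
      "finite (integers ord //
        {(x, y). x \<in> integers ord \<and> y \<in> integers ord \<and> x - y \<in> ideal_pow ord 1})"

section \<open>The Hilbert symbol\<close>

definition roots_of_unity :: "nat \<Rightarrow> 'f::field_char_0 set" where
  "roots_of_unity n = {x. x ^ n = 1}"

text \<open>
  \<open>hs\<close> is only meaningful on nonzero arguments. The assumptions are the standard properties of the
  \<open>n\<close>-th order Hilbert symbol. By Moore's theorem \<open>K\<^sub>2(F)/n\<close> is cyclic of order \<open>n\<close>, so they determine
  the symbol up to an automorphism of the group of \<open>n\<close>-th roots of unity; composing the injective
  character \<open>\<xi>\<close> below with such an automorphism gives again an injective character.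
\<close>

locale hilbert_symbol = nonarch_local_field ord
  for ord :: "'f::field_char_0 \<Rightarrow> int" +
  fixes n :: nat and hs :: "'f \<Rightarrow> 'f \<Rightarrow> 'f"
  assumes n_ge_2: "2 \<le> n"
    and card_roots_of_unity: "card (roots_of_unity n :: 'f set) = n"
    and hs_in: "a \<noteq> 0 \<Longrightarrow> b \<noteq> 0 \<Longrightarrow> hs a b \<in> roots_of_unity n"
    and hs_mult_left: "a \<noteq> 0 \<Longrightarrow> a' \<noteq> 0 \<Longrightarrow> b \<noteq> 0 \<Longrightarrow> hs (a * a') b = hs a b * hs a' b"
    and hs_mult_right: "a \<noteq> 0 \<Longrightarrow> b \<noteq> 0 \<Longrightarrow> b' \<noteq> 0 \<Longrightarrow> hs a (b * b') = hs a b * hs a b'"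
    and hs_skew: "a \<noteq> 0 \<Longrightarrow> b \<noteq> 0 \<Longrightarrow> hs a b * hs b a = 1"
    and hs_steinberg: "a \<noteq> 0 \<Longrightarrow> 1 - a \<noteq> 0 \<Longrightarrow> hs a (1 - a) = 1"
    and hs_nondegenerate:
      "{a. a \<noteq> 0 \<and> (\<forall>x. x \<noteq> 0 \<longrightarrow> hs a x = 1)} = {b ^ n | b. b \<noteq> 0}"

section \<open>The metaplectic cover of GL(2)\<close>

definition kubota_X :: "'f::field_char_0^2^2 \<Rightarrow> 'f" where
  "kubota_X m = (if m $ 2 $ 1 \<noteq> 0 then m $ 2 $ 1 else m $ 2 $ 2)"

definition kubota_cocycle ::
    "('f::field_char_0 \<Rightarrow> 'f \<Rightarrow> 'f) \<Rightarrow> 'f^2^2 \<Rightarrow> 'f^2^2 \<Rightarrow> 'f" where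
  "kubota_cocycle hs g h =
    hs (kubota_X (g ** h) / kubota_X g) (kubota_X (g ** h) / (kubota_X h * det g))"

type_synonym 'f mp = "('f^2^2) \<times> 'f"

definition mp_group :: "nat \<Rightarrow> ('f::field_char_0 \<Rightarrow> 'f \<Rightarrow> 'f) \<Rightarrow> 'f mp monoid" where
  "mp_group n hs =
    \<lparr> carrier = {g. det g \<noteq> 0} \<times> roots_of_unity n,
      monoid.mult = (\<lambda>(g, \<epsilon>) (h, \<eta>). (g ** h, kubota_cocycle hs g h * \<epsilon> * \<eta>)),
      one = (mat 1, 1) \<rparr>"

definition mp_det :: "'f::field_char_0 mp \<Rightarrow> 'f" where
  "mp_det h = det (fst h)"

definition mp_central :: "'f::field_char_0 \<Rightarrow> 'f mp" where
  "mp_central \<epsilon> = (mat 1, \<epsilon>)"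

definition kubota_s :: "('f::field_char_0 \<Rightarrow> int) \<Rightarrow> ('f \<Rightarrow> 'f \<Rightarrow> 'f) \<Rightarrow> 'f^2^2 \<Rightarrow> 'f" where
  "kubota_s ord hs g =
    (if g $ 2 $ 1 \<noteq> 0 \<and> g $ 2 $ 2 \<noteq> 0 \<and> odd (ord (g $ 2 $ 1))
     then hs (g $ 2 $ 1) (g $ 2 $ 2 * det g) else 1)"

definition congruence_subgroup :: "('f::field_char_0 \<Rightarrow> int) \<Rightarrow> nat \<Rightarrow> ('f^2^2) set" where
  "congruence_subgroup ord l = {k. \<forall>i j. (k - mat 1) $ i $ j \<in> ideal_pow ord (int l)}"

definition congruence_lift ::
    "('f::field_char_0 \<Rightarrow> int) \<Rightarrow> ('f \<Rightarrow> 'f \<Rightarrow> 'f) \<Rightarrow> nat \<Rightarrow> 'f mp set" where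
  "congruence_lift ord hs l = (\<lambda>k. (k, kubota_s ord hs k)) ` congruence_subgroup ord l"

text \<open>
  The topology for which the lifted congruence subgroups of sufficiently large level form a
  neighbourhood base at the identity. They decrease with the level, so no threshold has to
  be mentioned.
\<close>

definition mp_open ::
    "('f::field_char_0 \<Rightarrow> int) \<Rightarrow> nat \<Rightarrow> ('f \<Rightarrow> 'f \<Rightarrow> 'f) \<Rightarrow> 'f mp set \<Rightarrow> bool" where
  "mp_open ord n hs U \<longleftrightarrow> U \<subseteq> carrier (mp_group n hs) \<and>
    (\<forall>x\<in>U. \<exists>l\<ge>1. \<forall>k\<in>congruence_lift ord hs l. x \<otimes>\<^bsub>mp_group n hs\<^esub> k \<in> U)"

definition mp_topology ::
    "('f::field_char_0 \<Rightarrow> int) \<Rightarrow> nat \<Rightarrow> ('f \<Rightarrow> 'f \<Rightarrow> 'f) \<Rightarrow> 'f mp topology" where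
  "mp_topology ord n hs = topology (mp_open ord n hs)"

lemma congruence_lift_mono:
  "l \<le> l' \<Longrightarrow> congruence_lift ord hs l' \<subseteq> congruence_lift ord hs l"
  unfolding congruence_lift_def congruence_subgroup_def ideal_pow_def
  by (rule image_mono) fastforce

lemma openin_mp_topology: "openin (mp_topology ord n hs) = mp_open ord n hs"
proof -
  have "mp_open ord n hs (S \<inter> T)" if S: "mp_open ord n hs S" and T: "mp_open ord n hs T" for S T
    unfolding mp_open_def
  proof (intro conjI ballI)
    show "S \<inter> T \<subseteq> carrier (mp_group n hs)"
      using S by (auto simp: mp_open_def)
    fix x assume x: "x \<in> S \<inter> T"
    obtain a where a: "a \<ge> 1" "\<forall>k\<in>congruence_lift ord hs a. x \<otimes>\<^bsub>mp_group n hs\<^esub> k \<in> S"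
      using S x unfolding mp_open_def by blast
    obtain b where b: "b \<ge> 1" "\<forall>k\<in>congruence_lift ord hs b. x \<otimes>\<^bsub>mp_group n hs\<^esub> k \<in> T"
      using T x unfolding mp_open_def by blast
    have "\<forall>k\<in>congruence_lift ord hs (max a b). x \<otimes>\<^bsub>mp_group n hs\<^esub> k \<in> S \<inter> T"
      using a(2) b(2) congruence_lift_mono[of a "max a b" ord hs]
        congruence_lift_mono[of b "max a b" ord hs] by auto
    then show "\<exists>l\<ge>1. \<forall>k\<in>congruence_lift ord hs l. x \<otimes>\<^bsub>mp_group n hs\<^esub> k \<in> S \<inter> T"
      using a(1) by (intro exI[of _ "max a b"]) auto
  qed
  moreover have "mp_open ord n hs (\<Union>\<K>)" if K: "\<forall>S\<in>\<K>. mp_open ord n hs S" for \<K>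
    unfolding mp_open_def
  proof (intro conjI ballI)
    show "\<Union>\<K> \<subseteq> carrier (mp_group n hs)"
      using K unfolding mp_open_def by blast
    fix x assume "x \<in> \<Union>\<K>"
    then obtain S where S: "S \<in> \<K>" "x \<in> S" by blast
    then obtain l where "l \<ge> 1" "\<forall>k\<in>congruence_lift ord hs l. x \<otimes>\<^bsub>mp_group n hs\<^esub> k \<in> S"
      using K unfolding mp_open_def by blast
    then show "\<exists>l\<ge>1. \<forall>k\<in>congruence_lift ord hs l. x \<otimes>\<^bsub>mp_group n hs\<^esub> k \<in> \<Union>\<K>"
      using S(1) by blast
  qed
  ultimately have "istopology (mp_open ord n hs)"
    unfolding istopology_def by blast
  then show ?thesis
    unfolding mp_topology_def by (rule topology_inverse')
qed

section \<open>The lifts of the standard involution\<close>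

definition u_mat :: "'f::field_char_0 \<Rightarrow> 'f^2^2" where
  "u_mat a = vector [vector [a, 0], vector [0, - a]]"

definition mp_u :: "'f::field_char_0 \<Rightarrow> 'f mp" where
  "mp_u a = (u_mat a, 1)"

definition mp_sigma ::
    "nat \<Rightarrow> ('f::field_char_0 \<Rightarrow> 'f \<Rightarrow> 'f) \<Rightarrow> 'f \<Rightarrow> 'f mp \<Rightarrow> 'f mp" where
  "mp_sigma n hs \<alpha> h =
    mp_central (hs \<alpha> (mp_det h)) \<otimes>\<^bsub>mp_group n hs\<^esub> mp_u (mp_det h)
      \<otimes>\<^bsub>mp_group n hs\<^esub> inv\<^bsub>mp_group n hs\<^esub> h \<otimes>\<^bsub>mp_group n hs\<^esub> mp_u 1"

section \<open>Smooth representations\<close>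

text \<open>
  A representation acts on the complex vector space formed by the whole type \<open>'v\<close> with scalar
  multiplication \<open>smul\<close>. \<open>T\<close> is the topology of the group.
\<close>

definition group_rep ::
    "('g, 'm) monoid_scheme \<Rightarrow> (complex \<Rightarrow> 'v::ab_group_add \<Rightarrow> 'v) \<Rightarrow> ('g \<Rightarrow> 'v \<Rightarrow> 'v) \<Rightarrow> bool" where
  "group_rep G smul \<pi> \<longleftrightarrow>
    vector_space smul \<and>
    (\<forall>g\<in>carrier G. Vector_Spaces.linear smul smul (\<pi> g)) \<and>
    \<pi> \<one>\<^bsub>G\<^esub> = id \<and>
    (\<forall>g\<in>carrier G. \<forall>h\<in>carrier G. \<pi> (g \<otimes>\<^bsub>G\<^esub> h) = \<pi> g \<circ> \<pi> h)"

definition irreducible_rep ::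
    "('g, 'm) monoid_scheme \<Rightarrow> (complex \<Rightarrow> 'v::ab_group_add \<Rightarrow> 'v) \<Rightarrow> ('g \<Rightarrow> 'v \<Rightarrow> 'v) \<Rightarrow> bool" where
  "irreducible_rep G smul \<pi> \<longleftrightarrow>
    (\<exists>v::'v. v \<noteq> 0) \<and>
    (\<forall>W. module.subspace smul W \<and> (\<forall>g\<in>carrier G. \<pi> g ` W \<subseteq> W) \<longrightarrow> W = {0} \<or> W = UNIV)"

definition smooth_rep ::
    "('g, 'm) monoid_scheme \<Rightarrow> 'g topology \<Rightarrow> ('g \<Rightarrow> 'v \<Rightarrow> 'v) \<Rightarrow> bool" where
  "smooth_rep G T \<pi> \<longleftrightarrow> (\<forall>v. openin T {g \<in> carrier G. \<pi> g v = v})"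

definition admissible_rep ::
    "('g, 'm) monoid_scheme \<Rightarrow> 'g topology \<Rightarrow> (complex \<Rightarrow> 'v::ab_group_add \<Rightarrow> 'v)
      \<Rightarrow> ('g \<Rightarrow> 'v \<Rightarrow> 'v) \<Rightarrow> bool" where
  "admissible_rep G T smul \<pi> \<longleftrightarrow>
    smooth_rep G T \<pi> \<and>
    (\<forall>K. subgroup K G \<and> openin T K \<and> compactin T K \<longrightarrow>
      (\<exists>B. finite B \<and> {v. \<forall>k\<in>K. \<pi> k v = v} \<subseteq> module.span smul B))"

definition genuine_rep ::
    "nat \<Rightarrow> ('f::field_char_0 \<Rightarrow> 'f \<Rightarrow> 'f) \<Rightarrow> ('f \<Rightarrow> complex)
      \<Rightarrow> (complex \<Rightarrow> 'v \<Rightarrow> 'v) \<Rightarrow> ('f mp \<Rightarrow> 'v \<Rightarrow> 'v) \<Rightarrow> bool" where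
  "genuine_rep n hs \<xi> smul \<pi> \<longleftrightarrow>
    (\<forall>\<epsilon>\<in>roots_of_unity n. \<forall>g\<in>carrier (mp_group n hs). \<forall>v.
      \<pi> (mp_central \<epsilon> \<otimes>\<^bsub>mp_group n hs\<^esub> g) v = smul (\<xi> \<epsilon>) (\<pi> g v))"

definition injective_character :: "nat \<Rightarrow> ('f::field_char_0 \<Rightarrow> complex) \<Rightarrow> bool" where
  "injective_character n \<xi> \<longleftrightarrow>
    inj_on \<xi> (roots_of_unity n) \<and>
    (\<forall>\<epsilon>\<in>roots_of_unity n. \<xi> \<epsilon> \<noteq> 0) \<and>
    (\<forall>\<epsilon>\<in>roots_of_unity n. \<forall>\<eta>\<in>roots_of_unity n. \<xi> (\<epsilon> * \<eta>) = \<xi> \<epsilon> * \<xi> \<eta>)"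

text \<open>
  The contragredient acts on a subspace of the function space \<open>'v \<Rightarrow> complex\<close>, which carries
  pointwise operations.
\<close>

definition fun_scale :: "complex \<Rightarrow> ('v \<Rightarrow> complex) \<Rightarrow> ('v \<Rightarrow> complex)" where
  "fun_scale c f = (\<lambda>v. c * f v)"

definition contragredient ::
    "('g, 'm) monoid_scheme \<Rightarrow> ('g \<Rightarrow> 'v \<Rightarrow> 'v) \<Rightarrow> 'g \<Rightarrow> ('v \<Rightarrow> complex) \<Rightarrow> ('v \<Rightarrow> complex)" where
  "contragredient G \<pi> g f = (\<lambda>v. f (\<pi> (inv\<^bsub>G\<^esub> g) v))"

definition smooth_dual ::
    "('g, 'm) monoid_scheme \<Rightarrow> 'g topology \<Rightarrow> (complex \<Rightarrow> 'v::ab_group_add \<Rightarrow> 'v)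
      \<Rightarrow> ('g \<Rightarrow> 'v \<Rightarrow> 'v) \<Rightarrow> ('v \<Rightarrow> complex) set" where
  "smooth_dual G T smul \<pi> =
    {f. Vector_Spaces.linear smul (*) f \<and> openin T {g \<in> carrier G. contragredient G \<pi> g f = f}}"

definition twist ::
    "('g, 'm) monoid_scheme \<Rightarrow> ('g \<Rightarrow> 'g) \<Rightarrow> ('g \<Rightarrow> 'v \<Rightarrow> 'v) \<Rightarrow> 'g \<Rightarrow> 'v \<Rightarrow> 'v" where
  "twist G \<beta> \<pi> g = \<pi> (\<beta> (inv\<^bsub>G\<^esub> g))"

definition rep_isomorphic ::
    "('g, 'm) monoid_scheme
      \<Rightarrow> (complex \<Rightarrow> 'v::ab_group_add \<Rightarrow> 'v) \<Rightarrow> 'v set \<Rightarrow> ('g \<Rightarrow> 'v \<Rightarrow> 'v)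
      \<Rightarrow> (complex \<Rightarrow> 'w::ab_group_add \<Rightarrow> 'w) \<Rightarrow> 'w set \<Rightarrow> ('g \<Rightarrow> 'w \<Rightarrow> 'w) \<Rightarrow> bool" where
  "rep_isomorphic G smul V \<pi> smul' V' \<pi>' \<longleftrightarrow>
    (\<exists>\<phi>. bij_betw \<phi> V V' \<and>
      (\<forall>x\<in>V. \<forall>y\<in>V. \<phi> (x + y) = \<phi> x + \<phi> y) \<and>
      (\<forall>c. \<forall>x\<in>V. \<phi> (smul c x) = smul' c (\<phi> x)) \<and>
      (\<forall>g\<in>carrier G. \<forall>x\<in>V. \<phi> (\<pi> g x) = \<pi>' g (\<phi> x)))"

end

theory Submission
  imports Defs "HOL-Computational_Algebra.Fundamental_Theorem_Algebra"
begin

text \<open>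
  Both sides of the isomorphism have a central character on the group of \<open>n\<close>-th roots of unity. The
  involution inverts central elements, so the twist has central character \<open>\<xi>\<close>, while the contragredient
  has \<open>\<xi>\<inverse>\<close>. As \<open>\<xi>\<close> is injective, an isomorphism forces every \<open>n\<close>-th root of unity to be its own
  inverse, hence \<open>n = 2\<close> (\<open>dualizing_imp_degree_two\<close>).

  For \<open>n = 2\<close> the point is that the involution preserves conjugacy classes in a strong sense: every
  \<open>\<sigma>(h)\<close> is conjugate to \<open>h\<close> by an element over \<open>F\<^sup>\<times> GL(2, \<o>)\<close>, and such an element normalizes all
  small lifted congruence subgroups \<open>K\<close> (\<open>involution_preserves_conjugacy\<close>). In \<open>GL(2)\<close> an integral
  unipotent matrix does this after a suitable change of basis over \<open>\<o>\<close>; in the cover the remaining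
  sign is the commutator with a scalar matrix, which for \<open>n = 2\<close> is
  \<open>\<langle>z, \<Delta>(h)\<rangle>\<close> (\<open>scalar_commute\<close>).

  Let \<open>e\<close> be the projection to the vectors fixed by \<open>K\<close>. Since the conjugating elements commute with
  \<open>e\<close>, the operators \<open>e \<pi>(g) e\<close> and \<open>e \<pi>(\<sigma>(g)) e\<close> have the same trace for each group element
  (\<open>corner_trace\<close>). By linearity the same holds on the Hecke algebra of \<open>K\<close>, which acts
  irreducibly on the finite-dimensional space of fixed vectors. Therefore this algebra contains an
  operator of rank one, and the trace identity matches the coefficient of \<open>\<pi>\<close> given by this operator
  with a coefficient precomposed with \<open>\<sigma>\<close>
  (\<open>matching_coefficients\<close>). Such a match extends to an invariant form between \<open>\<pi>\<close> and its twist
  (\<open>invariant_form\<close>), and admissibility turns the form into an isomorphism with the contragredient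
  (\<open>involution_dualizes\<close>).

  Two observations simplify the work with the cover. The associativity of its multiplication follows
  from the existence of a genuine representation (\<open>group_of_genuine_rep\<close>). At sufficiently deep levels
  the diagonal entries and determinants of congruence matrices are squares, which makes the splitting of
  the cover over the congruence subgroup trivial (\<open>Ks_eq\<close>).
\<close>

section \<open>Finite-dimensional operators on a complex vector space\<close>

locale complex_vector_space = vector_space smul
  for smul :: "complex \<Rightarrow> 'v::ab_group_add \<Rightarrow> 'v" (infixr "\<cdot>" 75)
begin

abbreviation operator :: "('v \<Rightarrow> 'v) \<Rightarrow> bool" where
  "operator \<equiv> Vector_Spaces.linear smul smul"

abbreviation functional :: "('v \<Rightarrow> complex) \<Rightarrow> bool" where
  "functional \<equiv> Vector_Spaces.linear smul (*)"

lemma vector_space_times: "vector_space ((*) :: complex \<Rightarrow> complex \<Rightarrow> complex)"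
  by unfold_locales (auto simp: algebra_simps)

lemma operatorI:
  "(\<And>x y. T (x + y) = T x + T y) \<Longrightarrow> (\<And>c x. T (c \<cdot> x) = c \<cdot> T x) \<Longrightarrow> operator T"
  by (simp add: Vector_Spaces.linear_iff vector_space_axioms)

lemma functionalI:
  "(\<And>x y. f (x + y) = f x + f y) \<Longrightarrow> (\<And>c x. f (c \<cdot> x) = c * f x) \<Longrightarrow> functional f"
  by (simp add: Vector_Spaces.linear_iff vector_space_axioms vector_space_times)

lemma operator_add: "operator T \<Longrightarrow> T (x + y) = T x + T y"
  by (simp add: Vector_Spaces.linear_iff)

lemma operator_scale: "operator T \<Longrightarrow> T (c \<cdot> x) = c \<cdot> T x"
  by (simp add: Vector_Spaces.linear_iff)

lemma operator_zero: "operator T \<Longrightarrow> T 0 = 0"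
  by (metis operator_scale scale_zero_left)

lemma operator_sum: "operator T \<Longrightarrow> T (\<Sum>i\<in>I. f i) = (\<Sum>i\<in>I. T (f i))"
  by (induction I rule: infinite_finite_induct) (auto simp: operator_add operator_zero)

lemma functional_add: "functional f \<Longrightarrow> f (x + y) = f x + f y"
  by (simp add: Vector_Spaces.linear_iff)

lemma functional_scale: "functional f \<Longrightarrow> f (c \<cdot> x) = c * f x"
  by (simp add: Vector_Spaces.linear_iff)

lemma functional_zero: "functional f \<Longrightarrow> f 0 = 0"
  by (metis functional_scale scale_zero_left mult_zero_left)

lemma functional_sum: "functional f \<Longrightarrow> f (\<Sum>i\<in>I. g i) = (\<Sum>i\<in>I. f (g i))"
  by (induction I rule: infinite_finite_induct) (auto simp: functional_add functional_zero)

lemma operator_comp: "operator S \<Longrightarrow> operator T \<Longrightarrow> operator (S \<circ> T)"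
  by (rule operatorI) (auto simp: operator_add operator_scale)

lemma operator_agree_on_span:
  assumes "operator S" "operator T" "\<And>b. b \<in> B \<Longrightarrow> S b = T b" "v \<in> span B"
  shows "S v = T v"
  using assms(4)
proof (induction rule: span_induct_alt)
  case base
  then show ?case using assms(1,2) by (simp add: operator_zero)
next
  case (step c x y)
  then show ?case using assms(1-3) by (simp add: operator_add operator_scale)
qed

lemma subspace_range: 
  assumes "operator T" 
  shows "subspace (range T)"
proof (rule subspaceI)
  show "0 \<in> range T"
    by (metis assms operator_zero rangeI)
qed (auto simp: operator_add[OF assms, symmetric] operator_scale[OF assms, symmetric])

subsection \<open>The trace\<close>

definition trace_on :: "'v set \<Rightarrow> ('v \<Rightarrow> 'v) \<Rightarrow> complex" where
  "trace_on B T = (\<Sum>b\<in>B. representation B (T b) b)"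

context
  fixes B :: "'v set"
  assumes finB: "finite B" and indB: "independent B"
begin

lemma expand_in_basis: "v \<in> span B \<Longrightarrow> (\<Sum>b\<in>B. representation B v b \<cdot> b) = v"
  using sum_representation_eq[OF indB _ finB subset_refl] by simp

lemma trace_on_add:
  assumes "\<And>b. b \<in> B \<Longrightarrow> S b \<in> span B" "\<And>b. b \<in> B \<Longrightarrow> T b \<in> span B"
  shows "trace_on B (\<lambda>v. S v + T v) = trace_on B S + trace_on B T"
  unfolding trace_on_def sum.distrib[symmetric]
  by (rule sum.cong) (auto simp: representation_add[OF indB] assms)

lemma trace_on_scale:
  assumes "\<And>b. b \<in> B \<Longrightarrow> T b \<in> span B"
  shows "trace_on B (\<lambda>v. c \<cdot> T v) = c * trace_on B T"
  unfolding trace_on_def sum_distrib_left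
  by (rule sum.cong) (auto simp: representation_scale[OF indB] assms)

lemma trace_on_commute:
  assumes "operator S" "operator T"
    and S: "\<And>b. b \<in> B \<Longrightarrow> S b \<in> span B" and T: "\<And>b. b \<in> B \<Longrightarrow> T b \<in> span B"
  shows "trace_on B (S \<circ> T) = trace_on B (T \<circ> S)"
proof -
  have expand: "representation B (P (Q b)) b
      = (\<Sum>c\<in>B. representation B (Q b) c * representation B (P c) b)"
    if "operator P" "b \<in> B" "\<And>b. b \<in> B \<Longrightarrow> P b \<in> span B" "\<And>b. b \<in> B \<Longrightarrow> Q b \<in> span B" for P Q b
  proof -
    have "P (Q b) = P (\<Sum>c\<in>B. representation B (Q b) c \<cdot> c)"
      using that by (simp add: expand_in_basis)
    also have "\<dots> = (\<Sum>c\<in>B. representation B (Q b) c \<cdot> P c)"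
      using that by (simp add: operator_sum operator_scale)
    finally have "representation B (P (Q b)) b
        = (\<Sum>c\<in>B. representation B (representation B (Q b) c \<cdot> P c) b)"
      using that by (simp add: representation_sum[OF indB] span_scale)
    then show ?thesis
      using that by (simp add: representation_scale[OF indB])
  qed
  have "trace_on B (S \<circ> T)
      = (\<Sum>b\<in>B. \<Sum>c\<in>B. representation B (T b) c * representation B (S c) b)"
    unfolding trace_on_def by (rule sum.cong) (auto simp: expand assms)
  also have "\<dots> = (\<Sum>c\<in>B. \<Sum>b\<in>B. representation B (S c) b * representation B (T b) c)"
    by (subst sum.swap) (simp add: mult.commute)
  also have "\<dots> = trace_on B (T \<circ> S)"
    unfolding trace_on_def by (rule sum.cong) (auto simp: expand assms)
  finally show ?thesis .
qed

lemma trace_on_rank_one: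
  assumes "functional f" "r \<in> span B"
  shows "trace_on B (\<lambda>v. f v \<cdot> r) = f r"
proof -
  have "trace_on B (\<lambda>v. f v \<cdot> r) = (\<Sum>b\<in>B. f (representation B r b \<cdot> b))"
    unfolding trace_on_def using assms
    by (intro sum.cong) (auto simp: representation_scale[OF indB] functional_scale)
  also have "\<dots> = f r"
    unfolding functional_sum[OF assms(1), symmetric] expand_in_basis[OF assms(2)] ..
  finally show ?thesis .
qed

end

subsection \<open>Eigenvectors\<close>

definition poly_at :: "('v \<Rightarrow> 'v) \<Rightarrow> complex poly \<Rightarrow> 'v \<Rightarrow> 'v" where
  "poly_at T p v = (\<Sum>i\<le>degree p. coeff p i \<cdot> (T ^^ i) v)"

lemma poly_at_bound:
  assumes "degree p \<le> m"
  shows "poly_at T p v = (\<Sum>i\<le>m. coeff p i \<cdot> (T ^^ i) v)"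
  unfolding poly_at_def
  by (rule sum.mono_neutral_left) (use assms in \<open>auto simp: coeff_eq_0\<close>)

lemma poly_at_linear_factor:
  assumes "operator T"
  shows "poly_at T ([:- z, 1:] * q) v = T (poly_at T q v) - z \<cdot> poly_at T q v"
proof -
  let ?m = "Suc (degree q)"
  have deg: "degree ([:- z, 1:] * q) \<le> ?m"
    using degree_mult_le[of "[:- z, 1:]" q] by (simp del: mult_pCons_left)
  have c: "coeff ([:- z, 1:] * q) i = (case i of 0 \<Rightarrow> 0 | Suc j \<Rightarrow> coeff q j) - z * coeff q i" for i
    by (cases i) (auto simp: algebra_simps)
  have "poly_at T ([:- z, 1:] * q) v
      = (\<Sum>i\<le>?m. (case i of 0 \<Rightarrow> 0 | Suc j \<Rightarrow> coeff q j) \<cdot> (T ^^ i) v)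
        - (\<Sum>i\<le>?m. (z * coeff q i) \<cdot> (T ^^ i) v)"
    unfolding poly_at_bound[OF deg] c by (simp only: scale_left_diff_distrib sum_subtractf)
  also have "(\<Sum>i\<le>?m. (z * coeff q i) \<cdot> (T ^^ i) v) = z \<cdot> poly_at T q v"
    unfolding poly_at_bound[of q ?m, OF le_SucI[OF order_refl]]
    by (simp only: scale_sum_right scale_scale)
  also have "(\<Sum>i\<le>?m. (case i of 0 \<Rightarrow> 0 | Suc j \<Rightarrow> coeff q j) \<cdot> (T ^^ i) v) = T (poly_at T q v)"
    unfolding sum.atMost_Suc_shift poly_at_def
    using assms by (simp add: operator_sum operator_scale)
  finally show ?thesis .
qed

lemma annihilating_polynomial:
  assumes "finite B" "\<And>i. (T ^^ i) v \<in> span B"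
  obtains p where "p \<noteq> 0" "poly_at T p v = 0"
proof (cases "inj_on (\<lambda>i. (T ^^ i) v) {..card B}")
  case True
  let ?f = "\<lambda>i. (T ^^ i) v"
  have "dependent (?f ` {..card B})"
    using independent_span_bound[OF assms(1), of "?f ` {..card B}"] assms(2) card_image[OF True] by auto
  then obtain u x where u: "(\<Sum>w\<in>?f ` {..card B}. u w \<cdot> w) = 0" "x \<in> ?f ` {..card B}" "u x \<noteq> 0"
    by (subst (asm) dependent_finite) auto
  define p where "p = (\<Sum>i\<le>card B. monom (u (?f i)) i)"
  have cp: "coeff p i = (if i \<le> card B then u (?f i) else 0)" for i
    unfolding p_def by (simp add: coeff_sum)
  have "degree p \<le> card B"
    by (rule degree_le) (auto simp: cp)
  then have "poly_at T p v = (\<Sum>i\<le>card B. u (?f i) \<cdot> ?f i)"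
    by (subst poly_at_bound) (auto simp: cp)
  also have "\<dots> = 0"
    using u(1) by (simp add: sum.reindex[OF True])
  finally have "poly_at T p v = 0" .
  moreover obtain i where "i \<le> card B" "x = ?f i" using u(2) by auto
  then have "coeff p i \<noteq> 0" using u(3) cp by simp
  then have "p \<noteq> 0" by auto
  ultimately show ?thesis using that by blast
next
  case False
  then obtain i j where ij: "i < j" "(T ^^ i) v = (T ^^ j) v"
    unfolding inj_on_def by (metis nat_neq_iff)
  define p :: "complex poly" where "p = monom 1 j - monom 1 i"
  have cp: "coeff p k = (if k = j then 1 else 0) - (if k = i then 1 else 0)" for k
    unfolding p_def by auto
  have "degree p \<le> j"
    by (rule degree_le) (use ij in \<open>auto simp: cp\<close>)
  then have "poly_at T p v = (\<Sum>k\<le>j. (if k = j then (T ^^ k) v else 0) - (if k = i then (T ^^ k) v else 0))"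
    by (subst poly_at_bound[of _ j]) (use ij in \<open>auto simp: cp intro!: sum.cong\<close>)
  also have "\<dots> = 0"
    using ij by (simp add: sum_subtractf)
  finally have "poly_at T p v = 0" .
  moreover have "p \<noteq> 0"
    using cp[of j] ij by auto
  ultimately show ?thesis using that by blast
qed

text \<open>
  Among the nonzero polynomials with \<open>p(T) u = 0\<close> one has least degree. If \<open>z\<close> is a root and
  \<open>p = (X - z) q\<close>, then \<open>q(T) u\<close> is nonzero by minimality, and \<open>T - z\<close> kills it.
\<close>

lemma eigenvector_exists:
  assumes T: "operator T" and R: "subspace R" "\<And>v. v \<in> R \<Longrightarrow> T v \<in> R"
    and B: "finite B" "R \<subseteq> span B" and u: "u \<in> R" "u \<noteq> 0"
  obtains z v where "v \<in> R" "v \<noteq> 0" "T v = z \<cdot> v"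
proof -
  have pow: "(T ^^ i) u \<in> R" for i
    by (induction i) (auto simp: u R)
  have polyR: "poly_at T q u \<in> R" for q
    unfolding poly_at_def by (rule subspace_sum[OF R(1)]) (auto intro: subspace_scale R(1) pow)
  let ?P = "\<lambda>p. p \<noteq> 0 \<and> poly_at T p u = 0"
  obtain p0 where "p0 \<noteq> 0" "poly_at T p0 u = 0"
    by (rule annihilating_polynomial[OF B(1), of T u]) (use pow B(2) in auto)
  then have "?P p0" by simp
  then obtain p where p: "?P p" "\<And>q. ?P q \<Longrightarrow> degree p \<le> degree q"
    using ex_has_least_nat[of ?P p0 degree] by blast
  have "degree p \<noteq> 0"
  proof
    assume "degree p = 0"
    then obtain c where "p = [:c:]" by (metis degree_eq_zeroE)
    then show False using p(1) u(2) by (auto simp: poly_at_def)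
  qed
  then obtain z where "poly p z = 0"
    using fundamental_theorem_of_algebra[of p] constant_degree[of p] by auto
  then obtain q where q: "p = [:- z, 1:] * q"
    unfolding poly_eq_0_iff_dvd by (auto elim: dvdE)
  then have "q \<noteq> 0" using p(1) by auto
  then have "degree p = Suc (degree q)"
    unfolding q by (subst degree_mult_eq) auto
  then have "poly_at T q u \<noteq> 0"
    using p(2)[of q] \<open>q \<noteq> 0\<close> by auto
  moreover have "T (poly_at T q u) = z \<cdot> poly_at T q u"
    using p(1) poly_at_linear_factor[OF T, of z q u] q by simp
  ultimately show ?thesis using that polyR by blast
qed

subsection \<open>Rank one elements of irreducible operator algebras\<close>

text \<open>
  A basis of \<open>R\<close> that contains a vector of the kernel is mapped, without that vector, to a spanning
  set of the image.
\<close>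

lemma dim_image_less:
  assumes T: "operator T" and R: "subspace R" "R \<subseteq> span B" "finite B"
    and r: "r \<in> R" "r \<noteq> 0" "T r = 0"
  shows "dim (T ` R) < dim R"
proof -
  obtain C where C: "{r} \<subseteq> C" "C \<subseteq> R" "independent C" "R \<subseteq> span C"
    using maximal_independent_subset_extend[of "{r}" R] r by auto
  have finC: "finite C"
    using independent_span_bound[OF R(3) C(3)] C(2) R(2) by blast
  have "T ` R \<subseteq> span (T ` (C - {r}))"
  proof
    fix y assume "y \<in> T ` R"
    then obtain x where x: "y = T x" "x \<in> span C" using C(4) by auto
    have "x \<in> span C \<Longrightarrow> T x \<in> span (T ` (C - {r}))"
    proof (induction rule: span_induct_alt)
      case base
      then show ?case using T by (simp add: operator_zero span_zero)
    next
      case (step c w v)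
      have "T w \<in> span (T ` (C - {r}))"
        using step.hyps r(3) by (cases "w = r") (auto intro: span_base span_zero)
      then show ?case
        using T step by (simp add: operator_add operator_scale span_add span_scale)
    qed
    then show "y \<in> span (T ` (C - {r}))" using x by simp
  qed
  then have "dim (T ` R) \<le> card (T ` (C - {r}))"
    by (rule dim_le_card) (simp add: finC)
  also have "\<dots> \<le> card (C - {r})"
    by (rule card_image_le) (simp add: finC)
  also have "\<dots> < card C"
    using C(1) finC by (intro psubset_card_mono) auto
  also have "card C = dim R"
    by (rule basis_card_eq_dim) (use C in auto)
  finally show ?thesis .
qed

text \<open>
  The heart of Burnside's theorem, in the form in which it is needed. Let \<open>p\<close> be a nonzero element
  of least rank. For \<open>a\<close> in the algebra, \<open>pa\<close> has an eigenvector in the range of \<open>p\<close>, with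
  eigenvalue \<open>c\<close>, say. Then \<open>pap - cp\<close> lies in the algebra and has smaller rank than \<open>p\<close>, so
  it vanishes. The conclusion \<open>pap = cp\<close> makes sense for an element of the opposite algebra as
  well, which is why the rank itself is not mentioned; by transitivity it forces rank one.
\<close>

lemma irreducible_algebra_has_rank_one:
  fixes W :: "'v set" and A :: "('v \<Rightarrow> 'v) set"
  assumes B: "finite B" "W \<subseteq> span B" and w0: "w0 \<in> W" "w0 \<noteq> 0"
    and A_op: "\<And>a. a \<in> A \<Longrightarrow> operator a" and A_range: "\<And>a v. a \<in> A \<Longrightarrow> a v \<in> W"
    and A_add: "\<And>a b. a \<in> A \<Longrightarrow> b \<in> A \<Longrightarrow> (\<lambda>v. a v + b v) \<in> A"
    and A_scale: "\<And>a c. a \<in> A \<Longrightarrow> (\<lambda>v. c \<cdot> a v) \<in> A"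
    and A_comp: "\<And>a b. a \<in> A \<Longrightarrow> b \<in> A \<Longrightarrow> a \<circ> b \<in> A"
    and A_trans: "\<And>w w'. w \<in> W \<Longrightarrow> w \<noteq> 0 \<Longrightarrow> w' \<in> W \<Longrightarrow> \<exists>a\<in>A. a w = w'"
  obtains p where "p \<in> A" "p \<noteq> (\<lambda>v. 0)" "\<And>a. a \<in> A \<Longrightarrow> \<exists>c. p \<circ> a \<circ> p = (\<lambda>v. c \<cdot> p v)"
proof -
  let ?P = "\<lambda>p. p \<in> A \<and> p \<noteq> (\<lambda>v. 0)"
  obtain p0 where "p0 \<in> A" "p0 w0 = w0" using A_trans w0 by blast
  then have "?P p0" using w0 by auto
  then obtain p where p: "?P p" "\<And>q. ?P q \<Longrightarrow> dim (range p) \<le> dim (range q)"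
    using ex_has_least_nat[of ?P p0 "\<lambda>p. dim (range p)"] by blast
  have "\<exists>c. p \<circ> a \<circ> p = (\<lambda>v. c \<cdot> p v)" if a: "a \<in> A" for a
  proof -
    have opp: "operator p" and opa: "operator a" using p(1) A_op a by auto
    have R: "subspace (range p)" "range p \<subseteq> span B"
      using subspace_range[OF opp] A_range p(1) B(2) by auto
    obtain u where "p u \<noteq> 0" using p(1) by auto
    then obtain z r where r: "r \<in> range p" "r \<noteq> 0" "(p \<circ> a) r = z \<cdot> r"
      by (rule_tac eigenvector_exists[OF operator_comp[OF opp opa] R(1) _ B(1) R(2), of "p u"]) auto
    \<comment> \<open>The operator \<open>pa - z\<close> maps the range of \<open>p\<close> to itself and is not injective there.\<close>
    define s where "s = (\<lambda>x. p (a x) + (- z) \<cdot> x)"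
    have ops: "operator s"
      unfolding s_def using opp opa
      by (intro operatorI) (auto simp: operator_add operator_scale algebra_simps)
    have sp: "s \<circ> p = (\<lambda>v. (p \<circ> a \<circ> p) v + (- z) \<cdot> p v)"
      by (auto simp: s_def)
    have "s \<circ> p \<in> A"
      unfolding sp by (intro A_add A_comp A_scale) (use p(1) a in auto)
    moreover have "dim (range (s \<circ> p)) < dim (range p)"
      using dim_image_less[OF ops R B(1) r(1,2)] r(3) by (auto simp: s_def image_comp)
    ultimately have "s \<circ> p = (\<lambda>v. 0)" using p(2)[of "s \<circ> p"] by force
    then have "(p \<circ> a \<circ> p) v = z \<cdot> p v" for v
      using fun_cong[OF sp, of v] by (simp add: eq_neg_iff_add_eq_0)
    then show ?thesis by (intro exI[of _ z]) auto
  qed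
  then show ?thesis using that p(1) by blast
qed

lemma rank_one_factor:
  assumes p: "operator p" and "r \<noteq> 0" and range: "\<And>v. \<exists>c. p v = c \<cdot> r"
  obtains f where "functional f" "p = (\<lambda>v. f v \<cdot> r)"
proof -
  obtain f where f: "\<And>v. p v = f v \<cdot> r" using range by metis
  have "functional f"
  proof (rule functionalI)
    fix x y
    have "f (x + y) \<cdot> r = (f x + f y) \<cdot> r"
      using operator_add[OF p, of x y] by (simp add: f scale_left_distrib)
    then show "f (x + y) = f x + f y" using \<open>r \<noteq> 0\<close> by simp
  next
    fix c x
    have "f (c \<cdot> x) \<cdot> r = (c * f x) \<cdot> r"
      using operator_scale[OF p, of c x] by (simp add: f)
    then show "f (c \<cdot> x) = c * f x" using \<open>r \<noteq> 0\<close> by simp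
  qed
  then show ?thesis using that f by blast
qed

end

section \<open>Averaging over a subgroup with finite orbits\<close>

text \<open>
  The condition \<open>xK = Kx\<close>, stated elementwise and without inverses.
\<close>

definition (in group) normalizes :: "'a \<Rightarrow> 'a set \<Rightarrow> bool" where
  "normalizes x K \<longleftrightarrow> x \<in> carrier G \<and>
    (\<forall>k\<in>K. \<exists>k'\<in>K. x \<otimes> k = k' \<otimes> x) \<and> (\<forall>k\<in>K. \<exists>k'\<in>K. k \<otimes> x = x \<otimes> k')"

locale complex_group_rep = complex_vector_space smul + group G
  for smul :: "complex \<Rightarrow> 'v::ab_group_add \<Rightarrow> 'v" (infixr "\<cdot>" 75)
    and G :: "('g, 'm) monoid_scheme" (structure) +
  fixes \<pi> :: "'g \<Rightarrow> 'v \<Rightarrow> 'v"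
  assumes rep_operator: "g \<in> carrier G \<Longrightarrow> operator (\<pi> g)"
    and rep_one: "\<pi> \<one> = id"
    and rep_mult: "g \<in> carrier G \<Longrightarrow> h \<in> carrier G \<Longrightarrow> \<pi> (g \<otimes> h) = \<pi> g \<circ> \<pi> h"
begin

lemma rep_inv [simp]:
  assumes "g \<in> carrier G"
  shows "\<pi> (inv g) (\<pi> g v) = v" "\<pi> g (\<pi> (inv g) v) = v"
  using rep_mult[of "inv g" g] rep_mult[of g "inv g"] assms rep_one by (simp_all add: fun_eq_iff)

lemma inj_rep: "g \<in> carrier G \<Longrightarrow> inj (\<pi> g)"
  by (metis injI rep_inv(1))

definition fixed :: "'g set \<Rightarrow> 'v set" where
  "fixed K = {v. \<forall>k\<in>K. \<pi> k v = v}"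

definition orbit :: "'g set \<Rightarrow> 'v \<Rightarrow> 'v set" where
  "orbit K v = (\<lambda>k. \<pi> k v) ` K"

text \<open>
  The projection to the fixed vectors that usually is defined by integrating over \<open>K\<close> with respect
  to the Haar measure. When all orbits are finite it is the mean of the orbit.
\<close>

definition average :: "'g set \<Rightarrow> 'v \<Rightarrow> 'v" where
  "average K v = (1 / of_nat (card (orbit K v))) \<cdot> \<Sum>(orbit K v)"

lemma subspace_fixed:
  assumes "K \<subseteq> carrier G"
  shows "subspace (fixed K)"
proof -
  have "operator (\<pi> k)" if "k \<in> K" for k
    using assms that rep_operator by blast
  then show ?thesis
    by (intro subspaceI) (auto simp: fixed_def operator_zero operator_add operator_scale)
qed

end

locale averaging_group = complex_group_rep smul G \<pi>
  for smul :: "complex \<Rightarrow> 'v::ab_group_add \<Rightarrow> 'v" (infixr "\<cdot>" 75)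
    and G :: "('g, 'm) monoid_scheme" (structure) and \<pi> +
  fixes K :: "'g set"
  assumes subgroup_K: "subgroup K G"
    and finite_orbit: "finite (orbit K v)"
begin

lemma K_carrier: "k \<in> K \<Longrightarrow> k \<in> carrier G"
  using subgroup.mem_carrier[OF subgroup_K] .

lemma one_K: "\<one> \<in> K"
  using subgroup.one_closed[OF subgroup_K] .

lemma K_mult: "k \<in> K \<Longrightarrow> k' \<in> K \<Longrightarrow> k \<otimes> k' \<in> K"
  using subgroup.m_closed[OF subgroup_K] .

lemma K_inv: "k \<in> K \<Longrightarrow> inv k \<in> K"
  using subgroup.m_inv_closed[OF subgroup_K] .

lemma orbit_self: "v \<in> orbit K v"
  unfolding orbit_def using one_K rep_one by (metis id_apply image_eqI)

lemma card_orbit: "card (orbit K v) \<noteq> 0"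
  using orbit_self[of v] finite_orbit[of v] by (auto simp: card_eq_0_iff)

lemma orbit_translate: "k \<in> K \<Longrightarrow> orbit K (\<pi> k v) = orbit K v"
proof -
  have sub: "orbit K (\<pi> k v) \<subseteq> orbit K v" if "k \<in> K" for k v
  proof
    fix y assume "y \<in> orbit K (\<pi> k v)"
    then obtain h where h: "h \<in> K" "y = \<pi> h (\<pi> k v)"
      by (auto simp: orbit_def)
    then have "y = \<pi> (h \<otimes> k) v"
      by (simp add: rep_mult K_carrier that)
    then show "y \<in> orbit K v"
      unfolding orbit_def using K_mult[OF h(1) that] by blast
  qed
  show "orbit K (\<pi> k v) = orbit K v" if "k \<in> K"
    using sub[OF that, of v] sub[OF K_inv[OF that], of "\<pi> k v"] K_carrier[OF that] by auto
qed

lemma average_fixed_point: "v \<in> fixed K \<Longrightarrow> average K v = v"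
proof -
  assume "v \<in> fixed K"
  then have "orbit K v = {v}"
    unfolding orbit_def fixed_def using one_K by auto
  then show ?thesis by (simp add: average_def)
qed

lemma average_in_fixed: "average K v \<in> fixed K"
proof -
  have "\<pi> k (average K v) = average K v" if k: "k \<in> K" for k
  proof -
    have op: "operator (\<pi> k)" and inj: "inj_on (\<pi> k) (orbit K v)"
      using K_carrier[OF k] rep_operator inj_rep inj_on_subset by blast+
    have "\<pi> k ` orbit K v = (\<lambda>k'. \<pi> (k \<otimes> k') v) ` K"
      unfolding orbit_def using k K_carrier by (auto simp: rep_mult image_iff)
    also have "\<dots> \<subseteq> orbit K v"
      unfolding orbit_def using k K_mult by auto
    finally have "\<pi> k ` orbit K v = orbit K v"
      using card_image[OF inj] card_subset_eq[OF finite_orbit] by metis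
    then have "\<Sum>(\<pi> k ` orbit K v) = \<Sum>(orbit K v)" by simp
    then show ?thesis
      unfolding average_def operator_scale[OF op] operator_sum[OF op]
      by (simp add: sum.reindex[OF inj])
  qed
  then show ?thesis by (simp add: fixed_def)
qed

lemma average_idem: "average K (average K v) = average K v"
  by (rule average_fixed_point[OF average_in_fixed])

text \<open>
  The mean of an orbit is defined vector by vector. This lemma shows that on any finite set of vectors
  it agrees with a single element of the group algebra of \<open>K\<close>, and linearity of the average
  follows. The elements of \<open>R\<close> represent the classes of elements of \<open>K\<close> that act in the same way on
  all vectors of \<open>S\<close>. For a fixed \<open>s\<close> the map from \<open>R\<close> to the orbit of \<open>s\<close> has fibres of equal
  size, because translation by an element of \<open>K\<close> permutes the classes.
\<close>

lemma finitely_many_average_simultaneously: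
  assumes S: "finite S"
  obtains R where "R \<subseteq> K" "finite R" "R \<noteq> {}"
    "\<And>s. s \<in> S \<Longrightarrow> average K s = (1 / of_nat (card R)) \<cdot> (\<Sum>k\<in>R. \<pi> k s)"
proof -
  \<comment> \<open>\<open>\<rho> k\<close> records the action of \<open>k\<close> on \<open>S\<close>, and \<open>rep\<close> chooses an element for each such action.\<close>
  define \<rho> where "\<rho> k = restrict (\<pi> k) S" for k
  have \<rho>_eq: "\<rho> k = \<rho> k' \<longleftrightarrow> (\<forall>s\<in>S. \<pi> k s = \<pi> k' s)" for k k'
    unfolding \<rho>_def restrict_def by (auto simp: fun_eq_iff)
  have "\<rho> ` K \<subseteq> (\<Pi>\<^sub>E s\<in>S. orbit K s)"
    by (auto simp: \<rho>_def orbit_def)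
  then have fin: "finite (\<rho> ` K)"
    by (rule finite_subset) (simp add: finite_PiE S finite_orbit)
  define rep where "rep k = inv_into K \<rho> (\<rho> k)" for k
  have rep: "rep k \<in> K" "\<rho> (rep k) = \<rho> k" if "k \<in> K" for k
    unfolding rep_def using that by (auto intro: inv_into_into f_inv_into_f)
  have rep_cong: "rep k = rep k'" if "\<rho> k = \<rho> k'" for k k'
    unfolding rep_def using that by simp
  define R where "R = rep ` K"
  have R: "R \<subseteq> K" "R \<noteq> {}" using rep one_K by (auto simp: R_def)
  have finR: "finite R"
    using fin unfolding R_def rep_def by (simp add: image_image[symmetric, of _ \<rho>])
  have rep_R: "rep k = k" if k: "k \<in> R" for k
  proof -
    obtain h where "h \<in> K" "k = rep h" using k by (auto simp: R_def)
    then show ?thesis using rep_cong[OF rep(2)] by simp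
  qed
  have "average K s = (1 / of_nat (card R)) \<cdot> (\<Sum>k\<in>R. \<pi> k s)" if s: "s \<in> S" for s
  proof -
    let ?F = "\<lambda>y. {k \<in> R. \<pi> k s = y}"
    have le: "card (?F y) \<le> card (?F z)" if y: "y \<in> orbit K s" and z: "z \<in> orbit K s" for y z
    proof -
      obtain h where "h \<in> K" "y = \<pi> h s" using y by (auto simp: orbit_def)
      then have "z \<in> orbit K y" using z orbit_translate by simp
      then obtain k where k: "k \<in> K" "z = \<pi> k y" by (auto simp: orbit_def)
      have val: "\<pi> (rep (k \<otimes> h)) t = \<pi> k (\<pi> h t)" if "h \<in> R" "t \<in> S" for h t
      proof -
        have h: "h \<in> K" using that R by blast
        then have "\<pi> (rep (k \<otimes> h)) t = \<pi> (k \<otimes> h) t"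
          using rep(2)[of "k \<otimes> h"] K_mult k(1) that(2) \<rho>_eq by blast
        then show ?thesis using h k(1) K_carrier by (simp add: rep_mult)
      qed
      have "inj_on (\<lambda>h. rep (k \<otimes> h)) (?F y)"
      proof (rule inj_onI)
        fix h h' assume h: "h \<in> ?F y" "h' \<in> ?F y" and eq: "rep (k \<otimes> h) = rep (k \<otimes> h')"
        have "\<pi> h t = \<pi> h' t" if "t \<in> S" for t
          using val[of h t] val[of h' t] h eq that injD[OF inj_rep[OF K_carrier[OF k(1)]]] by force
        then have "rep h = rep h'" by (intro rep_cong) (simp add: \<rho>_eq)
        then show "h = h'" using h rep_R by simp
      qed
      moreover have "(\<lambda>h. rep (k \<otimes> h)) ` ?F y \<subseteq> ?F z"
        using val s k(2) R K_mult k(1) by (auto simp: R_def)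
      ultimately show ?thesis
        by (rule card_inj_on_le) (simp add: finR)
    qed
    have orb: "orbit K s = (\<lambda>k. \<pi> k s) ` R"
      unfolding orbit_def R_def image_image using rep(2) s \<rho>_eq by (intro image_cong) auto
    have fiber: "card (?F y) = card (?F s)" if "y \<in> orbit K s" for y
      using le[OF that orbit_self] le[OF orbit_self that] by simp
    have "(\<Sum>k\<in>R. \<pi> k s) = (\<Sum>y\<in>orbit K s. \<Sum>k\<in>?F y. \<pi> k s)"
      unfolding orb by (rule sum.image_gen[OF finR])
    also have "\<dots> = (\<Sum>y\<in>orbit K s. of_nat (card (?F s)) \<cdot> y)"
      using fiber by (intro sum.cong) (auto simp: sum_constant_scale)
    also have "\<dots> = of_nat (card (?F s)) \<cdot> \<Sum>(orbit K s)"
      by (simp add: scale_sum_right)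
    finally have sum: "(\<Sum>k\<in>R. \<pi> k s) = of_nat (card (?F s)) \<cdot> \<Sum>(orbit K s)" .
    have "card R = (\<Sum>y\<in>orbit K s. \<Sum>k\<in>?F y. 1)"
      unfolding orb using sum.image_gen[OF finR, of "\<lambda>k. 1::nat" "\<lambda>k. \<pi> k s"] by simp
    also have "\<dots> = card (orbit K s) * card (?F s)"
      using fiber by simp
    finally have card: "card R = card (orbit K s) * card (?F s)" .
    have "card R \<noteq> 0" using finR R by simp
    then show ?thesis
      unfolding average_def sum by (simp add: card)
  qed
  then show ?thesis using that R finR by blast
qed

lemma operator_average: "operator (average K)"
proof (rule operatorI)
  fix x y
  obtain R where R: "R \<subseteq> K" and avg: "\<And>s. s \<in> {x, y, x + y} \<Longrightarrow>
      average K s = (1 / of_nat (card R)) \<cdot> (\<Sum>k\<in>R. \<pi> k s)"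
    by (rule finitely_many_average_simultaneously[of "{x, y, x + y}"]) auto
  have op: "operator (\<pi> k)" if "k \<in> R" for k
    using that R by (auto intro: rep_operator K_carrier)
  have "(\<Sum>k\<in>R. \<pi> k (x + y)) = (\<Sum>k\<in>R. \<pi> k x) + (\<Sum>k\<in>R. \<pi> k y)"
    unfolding sum.distrib[symmetric]
    by (rule sum.cong) (simp_all add: operator_add[OF op])
  then show "average K (x + y) = average K x + average K y"
    by (simp add: avg scale_right_distrib)
next
  fix c x
  obtain R where R: "R \<subseteq> K" and avg: "\<And>s. s \<in> {x, c \<cdot> x} \<Longrightarrow>
      average K s = (1 / of_nat (card R)) \<cdot> (\<Sum>k\<in>R. \<pi> k s)"
    by (rule finitely_many_average_simultaneously[of "{x, c \<cdot> x}"]) auto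
  have op: "operator (\<pi> k)" if "k \<in> R" for k
    using that R by (auto intro: rep_operator K_carrier)
  have "(\<Sum>k\<in>R. \<pi> k (c \<cdot> x)) = c \<cdot> (\<Sum>k\<in>R. \<pi> k x)"
    unfolding scale_sum_right
    by (rule sum.cong) (simp_all add: operator_scale[OF op])
  then show "average K (c \<cdot> x) = c \<cdot> average K x"
    by (simp add: avg mult.commute)
qed

lemma invariant_functional_average:
  assumes f: "functional f" and inv: "\<And>k v. k \<in> K \<Longrightarrow> f (\<pi> k v) = f v"
  shows "f (average K v) = f v"
proof -
  have "f (\<Sum>(orbit K v)) = (\<Sum>y\<in>orbit K v. f v)"
    unfolding functional_sum[OF f] by (rule sum.cong) (auto simp: orbit_def inv)
  then show ?thesis
    unfolding average_def by (simp add: functional_scale[OF f] card_orbit)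
qed

lemma average_normalizer:
  assumes x: "normalizes x K"
  shows "average K (\<pi> x v) = \<pi> x (average K v)"
proof -
  have xc: "x \<in> carrier G" using x by (simp add: normalizes_def)
  note op = rep_operator[OF xc]
  have inj: "inj_on (\<pi> x) (orbit K v)" using inj_rep[OF xc] inj_on_subset by blast
  have "orbit K (\<pi> x v) = (\<lambda>k. \<pi> (k \<otimes> x) v) ` K"
    unfolding orbit_def using xc K_carrier by (intro image_cong) (auto simp: rep_mult)
  also have "\<dots> = (\<lambda>k. \<pi> (x \<otimes> k) v) ` K"
    using x unfolding normalizes_def by (auto simp: image_iff) metis+
  also have "\<dots> = \<pi> x ` orbit K v"
    unfolding orbit_def image_image using xc K_carrier by (intro image_cong) (auto simp: rep_mult)
  finally have orb: "orbit K (\<pi> x v) = \<pi> x ` orbit K v" .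
  show ?thesis
    unfolding average_def orb operator_scale[OF op] operator_sum[OF op]
    by (simp add: card_image[OF inj] sum.reindex[OF inj])
qed

end

section \<open>Invariant forms from an anti-automorphism that preserves conjugacy classes\<close>

text \<open>
  The setting in which a representation is identified with the twist of its dual: \<open>\<sigma>\<close> is an
  involutive anti-automorphism that preserves \<open>K\<close>, and every \<open>\<sigma> g\<close> is conjugate to \<open>g\<close> by an
  element that normalizes \<open>K\<close>. The normalizing condition is what makes the trace of \<open>\<pi> g\<close>,
  compressed to the vectors fixed by \<open>K\<close>, invariant under \<open>\<sigma>\<close>.
\<close>

locale class_preserving_involution = averaging_group smul G \<pi> K
  for smul :: "complex \<Rightarrow> 'v::ab_group_add \<Rightarrow> 'v" (infixr "\<cdot>" 75)
    and G :: "('g, 'm) monoid_scheme" (structure) and \<pi> and K +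
  fixes \<sigma> :: "'g \<Rightarrow> 'g"
  assumes irreducible:
      "subspace U \<Longrightarrow> (\<And>g v. g \<in> carrier G \<Longrightarrow> v \<in> U \<Longrightarrow> \<pi> g v \<in> U) \<Longrightarrow> U = {0} \<or> U = UNIV"
    and \<sigma>_closed: "g \<in> carrier G \<Longrightarrow> \<sigma> g \<in> carrier G"
    and \<sigma>_mult: "g \<in> carrier G \<Longrightarrow> h \<in> carrier G \<Longrightarrow> \<sigma> (g \<otimes> h) = \<sigma> h \<otimes> \<sigma> g"
    and \<sigma>_invol: "g \<in> carrier G \<Longrightarrow> \<sigma> (\<sigma> g) = g"
    and \<sigma>_K: "k \<in> K \<Longrightarrow> \<sigma> k \<in> K"
    and \<sigma>_conj: "g \<in> carrier G \<Longrightarrow> \<exists>x. normalizes x K \<and> \<sigma> g \<otimes> x = x \<otimes> g"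
    and fixed_finite: "\<exists>B. finite B \<and> fixed K \<subseteq> span B"
    and fixed_nonzero: "\<exists>v\<in>fixed K. v \<noteq> 0"
begin

subsection \<open>The anti-automorphism on the operators of the group algebra\<close>

text \<open>
  The graph of the map \<open>\<Sum> c\<^sub>i \<pi>(g\<^sub>i) \<mapsto> \<Sum> c\<^sub>i \<pi>(\<sigma> g\<^sub>i)\<close>. A relation is used because the map is well
  defined on the group algebra only: that it respects equality of operators is not clear at this
  point.
\<close>

inductive paired :: "('v \<Rightarrow> 'v) \<Rightarrow> ('v \<Rightarrow> 'v) \<Rightarrow> bool" where
  paired_rep: "g \<in> carrier G \<Longrightarrow> paired (\<pi> g) (\<pi> (\<sigma> g))"
| paired_add: "paired P P' \<Longrightarrow> paired Q Q' \<Longrightarrow> paired (\<lambda>v. P v + Q v) (\<lambda>v. P' v + Q' v)"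
| paired_scale: "paired P P' \<Longrightarrow> paired (\<lambda>v. c \<cdot> P v) (\<lambda>v. c \<cdot> P' v)"

lemma paired_sym: "paired P P' \<Longrightarrow> paired P' P"
proof (induction rule: paired.induct)
  case (paired_rep g)
  then show ?case using paired.paired_rep[OF \<sigma>_closed] \<sigma>_invol by metis
qed (auto intro: paired.intros)

lemma paired_operator: "paired P P' \<Longrightarrow> operator P"
proof (induction rule: paired.induct)
  case (paired_rep g)
  then show ?case by (rule rep_operator)
qed (auto intro!: operatorI simp: operator_add operator_scale algebra_simps)

lemma paired_comp:
  assumes "paired P P'" "paired Q Q'"
  shows "paired (P \<circ> Q) (Q' \<circ> P')"
  using assms(1)
proof (induction rule: paired.induct)
  case (paired_rep g)
  note op = rep_operator[OF paired_rep]
  show ?case using assms(2)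
  proof (induction rule: paired.induct)
    case (paired_rep h)
    then have "paired (\<pi> (g \<otimes> h)) (\<pi> (\<sigma> (g \<otimes> h)))"
      using \<open>g \<in> carrier G\<close> by (intro paired.paired_rep) auto
    then show ?case
      using paired_rep \<open>g \<in> carrier G\<close> by (simp add: rep_mult \<sigma>_mult \<sigma>_closed comp_def)
  next
    case (paired_add Q Q' R R')
    then show ?case
      using paired.paired_add[OF paired_add.IH] by (simp add: comp_def operator_add[OF op])
  next
    case (paired_scale Q Q' c)
    then show ?case
      using paired.paired_scale[OF paired_scale.IH] by (simp add: comp_def operator_scale[OF op])
  qed
next
  case (paired_add P P' R R')
  note op = paired_operator[OF paired_sym[OF assms(2)]]
  show ?case
    using paired.paired_add[OF paired_add.IH] by (simp add: comp_def operator_add[OF op])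
next
  case (paired_scale P P' c)
  note op = paired_operator[OF paired_sym[OF assms(2)]]
  show ?case
    using paired.paired_scale[OF paired_scale.IH] by (simp add: comp_def operator_scale[OF op])
qed

lemma paired_zero: "paired (\<lambda>v. 0) (\<lambda>v. 0)"
  using paired_scale[OF paired_rep[OF one_closed], of 0] by simp

lemma paired_id: "paired id id"
proof -
  have "\<sigma> \<one> \<otimes> \<sigma> \<one> = \<sigma> \<one>"
    using \<sigma>_mult[OF one_closed one_closed] by simp
  then have "\<sigma> \<one> = \<one>"
    using \<sigma>_closed[OF one_closed] by simp
  then show ?thesis
    using paired_rep[OF one_closed] by (simp add: rep_one)
qed

lemma paired_sum:
  "(\<And>i. i \<in> I \<Longrightarrow> paired (P i) (P' i)) \<Longrightarrow> paired (\<lambda>v. \<Sum>i\<in>I. P i v) (\<lambda>v. \<Sum>i\<in>I. P' i v)"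
  by (induction I rule: infinite_finite_induct) (auto intro: paired_zero paired_add)

lemma paired_cyclic:
  assumes "v \<noteq> 0"
  obtains P P' where "paired P P'" "P v = w"
proof -
  let ?U = "{P v |P P'. paired P P'}"
  have "?U = {0} \<or> ?U = UNIV"
  proof (rule irreducible)
    show "subspace ?U"
    proof (rule subspaceI)
      show "0 \<in> ?U" using paired_zero by force
    next
      fix x y assume "x \<in> ?U" "y \<in> ?U"
      then show "x + y \<in> ?U" using paired_add by fast
    next
      fix c x assume "x \<in> ?U"
      then show "c \<cdot> x \<in> ?U" using paired_scale by fast
    qed
  next
    fix g x assume "g \<in> carrier G" "x \<in> ?U"
    then obtain P P' where "g \<in> carrier G" "paired P P'" "x = P v" by auto
    then have "paired (\<pi> g \<circ> P) (P' \<circ> \<pi> (\<sigma> g))" "\<pi> g x = (\<pi> g \<circ> P) v"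
      using paired_comp[OF paired_rep] by auto
    then show "\<pi> g x \<in> ?U" by blast
  qed
  moreover have "v = id v" by simp
  then have "v \<in> ?U" using paired_id by blast
  ultimately have "w \<in> ?U" using assms by auto
  then show ?thesis using that by auto
qed

abbreviation e :: "'v \<Rightarrow> 'v" where "e \<equiv> average K"
abbreviation W :: "'v set" where "W \<equiv> fixed K"

text \<open>
  The average can be replaced by group algebra elements on both sides at once. An element \<open>R\<close> of the
  group algebra of \<open>K\<close> is found for \<open>S\<close> and an element \<open>Q\<close> for \<open>S'\<close>. As \<open>\<sigma>\<close> preserves \<open>K\<close>,
  their partners \<open>R'\<close> and \<open>Q'\<close> fix the vectors fixed by \<open>K\<close>, so composing with them does no harm.
\<close>

lemma average_by_paired:
  assumes "finite S" "finite S'"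
  obtains R R' where "paired R R'" "\<And>s. s \<in> S \<Longrightarrow> R s = e s" "\<And>s. s \<in> S' \<Longrightarrow> R' s = e s"
proof -
  have avg: "\<exists>R R'. paired R R' \<and> (\<forall>s\<in>S. R s = e s) \<and> (\<forall>w\<in>W. R' w = w)"
    if S: "finite S" for S
  proof -
    obtain I where I: "I \<subseteq> K" "finite I" "I \<noteq> {}"
      and avg: "\<And>s. s \<in> S \<Longrightarrow> e s = (1 / of_nat (card I)) \<cdot> (\<Sum>k\<in>I. \<pi> k s)"
      using finitely_many_average_simultaneously[OF S] by blast
    let ?A = "\<lambda>\<tau> v. (1 / of_nat (card I)) \<cdot> (\<Sum>k\<in>I. \<pi> (\<tau> k) v)"
    have "paired (?A (\<lambda>k. k)) (?A \<sigma>)"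
      by (intro paired_scale paired_sum paired_rep) (use I K_carrier in blast)
    moreover have "?A \<sigma> w = w" if w: "w \<in> W" for w
    proof -
      have "(\<Sum>k\<in>I. \<pi> (\<sigma> k) w) = (\<Sum>k\<in>I. w)"
        by (rule sum.cong) (use I \<sigma>_K w in \<open>auto simp: fixed_def\<close>)
      then show ?thesis using I by (simp add: sum_constant_scale)
    qed
    moreover have "\<forall>s\<in>S. ?A (\<lambda>k. k) s = e s" using avg by simp
    ultimately show ?thesis by blast
  qed
  obtain R R' where R: "paired R R'" "\<And>s. s \<in> S \<Longrightarrow> R s = e s" "\<And>w. w \<in> W \<Longrightarrow> R' w = w"
    using avg[OF assms(1)] by blast
  obtain Q Q' where Q: "paired Q Q'" "\<And>s. s \<in> S' \<Longrightarrow> Q s = e s" "\<And>w. w \<in> W \<Longrightarrow> Q' w = w"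
    using avg[OF assms(2)] by blast
  show ?thesis
  proof
    show "paired (Q' \<circ> R) (R' \<circ> Q)"
      by (rule paired_comp[OF paired_sym[OF Q(1)] R(1)])
  qed (auto simp: Q R average_in_fixed)
qed

definition B :: "'v set" where
  "B = (SOME B. B \<subseteq> W \<and> independent B \<and> W \<subseteq> span B)"

lemma B_basis: "finite B" "independent B" "span B = W"
proof -
  have sub: "subspace W" by (rule subspace_fixed) (simp add: subsetI K_carrier)
  have "\<exists>B. B \<subseteq> W \<and> independent B \<and> W \<subseteq> span B"
    using maximal_independent_subset[of W] by metis
  then have B: "B \<subseteq> W \<and> independent B \<and> W \<subseteq> span B"
    unfolding B_def by (rule someI_ex)
  then show "independent B" "span B = W" using span_minimal[OF _ sub] by auto
  obtain B0 where "finite B0" "W \<subseteq> span B0" using fixed_finite by blast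
  then show "finite B" using independent_span_bound[of B0 B] B by blast
qed

subsection \<open>The Hecke algebra of the subgroup\<close>

text \<open>
  The graph of the map that \<open>\<sigma>\<close> induces on the Hecke algebra \<open>eHe\<close>, where \<open>H\<close> is the group
  algebra.
\<close>

definition corner :: "('v \<Rightarrow> 'v) \<Rightarrow> ('v \<Rightarrow> 'v) \<Rightarrow> bool" where
  "corner a a' \<longleftrightarrow> (\<exists>P P'. paired P P' \<and> a = e \<circ> P \<circ> e \<and> a' = e \<circ> P' \<circ> e)"

lemma cornerI: "paired P P' \<Longrightarrow> corner (e \<circ> P \<circ> e) (e \<circ> P' \<circ> e)"
  unfolding corner_def by (intro exI conjI) (assumption, rule refl, rule refl)

lemma cornerE:
  assumes "corner a a'"
  obtains P P' where "paired P P'" "a = e \<circ> P \<circ> e" "a' = e \<circ> P' \<circ> e"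
  using assms unfolding corner_def by (elim exE conjE) (rule that)

lemma corner_sym: "corner a a' \<Longrightarrow> corner a' a"
  by (erule cornerE) (simp add: cornerI paired_sym)

lemma corner_operator: "corner a a' \<Longrightarrow> operator a"
  by (erule cornerE) (simp add: operator_comp operator_average paired_operator)

lemma corner_range: "corner a a' \<Longrightarrow> a v \<in> W"
  by (erule cornerE) (simp add: average_in_fixed)

lemma corner_average: "corner a a' \<Longrightarrow> a (e v) = a v"
  by (erule cornerE) (simp add: average_idem)

lemma corner_add:
  assumes "corner a a'" "corner b b'"
  shows "corner (\<lambda>v. a v + b v) (\<lambda>v. a' v + b' v)"
proof -
  obtain P P' where P: "paired P P'" and a: "a = e \<circ> P \<circ> e" "a' = e \<circ> P' \<circ> e"
    using cornerE[OF assms(1)] .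
  obtain Q Q' where Q: "paired Q Q'" and b: "b = e \<circ> Q \<circ> e" "b' = e \<circ> Q' \<circ> e"
    using cornerE[OF assms(2)] .
  from P Q have "corner (e \<circ> (\<lambda>v. P v + Q v) \<circ> e) (e \<circ> (\<lambda>v. P' v + Q' v) \<circ> e)"
    by (intro cornerI paired_add)
  then show ?thesis by (simp add: a b comp_def operator_add[OF operator_average])
qed

lemma corner_scale:
  assumes "corner a a'"
  shows "corner (\<lambda>v. c \<cdot> a v) (\<lambda>v. c \<cdot> a' v)"
proof -
  obtain P P' where "paired P P'" and a: "a = e \<circ> P \<circ> e" "a' = e \<circ> P' \<circ> e"
    using cornerE[OF assms] .
  then have "corner (e \<circ> (\<lambda>v. c \<cdot> P v) \<circ> e) (e \<circ> (\<lambda>v. c \<cdot> P' v) \<circ> e)"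
    by (intro cornerI paired_scale)
  then show ?thesis by (simp add: a comp_def operator_scale[OF operator_average])
qed

text \<open>
  The product \<open>ePeQe\<close> contains an average in the middle, which is not an element of the group algebra.
  Since the fixed vectors are finite-dimensional, the average matters on finitely many vectors only,
  and there it can be replaced by such an element.
\<close>

lemma corner_comp:
  assumes "corner a a'" "corner b b'"
  shows "corner (a \<circ> b) (b' \<circ> a')"
proof -
  obtain P P' where P: "paired P P'" and a: "a = e \<circ> P \<circ> e" "a' = e \<circ> P' \<circ> e"
    using cornerE[OF assms(1)] .
  obtain Q Q' where Q: "paired Q Q'" and b: "b = e \<circ> Q \<circ> e" "b' = e \<circ> Q' \<circ> e"
    using cornerE[OF assms(2)] .
  obtain R R' where R: "paired R R'" "\<And>s. s \<in> Q ` B \<Longrightarrow> R s = e s" "\<And>s. s \<in> P' ` B \<Longrightarrow> R' s = e s"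
    using average_by_paired[of "Q ` B" "P' ` B"] B_basis(1) by auto
  have ops: "operator P" "operator P'" "operator Q" "operator Q'" "operator R" "operator R'"
    using P Q R(1) paired_operator paired_sym by auto
  have RQ: "R (Q (e v)) = e (Q (e v))" for v
    using operator_agree_on_span[OF operator_comp[OF ops(5,3)] operator_comp[OF operator_average ops(3)],
        of B "e v"] R(2) B_basis(3) average_in_fixed by auto
  have RP: "R' (P' (e v)) = e (P' (e v))" for v
    using operator_agree_on_span[OF operator_comp[OF ops(6,2)] operator_comp[OF operator_average ops(2)],
        of B "e v"] R(3) B_basis(3) average_in_fixed by auto
  have "corner (e \<circ> (P \<circ> (R \<circ> Q)) \<circ> e) (e \<circ> ((Q' \<circ> R') \<circ> P') \<circ> e)"
    by (intro cornerI paired_comp P Q R)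
  moreover have "e \<circ> (P \<circ> (R \<circ> Q)) \<circ> e = a \<circ> b" "e \<circ> ((Q' \<circ> R') \<circ> P') \<circ> e = b' \<circ> a'"
    by (auto simp: a b RQ RP average_idem)
  ultimately show ?thesis by simp
qed

lemma corner_transitive:
  assumes "w \<in> W" "w \<noteq> 0" "w' \<in> W"
  obtains a a' where "corner a a'" "a w = w'"
proof -
  obtain P P' where "paired P P'" "P w = w'" using paired_cyclic[OF assms(2)] .
  then show ?thesis
    using that[OF cornerI] assms by (simp add: average_fixed_point)
qed

text \<open>
  For a single group element this is conjugation invariance of the trace: if \<open>\<sigma> g = x g x\<inverse>\<close> and \<open>x\<close>
  normalizes \<open>K\<close>, then \<open>\<pi> x\<close> commutes with the average. The general case follows by linearity.
\<close>

lemma corner_trace: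
  assumes "corner a a'"
  shows "trace_on B a = trace_on B a'"
proof -
  obtain P P' where "paired P P'" and a: "a = e \<circ> P \<circ> e" "a' = e \<circ> P' \<circ> e"
    using cornerE[OF assms] .
  have W: "e v \<in> span B" for v using average_in_fixed B_basis(3) by simp
  from \<open>paired P P'\<close> have "trace_on B (e \<circ> P \<circ> e) = trace_on B (e \<circ> P' \<circ> e)"
  proof (induction rule: paired.induct)
    case (paired_rep g)
    obtain x where x: "normalizes x K" and conj: "\<sigma> g \<otimes> x = x \<otimes> g"
      using \<sigma>_conj[OF paired_rep] by blast
    then have xc: "x \<in> carrier G" by (simp add: normalizes_def)
    have inv_avg: "\<pi> (inv x) (e v) = e (\<pi> (inv x) v)" for v
      using average_normalizer[OF x, of "\<pi> (inv x) v"] xc by (metis rep_inv)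
    have conj': "\<pi> (\<sigma> g) (\<pi> x v) = \<pi> x (\<pi> g v)" for v
      using arg_cong[OF conj, of \<pi>] paired_rep xc by (simp add: rep_mult \<sigma>_closed fun_eq_iff)
    \<comment> \<open>Both orders of composition are compressions: \<open>ST\<close> of \<open>\<pi> (\<sigma> g)\<close>, and \<open>TS\<close> of \<open>\<pi> g\<close>.\<close>
    let ?S = "\<pi> x \<circ> (e \<circ> \<pi> g \<circ> e)" and ?T = "\<pi> (inv x)"
    have "trace_on B (?S \<circ> ?T) = trace_on B (?T \<circ> ?S)"
    proof (rule trace_on_commute[OF B_basis(1,2)])
      show "operator ?S" "operator ?T"
        using xc paired_rep by (auto intro!: operator_comp rep_operator operator_average)
      show "?S b \<in> span B" for b
        using average_normalizer[OF x] W by (metis comp_apply)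
      show "?T b \<in> span B" if "b \<in> B" for b
      proof -
        have "e b = b" using that B_basis(3) span_base average_fixed_point by blast
        then show ?thesis using inv_avg[of b] W by metis
      qed
    qed
    moreover have "?T \<circ> ?S = e \<circ> \<pi> g \<circ> e" using xc by auto
    moreover have "?S \<circ> ?T = e \<circ> \<pi> (\<sigma> g) \<circ> e"
    proof
      fix v
      have "(?S \<circ> ?T) v = e (\<pi> x (\<pi> g (\<pi> (inv x) (e v))))"
        by (simp add: inv_avg average_normalizer[OF x])
      then show "(?S \<circ> ?T) v = (e \<circ> \<pi> (\<sigma> g) \<circ> e) v"
        using xc by (simp flip: conj')
    qed
    ultimately show ?case by metis
  next
    case (paired_add P P' Q Q')
    then show ?case
      using trace_on_add[OF B_basis(1,2), of "e \<circ> P \<circ> e" "e \<circ> Q \<circ> e"] W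
        trace_on_add[OF B_basis(1,2), of "e \<circ> P' \<circ> e" "e \<circ> Q' \<circ> e"]
      by (simp add: comp_def operator_add[OF operator_average])
  next
    case (paired_scale P P' c)
    then show ?case
      using trace_on_scale[OF B_basis(1,2), of "e \<circ> P \<circ> e" c] W
        trace_on_scale[OF B_basis(1,2), of "e \<circ> P' \<circ> e" c]
      by (simp add: comp_def operator_scale[OF operator_average])
  qed
  then show ?thesis by (simp add: a)
qed

subsection \<open>Matching matrix coefficients\<close>

text \<open>
  With this lemma the relation \<open>corner\<close> becomes a map on operators. If \<open>a'\<close> were nonzero, some
  element \<open>d = b p c\<close> of rank one would satisfy \<open>tr(a' d) \<noteq> 0\<close>; but this trace equals the trace of
  \<open>d' a\<close>, where \<open>d'\<close> corresponds to \<open>d\<close>, and \<open>a = 0\<close>.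
\<close>

lemma corner_zero_image:
  assumes p: "corner p p'" "p = (\<lambda>v. f v \<cdot> r)" and f: "functional f" and nz: "p \<noteq> (\<lambda>v. 0)"
    and a: "corner a a'" "a = (\<lambda>v. 0)"
  shows "a' = (\<lambda>v. 0)"
proof (rule ccontr)
  assume "a' \<noteq> (\<lambda>v. 0)"
  then obtain w where w: "a' w \<noteq> 0" by auto
  obtain u where u: "p u \<noteq> 0" using nz by auto
  then have "f u \<noteq> 0" "r \<noteq> 0" using p(2) by auto
  have "(1 / f u) \<cdot> p u = r" using \<open>f u \<noteq> 0\<close> p(2) by simp
  then have rW: "r \<in> W"
    using corner_range[OF corner_scale[OF p(1), of "1 / f u"], of u] by simp
  have a'_op: "operator a'" using corner_operator[OF corner_sym[OF a(1)]] .
  have a'e: "a' (e w) = a' w" using corner_average[OF corner_sym[OF a(1)]] .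
  obtain b b' where b: "corner b b'" "b r = e w"
    using corner_transitive[OF rW \<open>r \<noteq> 0\<close> average_in_fixed] .
  have "a' w \<in> W" using corner_range[OF corner_sym[OF a(1)]] .
  then obtain c c' where c: "corner c c'" "c (a' w) = e u"
    using corner_transitive w average_in_fixed by metis
  have fe: "f (e u) = f u"
    using corner_average[OF p(1), of u] p(2) \<open>r \<noteq> 0\<close> by simp
  have ops: "operator b" "operator c" "operator p"
    using corner_operator b c p by blast+
  \<comment> \<open>Then \<open>a' d\<close> is the operator \<open>v \<mapsto> f(c v) a' w\<close>, whose trace is \<open>f(c a' w) = f u\<close>.\<close>
  define d where "d = b \<circ> p \<circ> c"
  have d: "corner d (c' \<circ> (p' \<circ> b'))"
    unfolding d_def by (intro corner_comp b c p)
  have "trace_on B (a' \<circ> d) = trace_on B ((c' \<circ> (p' \<circ> b')) \<circ> a)"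
    by (rule corner_trace) (intro corner_comp corner_sym[OF a(1)] d)
  also have "(c' \<circ> (p' \<circ> b')) \<circ> a = (\<lambda>v. 0 \<cdot> (0::'v))"
    using a(2) operator_zero[OF corner_operator[OF corner_sym[OF d]]] by auto
  also have "trace_on B \<dots> = 0"
    by (simp add: trace_on_def representation_zero)
  finally have "trace_on B (a' \<circ> d) = 0" .
  moreover have "a' \<circ> d = (\<lambda>v. f (c v) \<cdot> a' w)"
    unfolding d_def p(2)
    using a'_op ops b(2) a'e by (auto simp: operator_scale)
  moreover have "functional (\<lambda>v. f (c v))"
    using f ops by (auto intro!: functionalI simp: operator_add operator_scale functional_add functional_scale)
  ultimately have "f (c (a' w)) = 0"
    using trace_on_rank_one[OF B_basis(1,2), of "\<lambda>v. f (c v)" "a' w"] \<open>a' w \<in> W\<close> B_basis(3) by simp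
  then show False using c(2) fe \<open>f u \<noteq> 0\<close> by simp
qed

text \<open>
  Let \<open>p = f(_) r\<close> be an element of rank one in the Hecke algebra, and let \<open>p'\<close> correspond to it.
  The relation \<open>pap = cp\<close> is inherited by \<open>p'\<close>, so \<open>p' = f'(_) r'\<close> has rank one too. Then
  \<open>f(a r) = tr(a p) = tr(p' a') = tr(a' p') = f'(a' r')\<close>, that is, \<open>\<sigma>\<close> takes one matrix
  coefficient of \<open>\<pi>\<close> to another one.
\<close>

lemma matching_coefficients:
  obtains f r f' r' where "functional f" "functional f'" "r \<noteq> 0" "r' \<noteq> 0" "\<exists>v. f v \<noteq> 0"
    "\<And>P P'. paired P P' \<Longrightarrow> f (P r) = f' (P' r')"
proof -
  obtain w0 where w0: "w0 \<in> W" "w0 \<noteq> 0" using fixed_nonzero by blast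
  obtain p where p: "p \<in> {a. \<exists>a'. corner a a'}" "p \<noteq> (\<lambda>v. 0)"
    "\<And>a. a \<in> {a. \<exists>a'. corner a a'} \<Longrightarrow> \<exists>c. p \<circ> a \<circ> p = (\<lambda>v. c \<cdot> p v)"
  proof (rule irreducible_algebra_has_rank_one[OF B_basis(1) _ w0, of "{a. \<exists>a'. corner a a'}"])
    show "W \<subseteq> span B" using B_basis(3) by simp
    show "\<exists>a\<in>{a. \<exists>a'. corner a a'}. a w = w'" if w: "w \<in> W" "w \<noteq> 0" "w' \<in> W" for w w'
      by (rule corner_transitive[OF w]) auto
  qed (auto intro: corner_operator corner_range corner_add corner_scale corner_comp)
  obtain p' where pp': "corner p p'" using p(1) by blast
  note opp = corner_operator[OF pp'] and opp' = corner_operator[OF corner_sym[OF pp']]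
  obtain u where u: "p u \<noteq> 0" using p(2) by auto
  have ru: "p u \<in> W" using corner_range[OF pp'] .
  have "\<exists>c. p v = c \<cdot> p u" for v
  proof -
    have "p v \<in> W" "e v \<in> W" by (rule corner_range[OF pp'], rule average_in_fixed)
    then obtain a a' where a: "corner a a'" "a (p u) = e v"
      using corner_transitive[OF ru u] by metis
    then obtain c where "p \<circ> a \<circ> p = (\<lambda>v. c \<cdot> p v)" using p(3) by blast
    from fun_cong[OF this, of u] show ?thesis
      using a(2) corner_average[OF pp', of v] by auto
  qed
  then obtain f where f: "functional f" "p = (\<lambda>v. f v \<cdot> p u)"
    using rank_one_factor[OF opp u] by metis
  have fe: "f (e v) = f v" for v
  proof -
    have "f (e v) \<cdot> p u = f v \<cdot> p u" using corner_average[OF pp', of v] f(2) by metis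
    then show ?thesis using u by simp
  qed
  have trace: "f (a (p u)) = trace_on B (p' \<circ> a')" if a: "corner a a'" for a a'
  proof -
    have "a \<circ> p = (\<lambda>v. f v \<cdot> a (p u))"
      by (subst f(2)) (auto simp: operator_scale[OF corner_operator[OF a]])
    then have "f (a (p u)) = trace_on B (a \<circ> p)"
      using trace_on_rank_one[OF B_basis(1,2) f(1), of "a (p u)"] corner_range[OF a] B_basis(3) by simp
    then show ?thesis using corner_trace[OF corner_comp[OF a pp']] by simp
  qed
  have "p' \<noteq> (\<lambda>v. 0)"
  proof
    assume "p' = (\<lambda>v. 0)"
    then have z: "f (a (p u)) = 0" if "corner a a'" for a a'
      using trace[OF that] by (simp add: trace_on_def representation_zero comp_def)
    obtain a a' where "corner a a'" "a (p u) = e u"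
      using corner_transitive[OF ru u average_in_fixed] .
    then have "f u = 0" using z fe by metis
    then show False using fun_cong[OF f(2), of u] u by simp
  qed
  then obtain u' where u': "p' u' \<noteq> 0" by auto
  have ru': "p' u' \<in> W" using corner_range[OF corner_sym[OF pp']] .
  have "\<exists>c. p' v = c \<cdot> p' u'" for v
  proof -
    obtain a' a where a: "corner a' a" "a' (p' u') = e v"
      using corner_transitive[OF ru' u' average_in_fixed] .
    then obtain c where c: "p \<circ> a \<circ> p = (\<lambda>v. c \<cdot> p v)" using p(3) corner_sym by blast
    have "corner (\<lambda>v. (p \<circ> (a \<circ> p)) v + (- c) \<cdot> p v) (\<lambda>v. ((p' \<circ> a') \<circ> p') v + (- c) \<cdot> p' v)"
      by (intro corner_add corner_scale corner_comp pp' corner_sym[OF a(1)])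
    then have "(\<lambda>v. ((p' \<circ> a') \<circ> p') v + (- c) \<cdot> p' v) = (\<lambda>v. 0)"
      by (rule corner_zero_image[OF pp' f(2,1) p(2)]) (use fun_cong[OF c] in auto)
    from fun_cong[OF this, of u'] have "p' (a' (p' u')) = c \<cdot> p' u'"
      by (simp add: eq_neg_iff_add_eq_0)
    then show ?thesis
      using a(2) corner_average[OF corner_sym[OF pp'], of v] by auto
  qed
  then obtain f' where f': "functional f'" "p' = (\<lambda>v. f' v \<cdot> p' u')"
    using rank_one_factor[OF opp' u'] by metis
  have f'e: "f' (e v) = f' v" for v
  proof -
    have "f' (e v) \<cdot> p' u' = f' v \<cdot> p' u'"
      using corner_average[OF corner_sym[OF pp'], of v] f'(2) by metis
    then show ?thesis using u' by simp
  qed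
  have corner: "f (a (p u)) = f' (a' (p' u'))" if a: "corner a a'" for a a'
  proof -
    note a' = corner_sym[OF a]
    have "a' \<circ> p' = (\<lambda>v. f' v \<cdot> a' (p' u'))"
      by (subst f'(2)) (auto simp: operator_scale[OF corner_operator[OF a']])
    then have "f' (a' (p' u')) = trace_on B (a' \<circ> p')"
      using trace_on_rank_one[OF B_basis(1,2) f'(1), of "a' (p' u')"] corner_range[OF a'] B_basis(3) by simp
    also have "\<dots> = trace_on B (p' \<circ> a')"
      by (rule trace_on_commute[OF B_basis(1,2)])
        (use a a' pp' corner_operator corner_range corner_sym B_basis(3) in metis)+
    finally show ?thesis using trace[OF a] by simp
  qed
  have "f (P (p u)) = f' (P' (p' u'))" if "paired P P'" for P P'
    using corner[OF cornerI[OF that]] ru ru' by (simp add: average_fixed_point fe f'e)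
  moreover have "f u \<noteq> 0" using fun_cong[OF f(2), of u] u by force
  ultimately show ?thesis using that f(1) f'(1) u u' by blast
qed

text \<open>
  Every vector \<open>w\<close> is \<open>P' r'\<close> for some pair \<open>P, P'\<close>, and the form is \<open>\<phi> w v = f(P v)\<close>. Writing
  \<open>v = Q r\<close>, the matching of coefficients gives \<open>f(P Q r) = f'(Q' P' r') = f'(Q' w)\<close>, so the value
  does not depend on the choice of \<open>P\<close>.
\<close>

theorem invariant_form:
  obtains \<phi> :: "'v \<Rightarrow> 'v \<Rightarrow> complex" where
    "\<And>w. functional (\<phi> w)"
    "\<And>w w' v. \<phi> (w + w') v = \<phi> w v + \<phi> w' v"
    "\<And>c w v. \<phi> (c \<cdot> w) v = c * \<phi> w v"
    "\<And>g w v. g \<in> carrier G \<Longrightarrow> \<phi> w (\<pi> g v) = \<phi> (\<pi> (\<sigma> g) w) v"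
    "\<And>w. (\<And>v. \<phi> w v = 0) \<Longrightarrow> w = 0"
proof -
  obtain f r f' r' where f: "functional f" "functional f'" and r: "r \<noteq> 0" "r' \<noteq> 0"
    and nz: "\<exists>v. f v \<noteq> 0" and match: "\<And>P P'. paired P P' \<Longrightarrow> f (P r) = f' (P' r')"
    by (rule matching_coefficients) blast
  have "\<exists>P. \<exists>P'. paired P P' \<and> P' r' = w" for w
    using paired_cyclic[OF r(2), of w] paired_sym by metis
  then obtain p p' where pp: "\<And>w. paired (p w) (p' w)" "\<And>w. p' w r' = w" by metis
  define \<phi> where "\<phi> w v = f (p w v)" for w v
  have \<phi>: "\<phi> w (Q r) = f' (Q' w)" if Q: "paired Q Q'" for w Q Q'
    using match[OF paired_comp[OF pp(1) Q]] by (simp add: \<phi>_def pp(2))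
  have op: "operator (p w)" for w using paired_operator[OF pp(1)] .
  have Q: "\<exists>Q Q'. paired Q Q' \<and> Q r = v" for v
    using paired_cyclic[OF r(1), of v] by metis
  have lin: "functional (\<phi> w)" for w
    unfolding \<phi>_def using f(1) op
    by (intro functionalI) (auto simp: operator_add operator_scale functional_add functional_scale)
  have add: "\<phi> (w + w') v = \<phi> w v + \<phi> w' v" for w w' v
  proof -
    obtain Q Q' where Q: "paired Q Q'" "Q r = v" using Q by blast
    then show ?thesis
      using \<phi>[OF Q(1)] operator_add[OF paired_operator[OF paired_sym[OF Q(1)]]] functional_add[OF f(2)] by simp
  qed
  have scale: "\<phi> (c \<cdot> w) v = c * \<phi> w v" for c w v
  proof -
    obtain Q Q' where Q: "paired Q Q'" "Q r = v" using Q by blast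
    then show ?thesis
      using \<phi>[OF Q(1)] operator_scale[OF paired_operator[OF paired_sym[OF Q(1)]]] functional_scale[OF f(2)] by simp
  qed
  have equiv: "\<phi> w (\<pi> g v) = \<phi> (\<pi> (\<sigma> g) w) v" if g: "g \<in> carrier G" for g w v
  proof -
    obtain Q Q' where Q: "paired Q Q'" "Q r = v" using Q by blast
    have "\<phi> w ((\<pi> g \<circ> Q) r) = f' ((Q' \<circ> \<pi> (\<sigma> g)) w)"
      by (rule \<phi>[OF paired_comp[OF paired_rep[OF g] Q(1)]])
    then show ?thesis using \<phi>[OF Q(1)] Q(2) by simp
  qed
  let ?N = "{w. \<forall>v. \<phi> w v = 0}"
  have "?N = {0} \<or> ?N = UNIV"
  proof (rule irreducible)
    show "subspace ?N"
      using scale[of 0] by (intro subspaceI) (auto simp: add scale)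
    show "\<pi> g w \<in> ?N" if g: "g \<in> carrier G" and "w \<in> ?N" for g w
    proof -
      have "\<phi> (\<pi> g w) v = \<phi> w (\<pi> (\<sigma> g) v)" for v
        using equiv[OF \<sigma>_closed[OF g]] \<sigma>_invol[OF g] by simp
      then show ?thesis using that by simp
    qed
  qed
  moreover have "?N \<noteq> UNIV"
  proof
    assume "?N = UNIV"
    then have "\<phi> r' v = 0" for v by auto
    moreover have "\<phi> r' (Q r) = f (Q r)" if "paired Q Q'" for Q Q'
      using \<phi>[OF that] match[OF that] by simp
    ultimately have "f v = 0" for v using Q by metis
    then show False using nz by simp
  qed
  ultimately have "w = 0" if "\<And>v. \<phi> w v = 0" for w
    using that by auto
  then show ?thesis using that[of \<phi>] lin add scale equiv by blast
qed

end

section \<open>Squares and residues in the local field\<close>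

context nonarch_local_field
begin

abbreviation I :: "int \<Rightarrow> 'f set" where "I \<equiv> ideal_pow ord"

lemma ord_one: "ord 1 = 0"
  using ord_mult[of 1 1] by simp

lemma ord_minus: "x \<noteq> 0 \<Longrightarrow> ord (- x) = ord x"
  using ord_mult[of "-1" "-1"] ord_mult[of "-1" x] ord_one by simp

lemma ord_inverse: "x \<noteq> 0 \<Longrightarrow> ord (inverse x) = - ord x"
  using ord_mult[of x "inverse x"] ord_one by simp

lemma ord_divide: "x \<noteq> 0 \<Longrightarrow> y \<noteq> 0 \<Longrightarrow> ord (x / y) = ord x - ord y"
  by (simp add: divide_inverse ord_mult ord_inverse)

lemma ideal_zero [simp]: "0 \<in> I k"
  by (simp add: ideal_pow_def)

lemma ideal_one: "1 \<in> I 0"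
  by (simp add: ideal_pow_def ord_one)

lemma ideal_add: "x \<in> I k \<Longrightarrow> y \<in> I k \<Longrightarrow> x + y \<in> I k"
  using ord_add[of x y] by (cases "x = 0"; cases "y = 0"; cases "x + y = 0") (auto simp: ideal_pow_def)

lemma ideal_minus: "x \<in> I k \<Longrightarrow> - x \<in> I k"
  using ord_minus[of x] by (cases "x = 0") (auto simp: ideal_pow_def)

lemma ideal_diff: "x \<in> I k \<Longrightarrow> y \<in> I k \<Longrightarrow> x - y \<in> I k"
  using ideal_add[of x k "- y"] ideal_minus by simp

lemma ideal_mult: "x \<in> I j \<Longrightarrow> y \<in> I k \<Longrightarrow> x * y \<in> I (j + k)"
  using ord_mult[of x y] by (cases "x = 0"; cases "y = 0") (auto simp: ideal_pow_def)

lemma ideal_mult_right: "x \<in> I k \<Longrightarrow> y \<in> I 0 \<Longrightarrow> x * y \<in> I k"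
  using ideal_mult[of x k y 0] by simp

lemma ideal_mult_left: "x \<in> I 0 \<Longrightarrow> y \<in> I k \<Longrightarrow> x * y \<in> I k"
  using ideal_mult[of x 0 y k] by simp

lemma ideal_mono: "x \<in> I k \<Longrightarrow> j \<le> k \<Longrightarrow> x \<in> I j"
  by (auto simp: ideal_pow_def)

lemma unit_of_near_one:
  assumes "x - 1 \<in> I k" "1 \<le> k"
  shows "x \<noteq> 0" "ord x = 0" "x \<in> I 0" "inverse x \<in> I 0"
proof -
  have x1: "x - 1 \<in> I 1" using ideal_mono assms by blast
  have one: "1 \<notin> I 1" by (simp add: ideal_pow_def ord_one)
  have "x \<notin> I 1"
  proof
    assume "x \<in> I 1"
    from ideal_diff[OF this x1] show False using one by simp
  qed
  moreover have x0: "x \<in> I 0"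
    using ideal_add[OF ideal_mono[OF x1, of 0] ideal_one] by simp
  ultimately show "x \<noteq> 0" "ord x = 0" "x \<in> I 0" by (auto simp: ideal_pow_def)
  then show "inverse x \<in> I 0" by (simp add: ideal_pow_def ord_inverse)
qed

text \<open>
  The square root is \<open>1 + 2 L\<close>, where \<open>L\<close> solves \<open>L = u - L\<^sup>2\<close>; this equation is contracting on the
  maximal ideal, also in residue characteristic two.
\<close>

lemma near_one_is_square:
  assumes u: "u \<in> I 1"
  obtains y where "1 + 4 * u = y * y"
proof -
  define X where "X = rec_nat (0::'f) (\<lambda>_ z. u - z * z)"
  have X0: "X 0 = 0" and XS: "X (Suc i) = u - X i * X i" for i
    by (simp_all add: X_def)
  have X1: "X i \<in> I 1" for i
  proof (induction i)
    case (Suc i)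
    then show ?case
      unfolding XS using ideal_diff[OF u] ideal_mono[OF ideal_mult[OF Suc Suc], of 1] by simp
  qed (simp add: X0)
  have step: "X (Suc i) - X i \<in> I (int i)" for i
  proof (induction i)
    case 0
    then show ?case using ideal_mono[OF u, of 0] by (simp add: X0 XS)
  next
    case (Suc i)
    have "X (Suc (Suc i)) - X (Suc i) = - ((X (Suc i) - X i) * (X (Suc i) + X i))"
      by (simp add: XS[of "Suc i"] XS[of i] algebra_simps)
    moreover have "(X (Suc i) - X i) * (X (Suc i) + X i) \<in> I (int i + 1)"
      by (intro ideal_mult Suc ideal_add X1)
    ultimately show ?case using ideal_minus by (simp add: add.commute)
  qed
  have tail: "X (i + d) - X i \<in> I (int i)" for i d
  proof (induction d)
    case (Suc d)
    have "X (Suc (i + d)) - X (i + d) \<in> I (int i)"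
      using ideal_mono[OF step[of "i + d"]] by simp
    from ideal_add[OF this Suc] show ?case by simp
  qed simp
  have "\<exists>L. \<forall>k. \<exists>N. \<forall>i\<ge>N. X i - L \<in> I k"
  proof (rule ord_complete)
    fix k
    have "X i - X j \<in> I k" if "i \<ge> nat k" "j \<ge> nat k" for i j
    proof -
      have "X i - X (nat k) \<in> I (int (nat k))" "X j - X (nat k) \<in> I (int (nat k))"
        using tail[of "nat k" "i - nat k"] tail[of "nat k" "j - nat k"] that by simp_all
      from ideal_diff[OF this] show ?thesis by (auto intro: ideal_mono)
    qed
    then show "\<exists>N. \<forall>i\<ge>N. \<forall>j\<ge>N. X i - X j \<in> I k" by blast
  qed
  then obtain L where L: "\<And>k. \<exists>N. \<forall>i\<ge>N. X i - L \<in> I k" by blast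
  have "L + L * L - u \<in> I k" if k: "k \<ge> 1" for k
  proof -
    obtain N where N: "\<And>i. i \<ge> N \<Longrightarrow> X i - L \<in> I k" using L by blast
    have d: "L - X N \<in> I k" "L - X (Suc N) \<in> I k"
      using ideal_minus[OF N[of N]] ideal_minus[OF N[of "Suc N"]] by simp_all
    have "L \<in> I 0"
      using ideal_add[OF ideal_mono[OF d(1), of 0] ideal_mono[OF X1[of N], of 0]] k by simp
    then have "L + X N \<in> I 0"
      using ideal_add ideal_mono[OF X1[of N], of 0] by simp
    from ideal_add[OF d(2) ideal_mult_right[OF d(1) this]]
    have "(L - X (Suc N)) + (L - X N) * (L + X N) \<in> I k" .
    then show ?thesis by (simp add: XS algebra_simps)
  qed
  from this[of "max 1 (ord (L + L * L - u) + 1)"] have "L + L * L - u = 0"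
    by (simp add: ideal_pow_def)
  then have u: "u = L + L * L" by simp
  have "1 + 4 * u = (1 + 2 * L) * (1 + 2 * L)"
    unfolding u by (simp add: algebra_simps)
  then show ?thesis using that by blast
qed

text \<open>
  From this level on the congruence subgroups consist of matrices whose diagonal entries and
  determinant are squares, and these are invisible to the quadratic Hilbert symbol.
\<close>

definition square_level :: nat where
  "square_level = (SOME l. 1 \<le> l \<and> (\<forall>x. x - 1 \<in> I (int l) \<longrightarrow> (\<exists>y. x = y * y)))"

lemma square_level: "1 \<le> square_level" "x - 1 \<in> I (int square_level) \<Longrightarrow> \<exists>y. x = y * y"
proof -
  \<comment> \<open>The factor \<open>4\<close> in \<open>1 + 4 u\<close> is absorbed; it is not a unit in residue characteristic two.\<close>
  define l where "l = nat (ord 4) + 1"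
  have l: "1 \<le> l" "1 + ord 4 \<le> int l" by (simp_all add: l_def)
  have "\<exists>y. x = y * y" if x: "x - 1 \<in> I (int l)" for x
  proof -
    have "(x - 1) / 4 \<in> I 1"
      using x l by (cases "x = 1") (auto simp: ideal_pow_def ord_divide)
    then obtain y where "1 + 4 * ((x - 1) / 4) = y * y"
      by (rule near_one_is_square)
    then have "x = y * y" by (simp add: field_simps)
    then show ?thesis ..
  qed
  then have "1 \<le> l \<and> (\<forall>x. x - 1 \<in> I (int l) \<longrightarrow> (\<exists>y. x = y * y))" using l by auto
  then have "1 \<le> square_level \<and> (\<forall>x. x - 1 \<in> I (int square_level) \<longrightarrow> (\<exists>y. x = y * y))"
    unfolding square_level_def by (rule someI)
  then show "1 \<le> square_level" "x - 1 \<in> I (int square_level) \<Longrightarrow> \<exists>y. x = y * y" by auto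
qed

lemma finite_residues:
  obtains F where "finite F" "F \<subseteq> I (int j)" "\<And>x. x \<in> I (int j) \<Longrightarrow> \<exists>y\<in>F. x - y \<in> I (int j + 1)"
proof -
  obtain p where p: "p \<noteq> 0" "ord p = 1" using uniformizer_exists by blast
  have pj: "p ^ j \<noteq> 0" "ord (p ^ j) = int j"
    using p by (induction j) (auto simp: ord_one ord_mult)
  let ?R = "{(x, y). x \<in> I 0 \<and> y \<in> I 0 \<and> x - y \<in> I 1}"
  define F where "F = (\<lambda>C. p ^ j * (SOME y. y \<in> C)) ` (I 0 // ?R)"
  have cls: "(SOME y. y \<in> ?R `` {x}) \<in> ?R `` {x}" if "x \<in> I 0" for x
    by (rule someI[of _ x]) (use that in auto)
  have pI: "p ^ j * z \<in> I (int j + k)" if "z \<in> I k" for z k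
    using ideal_mult[OF _ that, of "p ^ j" "int j"] pj by (simp add: ideal_pow_def)
  have "finite F" using finite_residue_field by (simp add: F_def)
  moreover have "F \<subseteq> I (int j)"
  proof
    fix z assume "z \<in> F"
    then obtain x where "x \<in> I 0" "z = p ^ j * (SOME y. y \<in> ?R `` {x})"
      unfolding F_def quotient_def by blast
    then show "z \<in> I (int j)" using cls[of x] pI[of _ 0] by auto
  qed
  moreover have "\<exists>y\<in>F. x - y \<in> I (int j + 1)" if x: "x \<in> I (int j)" for x
  proof -
    have x0: "x / p ^ j \<in> I 0"
      using x pj by (auto simp: ideal_pow_def ord_divide)
    define y where "y = (SOME y. y \<in> ?R `` {x / p ^ j})"
    have "x / p ^ j - y \<in> I 1" using cls[OF x0] by (auto simp: y_def)
    from pI[OF this] have "p ^ j * (x / p ^ j - y) \<in> I (int j + 1)" .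
    moreover have "p ^ j * (x / p ^ j - y) = x - p ^ j * y"
      using pj(1) by (simp add: right_diff_distrib del: power_eq_0_iff)
    ultimately have "x - p ^ j * y \<in> I (int j + 1)" by simp
    moreover have "p ^ j * y \<in> F"
      unfolding F_def quotient_def y_def using x0 by blast
    ultimately show ?thesis by blast
  qed
  ultimately show ?thesis using that by blast
qed

end

section \<open>Two by two matrices\<close>

definition mat2 :: "'a \<Rightarrow> 'a \<Rightarrow> 'a \<Rightarrow> 'a \<Rightarrow> 'a::zero^2^2" where
  "mat2 a b c d = vector [vector [a, b], vector [c, d]]"

lemma mat2_nth [simp]:
  "mat2 a b c d $ 1 $ 1 = a" "mat2 a b c d $ 1 $ 2 = b"
  "mat2 a b c d $ 2 $ 1 = c" "mat2 a b c d $ 2 $ 2 = d"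
  by (simp_all add: mat2_def)

lemma mat2_cases: obtains a b c d where "A = mat2 a b c d"
proof
  show "A = mat2 (A $ 1 $ 1) (A $ 1 $ 2) (A $ 2 $ 1) (A $ 2 $ 2)"
    by (simp add: vec_eq_iff forall_2)
qed

lemma mat2_eq_iff [simp]:
  "mat2 a b c d = mat2 a' b' c' d' \<longleftrightarrow> a = a' \<and> b = b' \<and> c = c' \<and> d = d'"
  by (metis mat2_nth)

lemma mat2_mult [simp]:
  "mat2 a b c d ** mat2 a' b' c' d'
    = mat2 (a * a' + b * c') (a * b' + b * d') (c * a' + d * c') (c * b' + d * d' :: 'a::comm_ring_1)"
  by (simp add: vec_eq_iff forall_2 matrix_matrix_mult_def sum_2)

lemma det_mat2 [simp]: "det (mat2 a b c d) = a * d - b * c"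
  by (simp add: det_2)

lemma mat_1_mat2: "mat 1 = mat2 1 0 0 1"
  by (simp add: vec_eq_iff forall_2 mat_def)

lemma u_mat_mat2: "u_mat a = mat2 a 0 0 (- a)"
  by (simp add: u_mat_def mat2_def)

lemma kubota_X_mat2 [simp]: "kubota_X (mat2 a b c d) = (if c \<noteq> 0 then c else d)"
  by (simp add: kubota_X_def)

lemma kubota_X_nonzero: "det g \<noteq> 0 \<Longrightarrow> kubota_X g \<noteq> 0"
  by (cases g rule: mat2_cases) auto

lemma mat2_inverse:
  fixes a b c d :: "'a::field"
  assumes D: "D = a * d - b * c" and "D \<noteq> 0"
  shows "mat2 (d / D) (- b / D) (- c / D) (a / D) ** mat2 a b c d = mat 1"
    and "det (mat2 (d / D) (- b / D) (- c / D) (a / D)) = 1 / D"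
proof -
  have 1: "(a * d - b * c) / D = 1" using assms by simp
  have "d / D * a + - b / D * c = (a * d - b * c) / D"
    "- c / D * b + a / D * d = (a * d - b * c) / D"
    by (simp_all add: diff_divide_distrib mult.commute)
  then show "mat2 (d / D) (- b / D) (- c / D) (a / D) ** mat2 a b c d = mat 1"
    unfolding 1 by (simp add: mat_1_mat2 mult.commute)
  have "d / D * (a / D) - - b / D * (- c / D) = (a * d - b * c) / D / D"
    by (simp add: diff_divide_distrib mult.commute)
  then show "det (mat2 (d / D) (- b / D) (- c / D) (a / D)) = 1 / D"
    unfolding 1 by simp
qed

section \<open>The metaplectic group\<close>

context hilbert_symbol
begin

abbreviation GG :: "'f mp monoid" where "GG \<equiv> mp_group n hs"

lemma roots_one: "1 \<in> roots_of_unity n"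
  by (simp add: roots_of_unity_def)

lemma roots_mult: "x \<in> roots_of_unity n \<Longrightarrow> y \<in> roots_of_unity n \<Longrightarrow> x * y \<in> roots_of_unity n"
  by (simp add: roots_of_unity_def power_mult_distrib)

lemma roots_inverse: "x \<in> roots_of_unity n \<Longrightarrow> inverse x \<in> roots_of_unity n"
  by (simp add: roots_of_unity_def power_inverse)

lemma roots_nonzero: "x \<in> roots_of_unity n \<Longrightarrow> x \<noteq> 0"
  using n_ge_2 by (auto simp: roots_of_unity_def power_0_left)

lemma hs_one_left: "b \<noteq> 0 \<Longrightarrow> hs 1 b = 1"
  using hs_mult_left[of 1 1 b] roots_nonzero[OF hs_in[of 1 b]] by simp

lemma hs_one_right: "a \<noteq> 0 \<Longrightarrow> hs a 1 = 1"
  using hs_mult_right[of a 1 1] roots_nonzero[OF hs_in[of a 1]] by simp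

lemma mp_mult: "(g, \<epsilon>) \<otimes>\<^bsub>GG\<^esub> (h, \<eta>) = (g ** h, kubota_cocycle hs g h * \<epsilon> * \<eta>)"
  by (simp add: mp_group_def)

lemma mp_one: "\<one>\<^bsub>GG\<^esub> = (mat 1, 1)"
  by (simp add: mp_group_def)

lemma mp_carrier: "(g, \<epsilon>) \<in> carrier GG \<longleftrightarrow> det g \<noteq> 0 \<and> \<epsilon> \<in> roots_of_unity n"
  by (simp add: mp_group_def)

lemma cocycle_in:
  assumes "det g \<noteq> 0" "det h \<noteq> 0"
  shows "kubota_cocycle hs g h \<in> roots_of_unity n"
proof -
  have "det (g ** h) \<noteq> 0" using assms by (simp add: det_mul)
  then show ?thesis
    unfolding kubota_cocycle_def using assms by (intro hs_in) (auto simp: kubota_X_nonzero)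
qed

lemma cocycle_one_left: "det h \<noteq> 0 \<Longrightarrow> kubota_cocycle hs (mat 1) h = 1"
  using kubota_X_nonzero[of h]
  by (simp add: kubota_cocycle_def hs_one_right) (simp add: mat_1_mat2 hs_one_right)

lemma cocycle_one_right: "det g \<noteq> 0 \<Longrightarrow> kubota_cocycle hs g (mat 1) = 1"
  using kubota_X_nonzero[of g]
  by (simp add: kubota_cocycle_def) (simp add: mat_1_mat2 hs_one_left)

lemma mp_closed: "x \<in> carrier GG \<Longrightarrow> y \<in> carrier GG \<Longrightarrow> x \<otimes>\<^bsub>GG\<^esub> y \<in> carrier GG"
  by (cases x; cases y) (auto simp: mp_mult mp_carrier det_mul intro!: roots_mult cocycle_in)

lemma mp_one_closed: "\<one>\<^bsub>GG\<^esub> \<in> carrier GG"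
  by (simp add: mp_one mp_carrier roots_one)

lemma mp_one_left: "x \<in> carrier GG \<Longrightarrow> \<one>\<^bsub>GG\<^esub> \<otimes>\<^bsub>GG\<^esub> x = x"
  by (cases x) (simp add: mp_mult mp_one mp_carrier cocycle_one_left)

text \<open>
  Multiplication by a central element. With this notation central factors are moved out of products
  by simplification, and without membership conditions.
\<close>

definition scale_mp :: "'f \<Rightarrow> 'f mp \<Rightarrow> 'f mp" where
  "scale_mp \<epsilon> x = (fst x, \<epsilon> * snd x)"

lemma central_mult: "x \<in> carrier GG \<Longrightarrow> mp_central \<epsilon> \<otimes>\<^bsub>GG\<^esub> x = scale_mp \<epsilon> x"
  by (cases x) (simp add: mp_mult mp_carrier mp_central_def cocycle_one_left scale_mp_def)

lemma mp_left_inverse: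
  assumes "x \<in> carrier GG"
  shows "\<exists>y\<in>carrier GG. y \<otimes>\<^bsub>GG\<^esub> x = \<one>\<^bsub>GG\<^esub>"
proof -
  obtain a b c d \<epsilon> where x: "x = (mat2 a b c d, \<epsilon>)" by (metis mat2_cases surj_pair)
  define D where "D = a * d - b * c"
  have D: "D \<noteq> 0" and \<epsilon>: "\<epsilon> \<in> roots_of_unity n"
    using assms by (auto simp: x mp_carrier D_def)
  define g where "g = mat2 (d / D) (- b / D) (- c / D) (a / D)"
  define \<eta> where "\<eta> = inverse (kubota_cocycle hs g (mat2 a b c d) * \<epsilon>)"
  have g: "g ** mat2 a b c d = mat 1" "det g \<noteq> 0"
    using mat2_inverse[OF D_def D] D by (simp_all add: g_def del: det_mat2)
  have c: "kubota_cocycle hs g (mat2 a b c d) * \<epsilon> \<in> roots_of_unity n"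
    using cocycle_in[OF g(2), of "mat2 a b c d"] D \<epsilon> by (auto simp: D_def intro: roots_mult)
  then have "(g, \<eta>) \<in> carrier GG"
    using g roots_inverse[OF c] by (simp only: mp_carrier \<eta>_def simp_thms)
  moreover have "(g, \<eta>) \<otimes>\<^bsub>GG\<^esub> x = \<one>\<^bsub>GG\<^esub>"
    using roots_nonzero[OF c] by (simp add: x mp_mult mp_one g \<eta>_def field_simps)
  ultimately show ?thesis by blast
qed

text \<open>
  Associativity of the cover is the cocycle identity for the Kubota cocycle. It comes for free from a
  genuine representation: two elements of the same fibre with the same action are equal, as \<open>\<xi>\<close> is
  injective, and both ways of bracketing a product act in the same way.
\<close>

lemma group_of_genuine_rep:
  fixes smul :: "complex \<Rightarrow> 'v::ab_group_add \<Rightarrow> 'v"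
  assumes \<xi>: "injective_character n \<xi>" and rep: "group_rep GG smul \<pi>"
    and nz: "(v::'v) \<noteq> 0" and gen: "genuine_rep n hs \<xi> smul \<pi>"
  shows "group GG"
proof -
  interpret vector_space smul using rep by (simp add: group_rep_def)
  have mult: "\<pi> (x \<otimes>\<^bsub>GG\<^esub> y) = \<pi> x \<circ> \<pi> y" if "x \<in> carrier GG" "y \<in> carrier GG" for x y
    using rep that by (simp add: group_rep_def)
  have genuine: "\<pi> (g, \<epsilon>) w = smul (\<xi> \<epsilon>) (\<pi> (g, 1) w)"
    if "det g \<noteq> 0" "\<epsilon> \<in> roots_of_unity n" for g \<epsilon> w
  proof -
    have g1: "(g, 1) \<in> carrier GG" using that roots_one by (simp add: mp_carrier)
    then have "\<pi> (mp_central \<epsilon> \<otimes>\<^bsub>GG\<^esub> (g, 1)) w = smul (\<xi> \<epsilon>) (\<pi> (g, 1) w)"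
      using gen that by (auto simp: genuine_rep_def)
    then show ?thesis by (simp add: central_mult[OF g1] scale_mp_def)
  qed
  have faithful: "\<epsilon> = \<eta>" if g: "(g, \<epsilon>) \<in> carrier GG" "(g, \<eta>) \<in> carrier GG"
    and eq: "\<pi> (g, \<epsilon>) = \<pi> (g, \<eta>)" for g \<epsilon> \<eta>
  proof -
    have det: "det g \<noteq> 0" and \<epsilon>: "\<epsilon> \<in> roots_of_unity n" "\<eta> \<in> roots_of_unity n"
      using g by (auto simp: mp_carrier)
    obtain y where y: "y \<in> carrier GG" "y \<otimes>\<^bsub>GG\<^esub> (g, \<epsilon>) = \<one>\<^bsub>GG\<^esub>"
      using mp_left_inverse[OF g(1)] by blast
    have "\<pi> y (\<pi> (g, \<epsilon>) v) = v"
      using mult[OF y(1) g(1)] y(2) rep by (simp add: group_rep_def fun_eq_iff)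
    moreover have "\<pi> y 0 = 0"
      using rep y(1) by (auto simp: group_rep_def Vector_Spaces.linear_iff)
        (metis add_cancel_right_right)
    ultimately have "\<pi> (g, \<epsilon>) v \<noteq> 0" using nz by metis
    then have "\<pi> (g, 1) v \<noteq> 0"
      using genuine[OF det \<epsilon>(1)] by auto
    moreover have "smul (\<xi> \<epsilon>) (\<pi> (g, 1) v) = smul (\<xi> \<eta>) (\<pi> (g, 1) v)"
      using genuine[OF det \<epsilon>(1), of v] genuine[OF det \<epsilon>(2), of v] eq by metis
    ultimately have "\<xi> \<epsilon> = \<xi> \<eta>" by simp
    then show ?thesis
      using \<xi> \<epsilon> by (auto simp: injective_character_def dest: inj_onD)
  qed
  show ?thesis
  proof (rule groupI)
    fix x y z assume xyz: "x \<in> carrier GG" "y \<in> carrier GG" "z \<in> carrier GG"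
    let ?l = "x \<otimes>\<^bsub>GG\<^esub> y \<otimes>\<^bsub>GG\<^esub> z" and ?r = "x \<otimes>\<^bsub>GG\<^esub> (y \<otimes>\<^bsub>GG\<^esub> z)"
    have fst: "fst ?l = fst ?r"
      by (cases x; cases y; cases z) (simp add: mp_mult matrix_mul_assoc)
    have c: "?l \<in> carrier GG" "?r \<in> carrier GG" using xyz by (simp_all add: mp_closed)
    have "\<pi> ?l = \<pi> ?r" using xyz by (simp add: mult mp_closed comp_assoc)
    then have "snd ?l = snd ?r"
      using faithful[of "fst ?l" "snd ?l" "snd ?r"] c fst by (metis prod.collapse)
    then show "?l = ?r" using fst by (rule prod_eqI[rotated])
  qed (use mp_closed mp_one_closed mp_one_left mp_left_inverse in auto)
qed

end

section \<open>The double cover\<close>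

text \<open>
  The assumption amounts to the cocycle identity for the Kubota cocycle, which
  \<open>group_of_genuine_rep\<close> provides.
\<close>

locale double_cover = hilbert_symbol ord 2 hs for ord :: "'f::field_char_0 \<Rightarrow> int" and hs +
  assumes group_GG: "group GG"
begin

sublocale group GG by (rule group_GG)

lemma hs_square: "a \<noteq> 0 \<Longrightarrow> b \<noteq> 0 \<Longrightarrow> hs a b * hs a b = 1"
  using hs_in[of a b] by (simp add: roots_of_unity_def power2_eq_square)

lemma hs_symmetric: "a \<noteq> 0 \<Longrightarrow> b \<noteq> 0 \<Longrightarrow> hs a b = hs b a"
  using hs_square[of a b] hs_skew[of a b] by (metis mult_cancel_left mult_zero_left zero_neq_one)

lemma hs_inverse_left: "a \<noteq> 0 \<Longrightarrow> b \<noteq> 0 \<Longrightarrow> hs (inverse a) b = hs a b"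
  using hs_mult_left[of a "inverse a" b] hs_square[of a b]
  by (simp add: hs_one_left) (metis mult_cancel_left mult_zero_left zero_neq_one)

lemma hs_inverse_right: "a \<noteq> 0 \<Longrightarrow> b \<noteq> 0 \<Longrightarrow> hs a (inverse b) = hs a b"
  by (simp add: hs_symmetric[of a] hs_inverse_left)

text \<open>
  By the Steinberg relation for \<open>a\<close> and for \<open>a\<inverse>\<close>, as \<open>- a = (1 - a) / (1 - a\<inverse>)\<close>.
\<close>

lemma hs_neg_self:
  assumes "a \<noteq> 0"
  shows "hs a (- a) = 1"
proof (cases "a = 1")
  case True
  then show ?thesis by (simp add: hs_one_left)
next
  case False
  have "- a = (1 - a) * inverse (1 - inverse a)"
    using assms False by (simp add: field_simps)
  then have "hs a (- a) = hs a (1 - a) * hs a (inverse (1 - inverse a))"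
    using assms False by (simp add: hs_mult_right)
  also have "hs a (inverse (1 - inverse a)) = hs (inverse a) (1 - inverse a)"
    using assms False by (simp add: hs_inverse_left hs_inverse_right)
  finally show ?thesis
    using assms False by (simp add: hs_steinberg)
qed

definition is_square :: "'f \<Rightarrow> bool" where
  "is_square s \<longleftrightarrow> s \<noteq> 0 \<and> (\<exists>y. s = y * y)"

lemma is_square_mult: "is_square s \<Longrightarrow> is_square t \<Longrightarrow> is_square (s * t)"
  unfolding is_square_def by (metis mult.assoc mult.left_commute mult_eq_0_iff)

lemma is_square_divide: "is_square s \<Longrightarrow> is_square t \<Longrightarrow> is_square (s / t)"
  unfolding is_square_def by (metis divide_eq_0_iff times_divide_times_eq)

lemma hs_square_right: "is_square s \<Longrightarrow> a \<noteq> 0 \<Longrightarrow> hs a s = 1"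
  unfolding is_square_def using hs_mult_right hs_square by fastforce

lemma hs_square_left: "is_square s \<Longrightarrow> a \<noteq> 0 \<Longrightarrow> hs s a = 1"
  using hs_square_right[of s a] hs_symmetric[of s a] by (simp add: is_square_def)

lemma mp_mult_mat2:
  "(mat2 a b c d, \<epsilon>) \<otimes>\<^bsub>GG\<^esub> (mat2 a' b' c' d', \<eta>) =
    (mat2 (a * a' + b * c') (a * b' + b * d') (c * a' + d * c') (c * b' + d * d'),
     kubota_cocycle hs (mat2 a b c d) (mat2 a' b' c' d') * \<epsilon> * \<eta>)"
  by (simp add: mp_mult)

lemma cocycle_mat2:
  "kubota_cocycle hs (mat2 a b c d) (mat2 a' b' c' d') =
    (let x = (if c * a' + d * c' \<noteq> 0 then c * a' + d * c' else c * b' + d * d') in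
      hs (x / (if c \<noteq> 0 then c else d)) (x / ((if c' \<noteq> 0 then c' else d') * (a * d - b * c))))"
  by (simp add: kubota_cocycle_def Let_def)

subsection \<open>Formula for the involution\<close>

lemma scale_mp_scale_mp [simp]: "scale_mp \<epsilon> (scale_mp \<eta> x) = scale_mp (\<epsilon> * \<eta>) x"
  by (simp add: scale_mp_def)

lemma scale_mp_one [simp]: "scale_mp 1 x = x"
  by (simp add: scale_mp_def)

lemma scale_mp_mult_left [simp]: "scale_mp \<epsilon> x \<otimes>\<^bsub>GG\<^esub> y = scale_mp \<epsilon> (x \<otimes>\<^bsub>GG\<^esub> y)"
  by (cases x; cases y) (simp add: mp_mult scale_mp_def)

lemma scale_mp_mult_right [simp]: "x \<otimes>\<^bsub>GG\<^esub> scale_mp \<epsilon> y = scale_mp \<epsilon> (x \<otimes>\<^bsub>GG\<^esub> y)"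
  by (cases x; cases y) (simp add: mp_mult scale_mp_def)

lemma scale_mp_closed: "\<epsilon> \<in> roots_of_unity 2 \<Longrightarrow> x \<in> carrier GG \<Longrightarrow> scale_mp \<epsilon> x \<in> carrier GG"
  by (cases x) (simp add: scale_mp_def mp_carrier roots_mult)

lemma mp_det_mult: "mp_det (x \<otimes>\<^bsub>GG\<^esub> y) = mp_det x * mp_det y"
  by (cases x; cases y) (simp add: mp_mult mp_det_def det_mul)

lemma mp_det_scale_mp [simp]: "mp_det (scale_mp \<epsilon> x) = mp_det x"
  by (simp add: mp_det_def scale_mp_def)

lemma mp_det_nonzero: "x \<in> carrier GG \<Longrightarrow> mp_det x \<noteq> 0"
  by (cases x) (simp add: mp_det_def mp_carrier)

lemma mp_det_inv: "x \<in> carrier GG \<Longrightarrow> mp_det (inv\<^bsub>GG\<^esub> x) = inverse (mp_det x)"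
  using mp_det_mult[of "inv\<^bsub>GG\<^esub> x" x] mp_det_nonzero[of x]
  by (simp add: mp_one mp_det_def[of "(mat 1, 1)"] inverse_eq_divide nonzero_eq_divide_eq)

lemma mp_u_closed: "a \<noteq> 0 \<Longrightarrow> mp_u a \<in> carrier GG"
  by (simp add: mp_u_def u_mat_mat2 mp_carrier roots_one)

lemma sigma_scale_mp:
  assumes "h \<in> carrier GG" "\<alpha> \<noteq> 0"
  shows "mp_sigma 2 hs \<alpha> h =
    scale_mp (hs \<alpha> (mp_det h)) (mp_u (mp_det h) \<otimes>\<^bsub>GG\<^esub> inv\<^bsub>GG\<^esub> h \<otimes>\<^bsub>GG\<^esub> mp_u 1)"
  unfolding mp_sigma_def using assms by (simp add: central_mult mp_u_closed mp_det_nonzero)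

lemma mp_inv_mat2:
  assumes g: "(mat2 a b c d, \<epsilon>) \<in> carrier GG" and D: "D = a * d - b * c"
  shows "inv\<^bsub>GG\<^esub> (mat2 a b c d, \<epsilon>) =
    (mat2 (d / D) (- b / D) (- c / D) (a / D), (if c \<noteq> 0 then 1 else hs d a) * \<epsilon>)"
proof (rule inv_equality[OF _ g])
  have D0: "D \<noteq> 0" and \<epsilon>: "\<epsilon> \<in> roots_of_unity 2" using g D by (auto simp: mp_carrier)
  note inverse = mat2_inverse[OF D D0]
  let ?g = "mat2 (d / D) (- b / D) (- c / D) (a / D)" and ?s = "if c \<noteq> 0 then 1 else hs d a"
  have X: "kubota_X (mat 1 :: 'f^2^2) = 1" by (simp add: mat_1_mat2)
  have coc: "kubota_cocycle hs ?g (mat2 a b c d) = ?s"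
  proof (cases "c = 0")
    case True
    then have "a \<noteq> 0" "d \<noteq> 0" using D D0 by auto
    moreover have "kubota_cocycle hs ?g (mat2 a b c d) = hs (inverse (a / D)) (inverse (d / D))"
      unfolding kubota_cocycle_def inverse X using True by (simp add: field_simps)
    ultimately show ?thesis using True D
      by (simp add: hs_inverse_left hs_inverse_right)
  next
    case False
    then have "kubota_cocycle hs ?g (mat2 a b c d) = hs (- (D / c)) (- (- (D / c)))"
      unfolding kubota_cocycle_def inverse X using D0 by (simp add: field_simps)
    then show ?thesis using False D0 hs_neg_self[of "- (D / c)"] by simp
  qed
  have "det ?g \<noteq> 0" "det (mat2 a b c d) \<noteq> 0"
    unfolding inverse using D D0 by simp_all
  from cocycle_in[OF this] have s: "?s \<in> roots_of_unity 2"
    unfolding coc .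
  have sq: "x * x = 1" if "x \<in> roots_of_unity 2" for x :: 'f
    using that by (simp add: roots_of_unity_def power2_eq_square)
  show "(?g, ?s * \<epsilon>) \<otimes>\<^bsub>GG\<^esub> (mat2 a b c d, \<epsilon>) = \<one>\<^bsub>GG\<^esub>"
    unfolding mp_mult coc inverse mp_one
    using sq[OF s] sq[OF \<epsilon>] by (simp add: mult.assoc mult.left_commute)
  show "(?g, ?s * \<epsilon>) \<in> carrier GG"
    unfolding mp_carrier inverse using D0 roots_mult[OF s \<epsilon>] by simp
qed

text \<open>
  The involution in coordinates. On the open cell it multiplies the fibre by the symbol of \<open>\<alpha> c\<close> and
  the determinant, which is the commutator of a scalar matrix \<open>\<alpha> c\<close> with the given element.
\<close>

lemma sigma_formula:
  assumes g: "(mat2 a b c d, \<epsilon>) \<in> carrier GG" and D: "D = a * d - b * c" and \<alpha>: "\<alpha> \<noteq> 0"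
  shows "mp_sigma 2 hs \<alpha> (mat2 a b c d, \<epsilon>) =
    (mat2 d b c a, hs \<alpha> D * (if c \<noteq> 0 then hs c D else 1) * \<epsilon>)"
proof -
  have D0: "D \<noteq> 0" using g D by (auto simp: mp_carrier)
  have det: "mp_det (mat2 a b c d, \<epsilon>) = D" by (simp add: mp_det_def D)
  let ?g = "mat2 (d / D) (- b / D) (- c / D) (a / D)"
  have m: "mat2 D 0 0 (- D) ** ?g = mat2 d (- b) c (- a)"
    "mat2 d (- b) c (- a) ** mat2 1 0 0 (- 1) = mat2 d b c a"
    using D0 by simp_all
  have sign: "kubota_cocycle hs (mat2 d (- b) c (- a)) (mat2 1 0 0 (- 1))
      * (kubota_cocycle hs (mat2 D 0 0 (- D)) ?g * (if c \<noteq> 0 then 1 else hs d a))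
      = (if c \<noteq> 0 then hs c D else 1)"
  proof (cases "c = 0")
    case False
    have "kubota_cocycle hs (mat2 d (- b) c (- a)) (mat2 1 0 0 (- 1)) = 1"
      unfolding kubota_cocycle_def m using False D0 D by (simp add: hs_one_left algebra_simps)
    moreover have "kubota_cocycle hs (mat2 D 0 0 (- D)) ?g = hs (c * (- inverse D)) (inverse D)"
      unfolding kubota_cocycle_def m using False D0 by (simp add: field_simps)
    moreover have "hs (c * (- inverse D)) (inverse D) = hs c (inverse D) * hs (- inverse D) (inverse D)"
      by (rule hs_mult_left) (use False D0 in simp_all)
    moreover have "hs (- inverse D) (inverse D) = 1"
      using hs_neg_self[of "- inverse D"] D0 by simp
    moreover have "hs c (inverse D) = hs c D"
      using False D0 by (rule hs_inverse_right)
    ultimately show ?thesis using False by simp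
  next
    case True
    then have ad: "a \<noteq> 0" "d \<noteq> 0" "D = a * d" using D D0 by auto
    have "kubota_cocycle hs (mat2 d (- b) c (- a)) (mat2 1 0 0 (- 1)) = hs (- 1) (inverse d)"
      unfolding kubota_cocycle_def m using True ad by (simp add: field_simps)
    moreover have "kubota_cocycle hs (mat2 D 0 0 (- D)) ?g = hs (inverse d) (inverse (a * d))"
      unfolding kubota_cocycle_def m using True ad by (simp add: field_simps)
    moreover have "hs d (- d) = hs d (- 1) * hs d d"
      using ad hs_mult_right[of d "- 1" d] by simp
    then have "hs (- 1) d * hs d d = 1"
      using ad hs_neg_self[of d] hs_symmetric[of "- 1" d] by simp
    then have "hs (- 1) d * (hs d d * (hs d a * hs d a)) = 1"
      using ad hs_square[of d a] by simp
    ultimately show ?thesis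
      using True ad by (simp add: hs_inverse_left hs_inverse_right hs_mult_right ac_simps)
  qed
  show ?thesis
    unfolding sigma_scale_mp[OF g \<alpha>] det mp_inv_mat2[OF g D] mp_u_def u_mat_mat2 mp_mult m
    unfolding scale_mp_def using sign by (simp add: ac_simps)
qed

subsection \<open>The involution is an anti-automorphism of order two\<close>

definition mp_scalar :: "'f \<Rightarrow> 'f mp" where
  "mp_scalar z = (mat2 z 0 0 z, 1)"

definition mp_upper :: "'f \<Rightarrow> 'f mp" where
  "mp_upper t = (mat2 1 t 0 1, 1)"

definition mp_flip :: "'f mp" where
  "mp_flip = (mat2 0 1 1 0, 1)"

lemma special_closed:
  "z \<noteq> 0 \<Longrightarrow> mp_scalar z \<in> carrier GG" "mp_upper t \<in> carrier GG" "mp_flip \<in> carrier GG"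
  by (simp_all add: mp_scalar_def mp_upper_def mp_flip_def mp_carrier roots_one)

lemma mp_cases:
  obtains a b c d \<epsilon> where "x = (mat2 a b c d, \<epsilon>)"
  by (metis mat2_cases surj_pair)

text \<open>
  Scalar matrices are not central in the cover: the commutator with \<open>x\<close> is the symbol of the scalar
  and the determinant of \<open>x\<close>.
\<close>

lemma scalar_commute:
  assumes z: "z \<noteq> 0" and x: "x \<in> carrier GG"
  shows "mp_scalar z \<otimes>\<^bsub>GG\<^esub> x = scale_mp (hs z (mp_det x)) (x \<otimes>\<^bsub>GG\<^esub> mp_scalar z)"
proof -
  obtain a b c d \<epsilon> where xg: "x = (mat2 a b c d, \<epsilon>)" by (rule mp_cases)
  define D where "D = a * d - b * c"
  define X where "X = (if c \<noteq> 0 then c else d)"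
  have D: "D \<noteq> 0" using x by (simp add: xg mp_carrier D_def)
  have X: "X \<noteq> 0" "kubota_X (mat2 a b c d) = X" using D by (auto simp: X_def D_def)
  have Xz: "kubota_X (mat2 (z * a) (z * b) (z * c) (z * d)) = z * X"
    using z by (simp add: X_def)
  have m: "mat2 z 0 0 z ** mat2 a b c d = mat2 (z * a) (z * b) (z * c) (z * d)"
    "mat2 a b c d ** mat2 z 0 0 z = mat2 (z * a) (z * b) (z * c) (z * d)"
    by (simp_all add: mult.commute)
  have "kubota_cocycle hs (mat2 z 0 0 z) (mat2 a b c d) = hs X (inverse z)"
    unfolding kubota_cocycle_def m Xz X(2) using X z by (simp add: field_simps)
  moreover have "kubota_cocycle hs (mat2 a b c d) (mat2 z 0 0 z) = hs z (X / D)"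
    unfolding kubota_cocycle_def m Xz X(2) det_mat2 D_def[symmetric] using X z by simp
  moreover have "hs X (inverse z) = hs z X"
    using X z by (simp add: hs_inverse_right hs_symmetric)
  moreover have "hs z (X / D) = hs z X * hs z D"
    using X z D by (simp add: divide_inverse hs_mult_right hs_inverse_right)
  moreover have "hs z D * (hs z X * hs z D * \<epsilon>) = hs z X * \<epsilon> * (hs z D * hs z D)"
    by (simp only: ac_simps)
  ultimately show ?thesis
    unfolding xg mp_scalar_def mp_mult m scale_mp_def mp_det_def fst_conv snd_conv det_mat2
      D_def[symmetric] by (simp add: hs_square[OF z D])
qed

lemma u_one_mult_u: "a \<noteq> 0 \<Longrightarrow> mp_u 1 \<otimes>\<^bsub>GG\<^esub> mp_u a = mp_scalar a"
  by (simp add: mp_u_def u_mat_mat2 mp_mult_mat2 cocycle_mat2 mp_scalar_def hs_one_right)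

lemma u_mult_scalar:
  assumes "a \<noteq> 0" "b \<noteq> 0"
  shows "mp_u b \<otimes>\<^bsub>GG\<^esub> mp_scalar a = scale_mp (hs a b) (mp_u (a * b))"
proof -
  have "kubota_cocycle hs (mat2 b 0 0 (- b)) (mat2 a 0 0 a) = hs a (inverse b)"
    using assms by (simp add: cocycle_mat2 field_simps)
  then show ?thesis
    using assms
    by (simp add: mp_u_def u_mat_mat2 mp_mult_mat2 mp_scalar_def scale_mp_def hs_inverse_right mult.commute)
qed

context
  fixes \<alpha> :: 'f
  assumes \<alpha>: "\<alpha> \<noteq> 0"
begin

abbreviation \<sigma> :: "'f mp \<Rightarrow> 'f mp" where "\<sigma> \<equiv> mp_sigma 2 hs \<alpha>"

lemma sigma_closed: "x \<in> carrier GG \<Longrightarrow> \<sigma> x \<in> carrier GG"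
  by (simp add: sigma_scale_mp \<alpha> scale_mp_closed hs_in mp_det_nonzero mp_u_closed)

text \<open>
  Reversing the product leaves the factor \<open>u(1) u(\<Delta>(x))\<close> in the middle, a scalar. Moving it to the
  left past \<open>y\<inverse>\<close> and multiplying it with \<open>u(\<Delta>(y))\<close> both cost the symbol of \<open>\<Delta>(x)\<close> and \<open>\<Delta>(y)\<close>,
  so the two signs cancel.
\<close>

lemma sigma_mult:
  assumes x: "x \<in> carrier GG" and y: "y \<in> carrier GG"
  shows "\<sigma> (x \<otimes>\<^bsub>GG\<^esub> y) = \<sigma> y \<otimes>\<^bsub>GG\<^esub> \<sigma> x"
proof -
  let ?a = "mp_det x" and ?b = "mp_det y"
  let ?i = "inv\<^bsub>GG\<^esub> x" and ?j = "inv\<^bsub>GG\<^esub> y"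
  have nz: "?a \<noteq> 0" "?b \<noteq> 0" using x y by (simp_all add: mp_det_nonzero)
  have cl: "?i \<in> carrier GG" "?j \<in> carrier GG" "mp_u ?a \<in> carrier GG" "mp_u ?b \<in> carrier GG"
    "mp_u 1 \<in> carrier GG" "mp_scalar ?a \<in> carrier GG" "mp_u (?a * ?b) \<in> carrier GG"
    using x y nz by (simp_all add: mp_u_closed special_closed)
  have j: "?j \<otimes>\<^bsub>GG\<^esub> mp_scalar ?a = scale_mp (hs ?a ?b) (mp_scalar ?a \<otimes>\<^bsub>GG\<^esub> ?j)"
    using scalar_commute[OF nz(1) cl(2)] hs_square[OF nz] nz y
    by (simp add: mp_det_inv hs_inverse_right)
  have "\<sigma> y \<otimes>\<^bsub>GG\<^esub> \<sigma> x = scale_mp (hs \<alpha> ?b * hs \<alpha> ?a)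
      (mp_u ?b \<otimes>\<^bsub>GG\<^esub> ?j \<otimes>\<^bsub>GG\<^esub> mp_u 1 \<otimes>\<^bsub>GG\<^esub> (mp_u ?a \<otimes>\<^bsub>GG\<^esub> ?i \<otimes>\<^bsub>GG\<^esub> mp_u 1))"
    using x y \<alpha> by (simp add: sigma_scale_mp mult.commute)
  also have "mp_u ?b \<otimes>\<^bsub>GG\<^esub> ?j \<otimes>\<^bsub>GG\<^esub> mp_u 1 \<otimes>\<^bsub>GG\<^esub> (mp_u ?a \<otimes>\<^bsub>GG\<^esub> ?i \<otimes>\<^bsub>GG\<^esub> mp_u 1)
      = mp_u ?b \<otimes>\<^bsub>GG\<^esub> (?j \<otimes>\<^bsub>GG\<^esub> (mp_u 1 \<otimes>\<^bsub>GG\<^esub> mp_u ?a)) \<otimes>\<^bsub>GG\<^esub> (?i \<otimes>\<^bsub>GG\<^esub> mp_u 1)"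
    using cl by (simp add: m_assoc)
  also have "mp_u 1 \<otimes>\<^bsub>GG\<^esub> mp_u ?a = mp_scalar ?a"
    using nz by (simp add: u_one_mult_u)
  also have "mp_u ?b \<otimes>\<^bsub>GG\<^esub> (?j \<otimes>\<^bsub>GG\<^esub> mp_scalar ?a)
      = scale_mp (hs ?a ?b) ((mp_u ?b \<otimes>\<^bsub>GG\<^esub> mp_scalar ?a) \<otimes>\<^bsub>GG\<^esub> ?j)"
    unfolding j using cl by (simp add: m_assoc)
  also have "\<dots> = mp_u (?a * ?b) \<otimes>\<^bsub>GG\<^esub> ?j"
    using nz by (simp add: u_mult_scalar hs_square)
  also have "mp_u (?a * ?b) \<otimes>\<^bsub>GG\<^esub> ?j \<otimes>\<^bsub>GG\<^esub> (?i \<otimes>\<^bsub>GG\<^esub> mp_u 1)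
      = mp_u (?a * ?b) \<otimes>\<^bsub>GG\<^esub> inv\<^bsub>GG\<^esub> (x \<otimes>\<^bsub>GG\<^esub> y) \<otimes>\<^bsub>GG\<^esub> mp_u 1"
    using cl x y by (simp add: inv_mult_group m_assoc)
  also have "scale_mp (hs \<alpha> ?b * hs \<alpha> ?a) \<dots> = \<sigma> (x \<otimes>\<^bsub>GG\<^esub> y)"
    using x y nz \<alpha> by (simp add: sigma_scale_mp mp_det_mult hs_mult_right mult.commute)
  finally show ?thesis ..
qed

lemma sigma_invol:
  assumes x: "x \<in> carrier GG"
  shows "\<sigma> (\<sigma> x) = x"
proof -
  obtain a b c d \<epsilon> where xg: "x = (mat2 a b c d, \<epsilon>)" by (rule mp_cases)
  define D where "D = a * d - b * c"
  have D: "D \<noteq> 0" using x by (simp add: xg mp_carrier D_def)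
  define s where "s = hs \<alpha> D * (if c \<noteq> 0 then hs c D else 1)"
  have \<sigma>x: "\<sigma> x = (mat2 d b c a, s * \<epsilon>)"
    unfolding xg s_def using x by (intro sigma_formula) (auto simp: xg D_def \<alpha>)
  then have "\<sigma> (\<sigma> x) = (mat2 a b c d, s * (s * \<epsilon>))"
    unfolding s_def using sigma_formula[of d b c a "s * \<epsilon>" D] sigma_closed[OF x] \<alpha>
    by (simp add: D_def mult.commute s_def)
  moreover have "s * s = 1"
    unfolding s_def using hs_square[OF \<alpha> D] hs_square[of c D] D by (simp add: mult.left_commute mult.assoc)
  ultimately show ?thesis by (simp add: xg flip: mult.assoc)
qed

end

subsection \<open>Congruence subgroups\<close>

text \<open>
  The groups that usually are denoted by \<open>K\<^sub>l\<^sup>*\<close>.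
\<close>

definition Ks :: "nat \<Rightarrow> 'f mp set" where
  "Ks l = congruence_lift ord hs l"

lemma congruence_subgroup_mat2:
  "mat2 a b c d \<in> congruence_subgroup ord l \<longleftrightarrow>
    a - 1 \<in> I (int l) \<and> b \<in> I (int l) \<and> c \<in> I (int l) \<and> d - 1 \<in> I (int l)"
  by (simp add: congruence_subgroup_def forall_2 mat_1_mat2)

lemma congruence_det:
  assumes "mat2 a b c d \<in> congruence_subgroup ord l"
  shows "a * d - b * c - 1 \<in> I (int l)"
proof -
  have I: "a - 1 \<in> I (int l)" "b \<in> I (int l)" "c \<in> I (int l)" "d - 1 \<in> I (int l)"
    using assms by (simp_all add: congruence_subgroup_mat2)
  have "d \<in> I 0" using ideal_add[OF ideal_mono[OF I(4), of 0] ideal_one] by simp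
  then have "(a - 1) * d + (d - 1) - b * c \<in> I (int l)"
    by (intro ideal_diff ideal_add ideal_mult_right I ideal_mono[OF I(3)]) simp_all
  then show ?thesis by (simp add: algebra_simps)
qed

lemma near_one_square: "square_level \<le> l \<Longrightarrow> x - 1 \<in> I (int l) \<Longrightarrow> is_square x"
  using square_level ideal_mono[of "x - 1" "int l" "int square_level"] unit_of_near_one[of x "int l"]
  by (auto simp: is_square_def)

context
  fixes l :: nat
  assumes l: "square_level \<le> l"
begin

lemma l_pos: "1 \<le> l"
  using l square_level by simp

lemma congruence_squares:
  assumes "mat2 a b c d \<in> congruence_subgroup ord l"
  shows "is_square a" "is_square d" "is_square (a * d - b * c)"
  using near_one_square[OF l] assms congruence_det[OF assms] by (auto simp: congruence_subgroup_mat2)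

text \<open>
  At these levels the Kubota splitting is trivial.
\<close>

lemma Ks_eq: "Ks l = (\<lambda>k. (k, 1)) ` congruence_subgroup ord l"
proof -
  have "kubota_s ord hs k = 1" if "k \<in> congruence_subgroup ord l" for k
  proof (cases k rule: mat2_cases)
    case (1 a b c d)
    then have "is_square (d * (a * d - b * c))"
      using congruence_squares that by (intro is_square_mult) auto
    then show ?thesis
      by (simp add: 1 kubota_s_def hs_square_right)
  qed
  then show ?thesis
    unfolding Ks_def congruence_lift_def by (auto intro!: image_cong)
qed

lemma Ks_iff:
  "(mat2 a b c d, \<epsilon>) \<in> Ks l \<longleftrightarrow> \<epsilon> = 1 \<and> mat2 a b c d \<in> congruence_subgroup ord l"
  by (auto simp: Ks_eq)

lemma Ks_cases:
  assumes "x \<in> Ks l"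
  obtains a b c d where "x = (mat2 a b c d, 1)" "mat2 a b c d \<in> congruence_subgroup ord l"
  using assms by (metis Ks_iff mp_cases)

lemma Ks_carrier: "x \<in> Ks l \<Longrightarrow> x \<in> carrier GG"
  by (erule Ks_cases) (use congruence_squares(3) in \<open>auto simp: mp_carrier roots_one is_square_def\<close>)

lemma congruence_mult:
  assumes "mat2 a b c d \<in> congruence_subgroup ord l" "mat2 a' b' c' d' \<in> congruence_subgroup ord l"
  shows "mat2 (a * a' + b * c') (a * b' + b * d') (c * a' + d * c') (c * b' + d * d')
    \<in> congruence_subgroup ord l"
proof -
  have I: "a - 1 \<in> I (int l)" "b \<in> I (int l)" "c \<in> I (int l)" "d - 1 \<in> I (int l)"
     "a' - 1 \<in> I (int l)" "b' \<in> I (int l)" "c' \<in> I (int l)" "d' - 1 \<in> I (int l)"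
    using assms by (simp_all add: congruence_subgroup_mat2)
  have I0: "a \<in> I 0" "d \<in> I 0" "a' \<in> I 0" "d' \<in> I 0" "c' \<in> I 0" "b' \<in> I 0"
    using unit_of_near_one(3) I l_pos ideal_mono[OF I(7), of 0] ideal_mono[OF I(6), of 0] by auto
  have "a * (a' - 1) + (a - 1) + b * c' \<in> I (int l)" "c * b' + (d * (d' - 1) + (d - 1)) \<in> I (int l)"
    "a * b' + b * d' \<in> I (int l)" "c * a' + d * c' \<in> I (int l)"
    by (intro ideal_add I ideal_mult_right[OF I(2)] ideal_mult_right[OF I(3)]
      ideal_mult_left[OF I0(1)] ideal_mult_left[OF I0(2)] I0)+
  then show ?thesis by (simp add: congruence_subgroup_mat2 algebra_simps)
qed

text \<open>
  Modulo squares only the lower left entries matter, and they satisfy \<open>c'' = c + c'\<close> up to square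
  factors. The symbol is trivial because of \<open>\<langle>x, -x\<rangle> = 1\<close> if \<open>c'' = 0\<close>, and because of the
  Steinberg relation for \<open>c / c''\<close> and \<open>c' / c''\<close> in the main case.
\<close>

lemma congruence_cocycle:
  assumes k: "mat2 a b c d \<in> congruence_subgroup ord l"
    and k': "mat2 a' b' c' d' \<in> congruence_subgroup ord l"
  shows "kubota_cocycle hs (mat2 a b c d) (mat2 a' b' c' d') = 1"
proof -
  define D where "D = a * d - b * c"
  define c'' where "c'' = c * a' + d * c'"
  define d'' where "d'' = c * b' + d * d'"
  have sq: "is_square d" "is_square D" "is_square a'" "is_square d'" "is_square d''"
    using congruence_squares[OF k] congruence_squares[OF k']
      congruence_squares(2)[OF congruence_mult[OF k k']] by (auto simp: D_def d''_def)
  then have nz: "d \<noteq> 0" "D \<noteq> 0" "a' \<noteq> 0" "d' \<noteq> 0" "d'' \<noteq> 0"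
    by (auto simp: is_square_def)
  have coc: "kubota_cocycle hs (mat2 a b c d) (mat2 a' b' c' d') =
      hs ((if c'' \<noteq> 0 then c'' else d'') / (if c \<noteq> 0 then c else d))
         ((if c'' \<noteq> 0 then c'' else d'') / ((if c' \<noteq> 0 then c' else d') * D))"
    by (simp add: cocycle_mat2 Let_def c''_def d''_def D_def)
  consider "c = 0" "c' = 0" | "c = 0" "c' \<noteq> 0" | "c \<noteq> 0" "c' = 0"
    | "c \<noteq> 0" "c' \<noteq> 0" "c'' = 0" | "c \<noteq> 0" "c' \<noteq> 0" "c'' \<noteq> 0" by blast
  then show ?thesis
  proof cases
    case 1
    then show ?thesis
      unfolding coc using nz sq by (simp add: c''_def hs_square_left is_square_divide)
  next
    case 2
    have "is_square (d / D)" using sq by (simp add: is_square_divide)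
    moreover have "d * c' / (c' * D) = d / D" using 2 by simp
    ultimately show ?thesis
      unfolding coc using nz 2 by (simp add: c''_def hs_square_right)
  next
    case 3
    then show ?thesis
      unfolding coc using nz sq by (simp add: c''_def hs_square_left)
  next
    case 4
    \<comment> \<open>Up to squares the arguments of the symbol are \<open>x\<close> and \<open>- x\<close>.\<close>
    define x where "x = d'' / c"
    have x: "x \<noteq> 0" using 4 nz by (simp add: x_def)
    have s: "is_square (d / (a' * D))" using sq by (intro is_square_divide is_square_mult)
    have "c * a' = - (d * c')" using 4(3) by (simp add: c''_def eq_neg_iff_add_eq_0)
    then have "a' * c = - (c' * d)" by (simp add: mult.commute)
    then have "a' * (c * d'') = - (c' * (d * d''))"
      by (metis mult.assoc mult_minus_left)
    then have "d'' / (c' * D) = - x * (d / (a' * D))"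
      using 4 nz by (simp add: x_def field_simps)
    moreover have "hs x (- x * (d / (a' * D))) = 1"
      using x s hs_mult_right[of x "- x" "d / (a' * D)"] hs_neg_self[OF x] hs_square_right[OF s x]
      by (simp add: is_square_def)
    ultimately show ?thesis unfolding coc using 4 by (simp add: x_def)
  next
    case 5
    \<comment> \<open>Up to squares and inverses the arguments of the symbol are \<open>p\<close> and \<open>1 - p\<close>.\<close>
    define p where "p = c * a' / c''"
    define q where "q = d * c' / c''"
    have q: "p \<noteq> 0" "q \<noteq> 0" "q = 1 - p"
      using 5 nz by (auto simp: p_def q_def field_simps) (simp add: c''_def mult.commute)
    have dD: "is_square (d / D)" "d / D \<noteq> 0" using sq nz by (simp_all add: is_square_divide)
    have x: "c'' / c = inverse p * a'" using 5 nz by (simp add: p_def)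
    have y: "c'' / (c' * D) = inverse q * (d / D)" using 5 nz by (simp add: q_def)
    have "hs (c'' / c) (c'' / (c' * D)) = hs (inverse p) (inverse q * (d / D)) * hs a' (inverse q * (d / D))"
      unfolding x y using q(1,2) nz(3) dD(2) by (simp add: hs_mult_left del: divide_eq_0_iff times_divide_eq_right)
    also have "hs a' (inverse q * (d / D)) = 1"
      using q(2) sq(3) dD(2) by (intro hs_square_left) auto
    also have "hs (inverse p) (inverse q * (d / D)) = hs (inverse p) (inverse q)"
      using q(1,2) dD hs_mult_right[of "inverse p" "inverse q" "d / D"] hs_square_right[OF dD(1), of "inverse p"] by simp
    also have "\<dots> = hs p q"
      using q(1,2) by (simp add: hs_inverse_left hs_inverse_right)
    also have "\<dots> = 1"
      using q hs_steinberg[of p] by simp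
    finally show ?thesis unfolding coc using 5 by simp
  qed
qed

lemma Ks_mult:
  assumes "x \<in> Ks l" "y \<in> Ks l"
  shows "x \<otimes>\<^bsub>GG\<^esub> y \<in> Ks l"
  by (rule Ks_cases[OF assms(1)]; rule Ks_cases[OF assms(2)])
    (simp add: mp_mult_mat2 congruence_cocycle Ks_iff congruence_mult)

lemma congruence_inverse:
  assumes k: "mat2 a b c d \<in> congruence_subgroup ord l" and D: "D = a * d - b * c"
  shows "mat2 (d / D) (- b / D) (- c / D) (a / D) \<in> congruence_subgroup ord l"
proof -
  have I: "a - 1 \<in> I (int l)" "b \<in> I (int l)" "c \<in> I (int l)" "d - 1 \<in> I (int l)" "D - 1 \<in> I (int l)"
    using k congruence_det[OF k] by (simp_all add: congruence_subgroup_mat2 D)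
  have D0: "D \<noteq> 0" "inverse D \<in> I 0" using unit_of_near_one[OF I(5)] l_pos by auto
  have "((d - 1) - (D - 1)) * inverse D \<in> I (int l)" "((a - 1) - (D - 1)) * inverse D \<in> I (int l)"
    "(- b) * inverse D \<in> I (int l)" "(- c) * inverse D \<in> I (int l)"
    by (intro ideal_mult_right ideal_diff ideal_minus I D0)+
  moreover have "((d - 1) - (D - 1)) * inverse D = d / D - 1"
    "((a - 1) - (D - 1)) * inverse D = a / D - 1"
    using D0 by (simp_all add: field_simps)
  ultimately show ?thesis
    by (simp add: congruence_subgroup_mat2 divide_inverse)
qed

lemma Ks_inv:
  assumes "x \<in> Ks l"
  shows "inv\<^bsub>GG\<^esub> x \<in> Ks l"
proof -
  obtain a b c d where x: "x = (mat2 a b c d, 1)" and k: "mat2 a b c d \<in> congruence_subgroup ord l"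
    using Ks_cases[OF assms] .
  have "hs d a = 1" using congruence_squares[OF k] by (simp add: hs_square_left is_square_def)
  then show ?thesis
    using mp_inv_mat2[OF Ks_carrier[OF assms, unfolded x] refl] congruence_inverse[OF k refl]
    by (simp add: x Ks_iff)
qed

lemma one_Ks: "\<one>\<^bsub>GG\<^esub> \<in> Ks l"
  by (simp add: mp_one mat_1_mat2 Ks_iff congruence_subgroup_mat2)

lemma Ks_subgroup: "subgroup (Ks l) GG"
  by (rule subgroupI) (use Ks_carrier one_Ks Ks_inv Ks_mult in auto)

lemma sigma_Ks:
  assumes "x \<in> Ks l" "\<alpha> \<noteq> 0"
  shows "mp_sigma 2 hs \<alpha> x \<in> Ks l"
proof -
  obtain a b c d where x: "x = (mat2 a b c d, 1)" and k: "mat2 a b c d \<in> congruence_subgroup ord l"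
    using Ks_cases[OF assms(1)] .
  have "mp_sigma 2 hs \<alpha> x = (mat2 d b c a, 1)"
    using sigma_formula[OF Ks_carrier[OF assms(1), unfolded x] refl assms(2)] congruence_squares(3)[OF k]
      assms(2) by (simp add: x hs_square_right)
  then show ?thesis using k by (simp add: Ks_iff congruence_subgroup_mat2)
qed

subsection \<open>Normalizers of the congruence subgroups\<close>

lemma normalizes_mult:
  assumes x: "normalizes x K" and y: "normalizes y K" and K: "K \<subseteq> carrier GG"
  shows "normalizes (x \<otimes>\<^bsub>GG\<^esub> y) K"
proof -
  have c: "x \<in> carrier GG" "y \<in> carrier GG" using x y by (simp_all add: normalizes_def)
  have "\<exists>k''\<in>K. x \<otimes>\<^bsub>GG\<^esub> y \<otimes>\<^bsub>GG\<^esub> k = k'' \<otimes>\<^bsub>GG\<^esub> (x \<otimes>\<^bsub>GG\<^esub> y)" if k: "k \<in> K" for k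
  proof -
    obtain k' where k': "k' \<in> K" "y \<otimes>\<^bsub>GG\<^esub> k = k' \<otimes>\<^bsub>GG\<^esub> y" using y k by (auto simp: normalizes_def)
    obtain k'' where k'': "k'' \<in> K" "x \<otimes>\<^bsub>GG\<^esub> k' = k'' \<otimes>\<^bsub>GG\<^esub> x" using x k' by (auto simp: normalizes_def)
    have kc: "k \<in> carrier GG" "k' \<in> carrier GG" "k'' \<in> carrier GG"
      using K k k' k'' by blast+
    have "x \<otimes>\<^bsub>GG\<^esub> y \<otimes>\<^bsub>GG\<^esub> k = x \<otimes>\<^bsub>GG\<^esub> (k' \<otimes>\<^bsub>GG\<^esub> y)"
      using c kc by (simp add: m_assoc flip: k'(2))
    also have "\<dots> = k'' \<otimes>\<^bsub>GG\<^esub> x \<otimes>\<^bsub>GG\<^esub> y"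
      using c kc by (simp add: m_assoc flip: k''(2))
    also have "\<dots> = k'' \<otimes>\<^bsub>GG\<^esub> (x \<otimes>\<^bsub>GG\<^esub> y)"
      using c kc by (simp add: m_assoc)
    finally show ?thesis using k'' by blast
  qed
  moreover have "\<exists>k''\<in>K. k \<otimes>\<^bsub>GG\<^esub> (x \<otimes>\<^bsub>GG\<^esub> y) = x \<otimes>\<^bsub>GG\<^esub> y \<otimes>\<^bsub>GG\<^esub> k''" if k: "k \<in> K" for k
  proof -
    obtain k' where k': "k' \<in> K" "k \<otimes>\<^bsub>GG\<^esub> x = x \<otimes>\<^bsub>GG\<^esub> k'" using x k by (auto simp: normalizes_def)
    obtain k'' where k'': "k'' \<in> K" "k' \<otimes>\<^bsub>GG\<^esub> y = y \<otimes>\<^bsub>GG\<^esub> k''" using y k' by (auto simp: normalizes_def)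
    have kc: "k \<in> carrier GG" "k' \<in> carrier GG" "k'' \<in> carrier GG"
      using K k k' k'' by blast+
    have "k \<otimes>\<^bsub>GG\<^esub> (x \<otimes>\<^bsub>GG\<^esub> y) = x \<otimes>\<^bsub>GG\<^esub> k' \<otimes>\<^bsub>GG\<^esub> y"
      using c kc by (simp flip: m_assoc k'(2))
    also have "\<dots> = x \<otimes>\<^bsub>GG\<^esub> (y \<otimes>\<^bsub>GG\<^esub> k'')"
      using c kc by (simp add: m_assoc flip: k''(2))
    also have "\<dots> = x \<otimes>\<^bsub>GG\<^esub> y \<otimes>\<^bsub>GG\<^esub> k''"
      using c kc by (simp add: m_assoc)
    finally show ?thesis using k'' by blast
  qed
  ultimately show ?thesis using c by (simp add: normalizes_def)
qed

lemma normalizes_one: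
  assumes "K \<subseteq> carrier GG"
  shows "normalizes \<one>\<^bsub>GG\<^esub> K"
proof -
  have "\<one>\<^bsub>GG\<^esub> \<otimes>\<^bsub>GG\<^esub> k = k \<otimes>\<^bsub>GG\<^esub> \<one>\<^bsub>GG\<^esub>" if "k \<in> K" for k
    using subsetD[OF assms that] by simp
  then show ?thesis unfolding normalizes_def using one_closed by metis
qed

lemma normalizes_sigma:
  assumes x: "normalizes x (Ks l)" and \<alpha>: "\<alpha> \<noteq> 0"
  shows "normalizes (mp_sigma 2 hs \<alpha> x) (Ks l)"
proof -
  let ?s = "mp_sigma 2 hs \<alpha>"
  have xc: "x \<in> carrier GG" using x by (simp add: normalizes_def)
  have "\<exists>k'\<in>Ks l. ?s x \<otimes>\<^bsub>GG\<^esub> k = k' \<otimes>\<^bsub>GG\<^esub> ?s x" if k: "k \<in> Ks l" for k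
  proof -
    note sk = sigma_Ks[OF k \<alpha>]
    obtain k' where k': "k' \<in> Ks l" "?s k \<otimes>\<^bsub>GG\<^esub> x = x \<otimes>\<^bsub>GG\<^esub> k'"
      using x sk unfolding normalizes_def by blast
    from arg_cong[OF k'(2), of ?s] have "?s x \<otimes>\<^bsub>GG\<^esub> k = ?s k' \<otimes>\<^bsub>GG\<^esub> ?s x"
      using xc Ks_carrier[OF sk] Ks_carrier[OF k] Ks_carrier[OF k'(1)] \<alpha>
      by (simp add: sigma_mult sigma_invol)
    then show ?thesis using sigma_Ks[OF k'(1) \<alpha>] by blast
  qed
  moreover have "\<exists>k'\<in>Ks l. k \<otimes>\<^bsub>GG\<^esub> ?s x = ?s x \<otimes>\<^bsub>GG\<^esub> k'" if k: "k \<in> Ks l" for k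
  proof -
    note sk = sigma_Ks[OF k \<alpha>]
    obtain k' where k': "k' \<in> Ks l" "x \<otimes>\<^bsub>GG\<^esub> ?s k = k' \<otimes>\<^bsub>GG\<^esub> x"
      using x sk unfolding normalizes_def by blast
    from arg_cong[OF k'(2), of ?s] have "k \<otimes>\<^bsub>GG\<^esub> ?s x = ?s x \<otimes>\<^bsub>GG\<^esub> ?s k'"
      using xc Ks_carrier[OF sk] Ks_carrier[OF k] Ks_carrier[OF k'(1)] \<alpha>
      by (simp add: sigma_mult sigma_invol)
    then show ?thesis using sigma_Ks[OF k'(1) \<alpha>] by blast
  qed
  ultimately show ?thesis using sigma_closed[OF \<alpha> xc] by (simp add: normalizes_def)
qed

text \<open>
  Determinants of congruence matrices are squares, so scalars commute with their lifts.
\<close>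

lemma normalizes_scalar:
  assumes z: "z \<noteq> 0"
  shows "normalizes (mp_scalar z) (Ks l)"
proof -
  have "mp_scalar z \<otimes>\<^bsub>GG\<^esub> k = k \<otimes>\<^bsub>GG\<^esub> mp_scalar z" if k: "k \<in> Ks l" for k
  proof -
    obtain a b c d where "k = (mat2 a b c d, 1)" "mat2 a b c d \<in> congruence_subgroup ord l"
      using Ks_cases[OF k] .
    then have "is_square (mp_det k)" using congruence_squares(3) by (simp add: mp_det_def)
    then show ?thesis
      using scalar_commute[OF z Ks_carrier[OF k]] z by (simp add: hs_square_right)
  qed
  then show ?thesis
    unfolding normalizes_def using special_closed(1)[OF z] by metis
qed

end

lemma upper_mult:
  assumes "(mat2 a b c d, \<epsilon>) \<in> carrier GG"
  shows "mp_upper t \<otimes>\<^bsub>GG\<^esub> (mat2 a b c d, \<epsilon>) = (mat2 (a + t * c) (b + t * d) c d, \<epsilon>)"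
    and "(mat2 a b c d, \<epsilon>) \<otimes>\<^bsub>GG\<^esub> mp_upper t = (mat2 a (a * t + b) c (c * t + d), \<epsilon>)"
  using assms
  by (auto simp: mp_upper_def mp_mult_mat2 cocycle_mat2 hs_one_left hs_one_right mp_carrier)

context
  fixes l :: nat
  assumes l: "square_level \<le> l"
begin

lemma upper_conjugate_Ks:
  assumes k: "k \<in> Ks l" and t: "t \<in> I 0"
  shows "\<exists>k'\<in>Ks l. mp_upper t \<otimes>\<^bsub>GG\<^esub> k = k' \<otimes>\<^bsub>GG\<^esub> mp_upper t"
proof -
  obtain a b c d where x: "k = (mat2 a b c d, 1)" and m: "mat2 a b c d \<in> congruence_subgroup ord l"
    using Ks_cases[OF l k] .
  have I: "a - 1 \<in> I (int l)" "b \<in> I (int l)" "c \<in> I (int l)" "d - 1 \<in> I (int l)"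
    using m by (simp_all add: congruence_subgroup_mat2)
  let ?k = "(mat2 (a + t * c) (b + t * (d - a) - t * t * c) c (d - t * c), 1)"
  have tc: "t * c \<in> I (int l)" by (rule ideal_mult_left[OF t I(3)])
  have "(a - 1) + t * c \<in> I (int l)" "b + t * ((d - 1) - (a - 1)) - t * (t * c) \<in> I (int l)"
    "(d - 1) - t * c \<in> I (int l)"
    by (intro ideal_add ideal_diff ideal_mult_left[OF t] I tc)+
  then have k': "?k \<in> Ks l"
    using I(3) by (simp add: Ks_iff[OF l] congruence_subgroup_mat2 algebra_simps)
  moreover have "mp_upper t \<otimes>\<^bsub>GG\<^esub> k = ?k \<otimes>\<^bsub>GG\<^esub> mp_upper t"
    unfolding x using upper_mult(1)[OF Ks_carrier[OF l k, unfolded x]]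
      upper_mult(2)[OF Ks_carrier[OF l k']] by (simp add: algebra_simps)
  ultimately show ?thesis by blast
qed

lemma upper_inverse: "inv\<^bsub>GG\<^esub> mp_upper t = mp_upper (- t)"
  by (rule inv_equality[OF _ special_closed(2) special_closed(2)])
    (simp add: mp_upper_def mp_mult_mat2 cocycle_mat2 hs_one_left mp_one mat_1_mat2)

lemma normalizes_upper:
  assumes t: "t \<in> I 0"
  shows "normalizes (mp_upper t) (Ks l)"
proof -
  have "\<exists>k'\<in>Ks l. k \<otimes>\<^bsub>GG\<^esub> mp_upper t = mp_upper t \<otimes>\<^bsub>GG\<^esub> k'" if k: "k \<in> Ks l" for k
  proof -
    obtain k' where k': "k' \<in> Ks l" "mp_upper (- t) \<otimes>\<^bsub>GG\<^esub> k = k' \<otimes>\<^bsub>GG\<^esub> mp_upper (- t)"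
      using upper_conjugate_Ks[OF k ideal_minus[OF t]] by blast
    note c = Ks_carrier[OF l k] Ks_carrier[OF l k'(1)] special_closed(2)[of t]
    have "k \<otimes>\<^bsub>GG\<^esub> mp_upper t = mp_upper t \<otimes>\<^bsub>GG\<^esub> (mp_upper (- t) \<otimes>\<^bsub>GG\<^esub> k) \<otimes>\<^bsub>GG\<^esub> mp_upper t"
      using c by (simp add: inv_solve_left m_assoc flip: upper_inverse) (simp flip: m_assoc)
    also have "\<dots> = mp_upper t \<otimes>\<^bsub>GG\<^esub> k'"
      unfolding k'(2) using c by (simp add: m_assoc flip: upper_inverse)
    finally show ?thesis using k'(1) by blast
  qed
  then show ?thesis
    unfolding normalizes_def using upper_conjugate_Ks[OF _ t] special_closed(2) by blast
qed

lemma flip_square: "mp_flip \<otimes>\<^bsub>GG\<^esub> mp_flip = \<one>\<^bsub>GG\<^esub>"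
  by (simp add: mp_flip_def mp_mult_mat2 cocycle_mat2 hs_one_left mp_one mat_1_mat2)

lemma flip_conjugate_Ks:
  assumes k: "k \<in> Ks l"
  shows "\<exists>k'\<in>Ks l. mp_flip \<otimes>\<^bsub>GG\<^esub> k = k' \<otimes>\<^bsub>GG\<^esub> mp_flip"
proof -
  obtain a b c d where x: "k = (mat2 a b c d, 1)" and m: "mat2 a b c d \<in> congruence_subgroup ord l"
    using Ks_cases[OF l k] .
  note sq = congruence_squares[OF l m]
  have nz: "a \<noteq> 0" "d \<noteq> 0" "a * d - b * c \<noteq> 0" "c * b - d * a \<noteq> 0"
    using sq by (auto simp: is_square_def mult.commute)
  let ?k = "(mat2 d c b a, 1)"
  have "?k \<in> Ks l" using m by (simp add: Ks_iff[OF l] congruence_subgroup_mat2)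
  moreover have "kubota_cocycle hs (mat2 0 1 1 0) (mat2 a b c d) = 1"
    using nz sq by (simp add: cocycle_mat2 hs_square_left)
  moreover have "kubota_cocycle hs (mat2 d c b a) (mat2 0 1 1 0) = 1"
  proof -
    have "is_square (a / (d * a - c * b))" using sq is_square_divide by (simp add: mult.commute)
    then show ?thesis using nz by (simp add: cocycle_mat2 hs_square_right)
  qed
  ultimately show ?thesis
    by (intro bexI[of _ ?k]) (simp_all add: x mp_flip_def mp_mult_mat2)
qed

lemma normalizes_flip: "normalizes mp_flip (Ks l)"
proof -
  have "\<exists>k'\<in>Ks l. k \<otimes>\<^bsub>GG\<^esub> mp_flip = mp_flip \<otimes>\<^bsub>GG\<^esub> k'" if k: "k \<in> Ks l" for k
  proof -
    obtain k' where k': "k' \<in> Ks l" "mp_flip \<otimes>\<^bsub>GG\<^esub> k = k' \<otimes>\<^bsub>GG\<^esub> mp_flip"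
      using flip_conjugate_Ks[OF k] by blast
    note c = Ks_carrier[OF l k] Ks_carrier[OF l k'(1)] special_closed(3)
    have "k \<otimes>\<^bsub>GG\<^esub> mp_flip = mp_flip \<otimes>\<^bsub>GG\<^esub> (mp_flip \<otimes>\<^bsub>GG\<^esub> k) \<otimes>\<^bsub>GG\<^esub> mp_flip"
      using c flip_square by (simp flip: m_assoc)
    also have "\<dots> = mp_flip \<otimes>\<^bsub>GG\<^esub> k'"
      unfolding k'(2) using c by (simp add: m_assoc flip_square)
    finally show ?thesis using k'(1) by blast
  qed
  then show ?thesis
    unfolding normalizes_def using flip_conjugate_Ks special_closed(3) by blast
qed

subsection \<open>The involution preserves conjugacy classes\<close>

definition twist_conjugate :: "'f \<Rightarrow> 'f mp \<Rightarrow> bool" where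
  "twist_conjugate \<alpha> h \<longleftrightarrow>
    (\<exists>x. normalizes x (Ks l) \<and> mp_sigma 2 hs \<alpha> h \<otimes>\<^bsub>GG\<^esub> x = x \<otimes>\<^bsub>GG\<^esub> h)"

lemma Ks_sub: "Ks l \<subseteq> carrier GG"
  using Ks_carrier[OF l] by blast

lemma twist_conjugate_transfer:
  assumes \<alpha>: "\<alpha> \<noteq> 0" and y: "normalizes y (Ks l)"
    and h: "h \<in> carrier GG" "h' \<in> carrier GG" and conj: "y \<otimes>\<^bsub>GG\<^esub> h = h' \<otimes>\<^bsub>GG\<^esub> y"
    and h': "twist_conjugate \<alpha> h'"
  shows "twist_conjugate \<alpha> h"
proof -
  let ?s = "mp_sigma 2 hs \<alpha>"
  obtain x where x: "normalizes x (Ks l)" "?s h' \<otimes>\<^bsub>GG\<^esub> x = x \<otimes>\<^bsub>GG\<^esub> h'"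
    using h' by (auto simp: twist_conjugate_def)
  have c: "x \<in> carrier GG" "y \<in> carrier GG" "?s y \<in> carrier GG" "?s h \<in> carrier GG" "?s h' \<in> carrier GG"
    using x y h sigma_closed[OF \<alpha>] by (auto simp: normalizes_def)
  have s: "?s h \<otimes>\<^bsub>GG\<^esub> ?s y = ?s y \<otimes>\<^bsub>GG\<^esub> ?s h'"
    using arg_cong[OF conj, of ?s] c h by (simp add: sigma_mult[OF \<alpha>])
  have "?s h \<otimes>\<^bsub>GG\<^esub> (?s y \<otimes>\<^bsub>GG\<^esub> x \<otimes>\<^bsub>GG\<^esub> y) = ?s h \<otimes>\<^bsub>GG\<^esub> ?s y \<otimes>\<^bsub>GG\<^esub> (x \<otimes>\<^bsub>GG\<^esub> y)"
    using c h by (simp add: m_assoc)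
  also have "\<dots> = ?s y \<otimes>\<^bsub>GG\<^esub> (?s h' \<otimes>\<^bsub>GG\<^esub> x) \<otimes>\<^bsub>GG\<^esub> y"
    unfolding s using c h by (simp add: m_assoc)
  also have "\<dots> = ?s y \<otimes>\<^bsub>GG\<^esub> x \<otimes>\<^bsub>GG\<^esub> (h' \<otimes>\<^bsub>GG\<^esub> y)"
    unfolding x(2) using c h by (simp add: m_assoc)
  also have "\<dots> = ?s y \<otimes>\<^bsub>GG\<^esub> x \<otimes>\<^bsub>GG\<^esub> y \<otimes>\<^bsub>GG\<^esub> h"
    unfolding conj[symmetric] using c h by (simp add: m_assoc)
  finally show ?thesis
    unfolding twist_conjugate_def
    by (intro exI[of _ "?s y \<otimes>\<^bsub>GG\<^esub> x \<otimes>\<^bsub>GG\<^esub> y"])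
      (simp add: normalizes_mult[OF l] normalizes_sigma[OF l _ \<alpha>] Ks_sub x y)
qed

text \<open>
  The unipotent matrix with entry \<open>t = (d - a) / c\<close> conjugates the matrix with rows \<open>a, b\<close> and
  \<open>c, d\<close> to the one with rows \<open>d, b\<close> and \<open>c, a\<close>, which is its image under the standard involution.
  Conjugation by the scalar \<open>\<alpha> c\<close> then produces exactly the sign in the formula for the involution
  on the cover. The unipotent matrix normalizes the congruence subgroup since \<open>t\<close> is integral.
\<close>

lemma twist_conjugate_lower_left:
  assumes \<alpha>: "\<alpha> \<noteq> 0" and h: "(mat2 a b c d, \<epsilon>) \<in> carrier GG" and c: "c \<noteq> 0"
    and t: "(d - a) / c \<in> I 0"
  shows "twist_conjugate \<alpha> (mat2 a b c d, \<epsilon>)"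
proof -
  let ?s = "mp_sigma 2 hs \<alpha>" and ?h = "(mat2 a b c d, \<epsilon>)" and ?h' = "(mat2 d b c a, \<epsilon>)"
  define t where "t = (d - a) / c"
  define D where "D = a * d - b * c"
  have D: "D \<noteq> 0" using h by (simp add: D_def mp_carrier)
  have h': "?h' \<in> carrier GG" using h by (simp add: mp_carrier mult.commute)
  have \<alpha>c: "\<alpha> * c \<noteq> 0" using \<alpha> c by simp
  have tc: "t * c = d - a" "c * t = d - a" using c by (simp_all add: t_def)
  have td: "t * d = d * t" by (rule mult.commute)
  have up: "mp_upper t \<otimes>\<^bsub>GG\<^esub> ?h = ?h' \<otimes>\<^bsub>GG\<^esub> mp_upper t"
    unfolding upper_mult(1)[OF h] upper_mult(2)[OF h'] tc td by (simp add: add.commute)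
  have "?s ?h = scale_mp (hs \<alpha> D * hs c D) ?h'"
    using sigma_formula[OF h D_def \<alpha>] c by (simp add: scale_mp_def)
  also have "hs \<alpha> D * hs c D = hs (\<alpha> * c) (mp_det ?h')"
    using \<alpha> c D by (simp add: hs_mult_left mp_det_def D_def mult.commute)
  finally have s: "?s ?h \<otimes>\<^bsub>GG\<^esub> mp_scalar (\<alpha> * c) = mp_scalar (\<alpha> * c) \<otimes>\<^bsub>GG\<^esub> ?h'"
    using scalar_commute[OF \<alpha>c h'] by simp
  have cl: "mp_scalar (\<alpha> * c) \<in> carrier GG" "mp_upper t \<in> carrier GG" "?s ?h \<in> carrier GG"
    using special_closed \<alpha>c sigma_closed[OF \<alpha> h] by auto
  have "?s ?h \<otimes>\<^bsub>GG\<^esub> (mp_scalar (\<alpha> * c) \<otimes>\<^bsub>GG\<^esub> mp_upper t)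
      = mp_scalar (\<alpha> * c) \<otimes>\<^bsub>GG\<^esub> mp_upper t \<otimes>\<^bsub>GG\<^esub> ?h"
    using cl h h' s up by (metis m_assoc)
  moreover have "normalizes (mp_scalar (\<alpha> * c) \<otimes>\<^bsub>GG\<^esub> mp_upper t) (Ks l)"
    using t by (intro normalizes_mult[OF l] normalizes_scalar[OF l \<alpha>c] normalizes_upper Ks_sub) (simp add: t_def)
  ultimately show ?thesis unfolding twist_conjugate_def by blast
qed

lemma twist_conjugate_upper_right:
  assumes \<alpha>: "\<alpha> \<noteq> 0" and h: "(mat2 a b c d, \<epsilon>) \<in> carrier GG" and b: "b \<noteq> 0"
    and t: "(d - a) / b \<in> I 0"
  shows "twist_conjugate \<alpha> (mat2 a b c d, \<epsilon>)"
proof -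
  let ?h = "(mat2 a b c d, \<epsilon>)"
  have cl: "mp_flip \<in> carrier GG" by (rule special_closed)
  let ?h' = "mp_flip \<otimes>\<^bsub>GG\<^esub> ?h \<otimes>\<^bsub>GG\<^esub> mp_flip"
  have h': "?h' \<in> carrier GG" using cl h by simp
  obtain \<eta> where eq: "?h' = (mat2 d c b a, \<eta>)"
    by (simp add: mp_flip_def mp_mult_mat2)
  have "(a - d) / b \<in> I 0" using ideal_minus[OF t] by (simp add: minus_divide_left)
  then have "twist_conjugate \<alpha> ?h'"
    using twist_conjugate_lower_left[OF \<alpha> h'[unfolded eq] b] eq by simp
  moreover have "mp_flip \<otimes>\<^bsub>GG\<^esub> ?h = ?h' \<otimes>\<^bsub>GG\<^esub> mp_flip"
    using cl h by (simp add: m_assoc flip_square)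
  ultimately show ?thesis
    using twist_conjugate_transfer[OF \<alpha> normalizes_flip h h'] by blast
qed

text \<open>
  If one of the off-diagonal entries is at least as large as \<open>d - a\<close>, the previous lemmas apply.
  Otherwise \<open>d - a\<close> dominates both. Conjugation by the unipotent matrix with entry \<open>1\<close> then adds
  \<open>d - a - c\<close> to the upper right entry, which becomes at least as large as the difference of
  the new diagonal entries.
\<close>

theorem involution_preserves_conjugacy:
  assumes \<alpha>: "\<alpha> \<noteq> 0" and h: "h \<in> carrier GG"
  shows "twist_conjugate \<alpha> h"
proof -
  obtain a b c d \<epsilon> where hg: "h = (mat2 a b c d, \<epsilon>)" by (rule mp_cases)
  show ?thesis
  proof (cases "(c \<noteq> 0 \<and> (d - a) / c \<in> I 0) \<or> (b \<noteq> 0 \<and> (d - a) / b \<in> I 0)")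
    case True
    then show ?thesis
      using twist_conjugate_lower_left[OF \<alpha>] twist_conjugate_upper_right[OF \<alpha>] h hg by blast
  next
    case False
    show ?thesis
    proof (cases "a = d")
      case True
      then have "b = 0" "c = 0" using False by auto
      then have "d \<noteq> 0" using h True by (auto simp: hg mp_carrier)
      have "mp_sigma 2 hs \<alpha> h = h"
        using sigma_formula[OF h[unfolded hg] refl \<alpha>] \<open>b = 0\<close> \<open>c = 0\<close> \<open>d \<noteq> 0\<close> True \<alpha>
          hs_square_right[of "d * d" \<alpha>] by (auto simp: hg is_square_def)
      then show ?thesis
        unfolding twist_conjugate_def
        by (intro exI[of _ "\<one>\<^bsub>GG\<^esub>"]) (simp add: h normalizes_one[OF l] Ks_sub)
    next
      case ad: False
      have small: "x / (d - a) \<in> I 1" if "x = b \<or> x = c" for x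
        using that ad False
        by (cases "x = 0") (auto simp: ideal_pow_def ord_divide)
      let ?b = "b + d - a - c"
      have "?b / (d - a) = ((b - c) + (d - a)) / (d - a)" by (simp add: algebra_simps)
      then have "?b / (d - a) = (b / (d - a) - c / (d - a)) + 1"
        using ad by (simp add: add_divide_distrib[of "b - c"] diff_divide_distrib[of b])
      moreover have "b / (d - a) - c / (d - a) \<in> I 1"
        by (intro ideal_diff small) auto
      \<comment> \<open>So the new upper right entry is \<open>d - a\<close> times a unit.\<close>
      ultimately have unit: "?b / (d - a) - 1 \<in> I 1" by simp
      then have b: "?b \<noteq> 0" "inverse (?b / (d - a)) \<in> I 0"
        using unit_of_near_one[OF unit] by auto
      have "1 - (c / (d - a) + c / (d - a)) \<in> I 0"
        using ideal_mono[OF small[of c], of 0] by (intro ideal_diff ideal_one ideal_add) auto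
      note prod = ideal_mult_right[OF this b(2)]
      define e where "e = d - a"
      have e: "e \<noteq> 0" using ad by (simp add: e_def)
      have "1 - (c / e + c / e) = (e - c - c) / e"
        using e by (simp add: diff_divide_distrib)
      then have "(1 - (c / e + c / e)) * inverse (?b / e) = (e - c - c) / ?b"
        using e by simp
      also have "e - c - c = (d - c) - (a + c)" by (simp add: e_def)
      finally have eq: "(1 - (c / e + c / e)) * inverse (?b / e) = ((d - c) - (a + c)) / ?b" .
      have t: "((d - c) - (a + c)) / ?b \<in> I 0"
        using prod unfolding e_def[symmetric] eq .
      let ?h' = "(mat2 (a + c) ?b c (d - c), \<epsilon>)"
      have h': "?h' \<in> carrier GG"
        using h by (simp add: hg mp_carrier algebra_simps)
      have "mp_upper 1 \<otimes>\<^bsub>GG\<^esub> h = ?h' \<otimes>\<^bsub>GG\<^esub> mp_upper 1"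
        unfolding hg upper_mult(1)[OF h[unfolded hg]] upper_mult(2)[OF h'] by simp
      moreover have "twist_conjugate \<alpha> ?h'"
        by (rule twist_conjugate_upper_right[OF \<alpha> h' b(1) t])
      ultimately show ?thesis
        using twist_conjugate_transfer[OF \<alpha> normalizes_upper[OF ideal_one] h h'] by blast
    qed
  qed
qed

end

subsection \<open>Compactness of the congruence subgroups\<close>

lemma Ks_mono: "l \<le> l' \<Longrightarrow> Ks l' \<subseteq> Ks l"
  unfolding Ks_def by (rule congruence_lift_mono)

lemma open_at_one:
  assumes "openin (mp_topology ord 2 hs) U" "\<one>\<^bsub>GG\<^esub> \<in> U"
  obtains l where "square_level \<le> l" "Ks l \<subseteq> U"
proof -
  obtain l where l: "\<forall>k\<in>Ks l. \<one>\<^bsub>GG\<^esub> \<otimes>\<^bsub>GG\<^esub> k \<in> U"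
    using assms unfolding openin_mp_topology mp_open_def Ks_def by blast
  \<comment> \<open>The topology allows small levels, at which the splitting need not be trivial; a larger level is chosen.\<close>
  let ?m = "max l square_level"
  have "k \<in> U" if "k \<in> Ks ?m" for k
  proof -
    have "k \<in> Ks l" using that Ks_mono[of l ?m] by auto
    moreover have "k \<in> carrier GG" using Ks_carrier[of ?m] that by simp
    ultimately show ?thesis using l by force
  qed
  then have "Ks ?m \<subseteq> U" by (rule subsetI)
  then show ?thesis using that[of ?m] by simp
qed

lemma openI:
  assumes "U \<subseteq> carrier GG"
    and "\<And>x. x \<in> U \<Longrightarrow> \<exists>l\<ge>square_level. \<forall>k\<in>Ks l. x \<otimes>\<^bsub>GG\<^esub> k \<in> U"
  shows "openin (mp_topology ord 2 hs) U"
  unfolding openin_mp_topology mp_open_def using assms square_level(1) unfolding Ks_def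
  by (meson order_trans)

definition matrix_ball :: "'f^2^2 \<Rightarrow> nat \<Rightarrow> ('f^2^2) set" where
  "matrix_ball g j = {h. \<forall>i k. h $ i $ k - g $ i $ k \<in> I (int j)}"

lemma matrix_ball_mat2:
  "mat2 a b c d \<in> matrix_ball (mat2 a' b' c' d') j \<longleftrightarrow>
    a - a' \<in> I (int j) \<and> b - b' \<in> I (int j) \<and> c - c' \<in> I (int j) \<and> d - d' \<in> I (int j)"
  by (simp add: matrix_ball_def forall_2)

lemma congruence_subgroup_ball: "congruence_subgroup ord l = matrix_ball (mat 1) l"
  by (simp add: congruence_subgroup_def matrix_ball_def)

lemma matrix_ball_trans:
  assumes "h \<in> matrix_ball g j" "i \<le> j" "g \<in> matrix_ball f i"
  shows "h \<in> matrix_ball f i"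
proof -
  have "h $ p $ q - f $ p $ q \<in> I (int i)" for p q
  proof -
    have "h $ p $ q - g $ p $ q \<in> I (int j)" "g $ p $ q - f $ p $ q \<in> I (int i)"
      using assms by (simp_all add: matrix_ball_def)
    from ideal_add[OF ideal_mono[OF this(1)] this(2)] assms(2) show ?thesis by simp
  qed
  then show ?thesis by (simp add: matrix_ball_def)
qed

lemma matrix_ball_sym: "h \<in> matrix_ball g j \<Longrightarrow> g \<in> matrix_ball h j"
  unfolding matrix_ball_def using ideal_minus by fastforce

lemma matrix_ball_split:
  obtains N where "finite N" "N \<subseteq> matrix_ball g j" "matrix_ball g j \<subseteq> (\<Union>h\<in>N. matrix_ball h (Suc j))"
proof -
  obtain F where F: "finite F" "F \<subseteq> I (int j)" "\<And>x. x \<in> I (int j) \<Longrightarrow> \<exists>y\<in>F. x - y \<in> I (int j + 1)"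
    using finite_residues by blast
  obtain a b c d where g: "g = mat2 a b c d" by (rule mat2_cases)
  let ?N = "(\<lambda>(p, q, r, s). mat2 (a + p) (b + q) (c + r) (d + s)) ` (F \<times> F \<times> F \<times> F)"
  have "finite ?N" using F(1) by simp
  moreover have "?N \<subseteq> matrix_ball g j"
    using F(2) by (auto simp: g matrix_ball_mat2)
  moreover have "matrix_ball g j \<subseteq> (\<Union>h\<in>?N. matrix_ball h (Suc j))"
  proof
    fix h assume h: "h \<in> matrix_ball g j"
    obtain a' b' c' d' where hm: "h = mat2 a' b' c' d'" by (rule mat2_cases)
    have I: "a' - a \<in> I (int j)" "b' - b \<in> I (int j)" "c' - c \<in> I (int j)" "d' - d \<in> I (int j)"
      using h by (simp_all add: hm g matrix_ball_mat2)
    obtain p q r s where "p \<in> F" "q \<in> F" "r \<in> F" "s \<in> F"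
      and close: "a' - a - p \<in> I (int j + 1)" "b' - b - q \<in> I (int j + 1)"
        "c' - c - r \<in> I (int j + 1)" "d' - d - s \<in> I (int j + 1)"
      using F(3)[OF I(1)] F(3)[OF I(2)] F(3)[OF I(3)] F(3)[OF I(4)] by blast
    then have "mat2 (a + p) (b + q) (c + r) (d + s) \<in> ?N" by force
    moreover have "h \<in> matrix_ball (mat2 (a + p) (b + q) (c + r) (d + s)) (Suc j)"
      using close by (simp add: hm matrix_ball_mat2 diff_diff_eq add.commute)
    ultimately show "h \<in> (\<Union>h\<in>?N. matrix_ball h (Suc j))" by blast
  qed
  ultimately show ?thesis using that by blast
qed

lemma nested_balls_meet:
  assumes "\<And>j. X (Suc j) \<in> matrix_ball (X j) (l + j)"
  obtains L where "\<And>j. L \<in> matrix_ball (X j) (l + j)"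
proof -
  have tail: "X (j + d) \<in> matrix_ball (X j) (l + j)" for j d
  proof (induction d)
    case 0
    then show ?case by (simp add: matrix_ball_def)
  next
    case (Suc d)
    then show ?case using matrix_ball_trans[OF assms[of "j + d"], of "l + j"] by simp
  qed
  have "\<exists>L. \<forall>k. \<exists>N. \<forall>i\<ge>N. X i $ p $ q - L \<in> I k" for p q
  proof (rule ord_complete)
    fix k
    have "X i $ p $ q - X i' $ p $ q \<in> I k" if "i \<ge> nat k" "i' \<ge> nat k" for i i'
    proof -
      have "X i \<in> matrix_ball (X (nat k)) (l + nat k)" "X i' \<in> matrix_ball (X (nat k)) (l + nat k)"
        using tail[of "nat k" "i - nat k"] tail[of "nat k" "i' - nat k"] that by simp_all
      then have "X i \<in> matrix_ball (X i') (l + nat k)"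
        using matrix_ball_trans[OF _ order_refl] matrix_ball_sym by blast
      then have "X i $ p $ q - X i' $ p $ q \<in> I (int (l + nat k))"
        by (simp add: matrix_ball_def)
      then show ?thesis by (rule ideal_mono) simp
    qed
    then show "\<exists>N. \<forall>i\<ge>N. \<forall>j\<ge>N. X i $ p $ q - X j $ p $ q \<in> I k" by blast
  qed
  then obtain M where M: "\<And>p q k. \<exists>N. \<forall>i\<ge>N. X i $ p $ q - M p q \<in> I k" by metis
  let ?L = "\<chi> p q. M p q"
  have "?L \<in> matrix_ball (X j) (l + j)" for j
  proof -
    have "M p q - X j $ p $ q \<in> I (int (l + j))" for p q
    proof -
      obtain N where N: "\<And>i. i \<ge> N \<Longrightarrow> X i $ p $ q - M p q \<in> I (int (l + j))" using M by blast
      have "X (j + N) $ p $ q - X j $ p $ q \<in> I (int (l + j))"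
        using tail[of j N] by (simp add: matrix_ball_def)
      from ideal_diff[OF this N[of "j + N"]] show ?thesis by simp
    qed
    then show ?thesis by (simp add: matrix_ball_def)
  qed
  then show ?thesis using that by blast
qed

context
  fixes l :: nat
  assumes l: "square_level \<le> l"
begin

text \<open>
  Near a matrix \<open>g\<close> of the congruence subgroup, additive balls are contained in cosets of smaller
  congruence subgroups, because \<open>g\<inverse>\<close> is integral.
\<close>

lemma ball_subset_coset:
  assumes g: "g \<in> congruence_subgroup ord l" and j: "l \<le> j" and h: "h \<in> matrix_ball g j"
  shows "\<exists>k\<in>Ks j. (h, 1) = (g, 1) \<otimes>\<^bsub>GG\<^esub> k"
proof -
  obtain a b c d where gm: "g = mat2 a b c d" by (rule mat2_cases)
  obtain a' b' c' d' where hm: "h = mat2 a' b' c' d'" by (rule mat2_cases)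
  have gK: "(g, 1) \<in> Ks l" using g by (simp add: Ks_eq[OF l])
  have hK: "(h, 1) \<in> Ks l"
    using matrix_ball_trans[OF h j] g by (simp add: Ks_eq[OF l] congruence_subgroup_ball)
  note gc = Ks_carrier[OF l gK] and hc = Ks_carrier[OF l hK]
  let ?k = "inv\<^bsub>GG\<^esub> (g, 1) \<otimes>\<^bsub>GG\<^esub> (h, 1)"
  have kK: "?k \<in> Ks l" by (intro Ks_mult[OF l] Ks_inv[OF l] gK hK)
  define D where "D = a * d - b * c"
  have k: "?k = (mat2 ((d / D) * a' + (- b / D) * c') ((d / D) * b' + (- b / D) * d')
      ((- c / D) * a' + (a / D) * c') ((- c / D) * b' + (a / D) * d'), snd ?k)"
    unfolding gm hm mp_inv_mat2[OF gc[unfolded gm] D_def] mp_mult_mat2 by simp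
  have I: "a' - a \<in> I (int j)" "b' - b \<in> I (int j)" "c' - c \<in> I (int j)" "d' - d \<in> I (int j)"
    using h by (simp_all add: hm gm matrix_ball_mat2)
  have gi: "a - 1 \<in> I (int l)" "b \<in> I (int l)" "c \<in> I (int l)" "d - 1 \<in> I (int l)" "D - 1 \<in> I (int l)"
    using g congruence_det by (simp_all add: gm congruence_subgroup_mat2 D_def)
  have D: "D \<noteq> 0" "inverse D \<in> I 0" using unit_of_near_one[OF gi(5)] l_pos[OF l] by auto
  have int: "a \<in> I 0" "d \<in> I 0" "b \<in> I 0" "c \<in> I 0"
    using unit_of_near_one(3) gi l_pos[OF l] ideal_mono[OF gi(2), of 0] ideal_mono[OF gi(3), of 0] by auto
  have dD: "d / D \<in> I 0" "- b / D \<in> I 0" "- c / D \<in> I 0" "a / D \<in> I 0"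
    unfolding divide_inverse by (intro ideal_mult_left[OF _ D(2)] ideal_minus int)+
  have one: "(a * d - b * c) / D = 1" using D by (simp add: D_def)
  have "(d / D) * (a' - a) + (- b / D) * (c' - c) \<in> I (int j)"
    "(d / D) * (b' - b) + (- b / D) * (d' - d) \<in> I (int j)"
    "(- c / D) * (a' - a) + (a / D) * (c' - c) \<in> I (int j)"
    "(- c / D) * (b' - b) + (a / D) * (d' - d) \<in> I (int j)"
    by (intro ideal_add ideal_mult_left I dD)+
  moreover have
    "(d / D) * (a' - a) + (- b / D) * (c' - c) = (d / D) * a' + (- b / D) * c' - (a * d - b * c) / D"
    "(d / D) * (b' - b) + (- b / D) * (d' - d) = (d / D) * b' + (- b / D) * d'"
    "(- c / D) * (a' - a) + (a / D) * (c' - c) = (- c / D) * a' + (a / D) * c'"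
    "(- c / D) * (b' - b) + (a / D) * (d' - d) = (- c / D) * b' + (a / D) * d' - (a * d - b * c) / D"
    by (simp_all add: algebra_simps diff_divide_distrib)
  ultimately have "fst ?k \<in> congruence_subgroup ord j"
    unfolding one by (subst k) (simp add: congruence_subgroup_mat2)
  moreover have "snd ?k = 1"
    using kK by (subst (asm) k) (simp only: Ks_iff[OF l])
  moreover obtain m \<mu> where m: "?k = (m, \<mu>)" by (rule prod.exhaust)
  ultimately have "?k \<in> Ks j"
    unfolding Ks_eq[OF le_trans[OF l j]] m by simp
  moreover have "(h, 1) = (g, 1) \<otimes>\<^bsub>GG\<^esub> ?k"
    using gc hc by (simp flip: m_assoc)
  ultimately show ?thesis by blast
qed

text \<open>
  Suppose that a cover has no finite subcover. Every ball is a finite union of balls of the next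
  level, so there is a nested sequence of balls that are not finitely covered. By completeness they
  have a common point. The member of the cover that contains it also contains all sufficiently small
  balls of the sequence, a contradiction.
\<close>

lemma compactin_Ks: "compactin (mp_topology ord 2 hs) (Ks l)"
proof -
  have "\<exists>\<F>. finite \<F> \<and> \<F> \<subseteq> \<U> \<and> Ks l \<subseteq> \<Union>\<F>"
    if \<U>: "\<And>U. U \<in> \<U> \<Longrightarrow> openin (mp_topology ord 2 hs) U" "Ks l \<subseteq> \<Union>\<U>" for \<U>
  proof (rule ccontr)
    assume no: "\<nexists>\<F>. finite \<F> \<and> \<F> \<subseteq> \<U> \<and> Ks l \<subseteq> \<Union>\<F>"
    define covered where "covered S \<longleftrightarrow> (\<exists>\<F>. finite \<F> \<and> \<F> \<subseteq> \<U> \<and> (\<lambda>k. (k, 1)) ` S \<subseteq> \<Union>\<F>)" for S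
    have step: "\<exists>h. h \<in> matrix_ball g j \<and> \<not> covered (matrix_ball h (Suc j))"
      if g: "\<not> covered (matrix_ball g j)" for g j
    proof (rule ccontr)
      assume "\<not> ?thesis"
      then have cov: "\<And>h. h \<in> matrix_ball g j \<Longrightarrow> covered (matrix_ball h (Suc j))" by blast
      obtain N where N: "finite N" "N \<subseteq> matrix_ball g j"
        "matrix_ball g j \<subseteq> (\<Union>h\<in>N. matrix_ball h (Suc j))" by (rule matrix_ball_split)
      have "\<forall>h\<in>N. \<exists>\<F>. finite \<F> \<and> \<F> \<subseteq> \<U> \<and> (\<lambda>k. (k, 1)) ` matrix_ball h (Suc j) \<subseteq> \<Union>\<F>"
        using cov N(2) unfolding covered_def by blast
      then obtain \<F> where \<F>: "\<And>h. h \<in> N \<Longrightarrow> finite (\<F> h) \<and> \<F> h \<subseteq> \<U> \<and>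
          (\<lambda>k. (k, 1)) ` matrix_ball h (Suc j) \<subseteq> \<Union>(\<F> h)" by metis
      have "(k, 1) \<in> \<Union>(\<Union>h\<in>N. \<F> h)" if k: "k \<in> matrix_ball g j" for k
      proof -
        obtain h where h: "h \<in> N" "k \<in> matrix_ball h (Suc j)" using N(3) k by auto
        then have "(k, 1) \<in> \<Union>(\<F> h)" using \<F>[OF h(1)] by auto
        then show ?thesis using h(1) by blast
      qed
      moreover have "finite (\<Union>h\<in>N. \<F> h)" "(\<Union>h\<in>N. \<F> h) \<subseteq> \<U>"
        using \<F> N(1) by auto
      ultimately have "covered (matrix_ball g j)"
        unfolding covered_def by (intro exI[of _ "\<Union>h\<in>N. \<F> h"]) auto
      then show False using g by simp
    qed
    have start: "\<not> covered (matrix_ball (mat 1) (l + 0))"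
      using no by (simp add: covered_def Ks_eq[OF l] congruence_subgroup_ball)
    obtain X where X: "X 0 = mat 1" "\<And>j. \<not> covered (matrix_ball (X j) (l + j))"
      "\<And>j. X (Suc j) \<in> matrix_ball (X j) (l + j)"
    proof -
      have "\<exists>X. \<forall>j. (\<not> covered (matrix_ball (X j) (l + j)) \<and> (j = 0 \<longrightarrow> X j = mat 1))
          \<and> X (Suc j) \<in> matrix_ball (X j) (l + j)"
        by (rule dependent_nat_choice) (use start step in auto)
      then show ?thesis using that by auto
    qed
    obtain L where L: "\<And>j. L \<in> matrix_ball (X j) (l + j)"
      using nested_balls_meet[OF X(3)] by blast
    have LK: "L \<in> congruence_subgroup ord l"
      using L[of 0] by (simp add: X(1) congruence_subgroup_ball)
    then have "(L, 1) \<in> Ks l" by (simp add: Ks_eq[OF l])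
    then obtain U where U: "U \<in> \<U>" "(L, 1) \<in> U" using \<U>(2) by blast
    then obtain m where m: "\<forall>k\<in>Ks m. (L, 1) \<otimes>\<^bsub>GG\<^esub> k \<in> U"
      using \<U>(1)[OF U(1)] unfolding openin_mp_topology mp_open_def Ks_def by blast
    have "(h, 1) \<in> U" if h: "h \<in> matrix_ball (X m) (l + m)" for h
    proof -
      have "h \<in> matrix_ball L (l + m)"
        using matrix_ball_trans[OF h order_refl matrix_ball_sym[OF L]] .
      then obtain k where "k \<in> Ks (l + m)" "(h, 1) = (L, 1) \<otimes>\<^bsub>GG\<^esub> k"
        using ball_subset_coset[OF LK le_add1] by blast
      then show ?thesis using m Ks_mono[of m "l + m"] by auto
    qed
    then have "covered (matrix_ball (X m) (l + m))"
      unfolding covered_def using U(1) by (intro exI[of _ "{U}"]) auto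
    then show False using X(2) by simp
  qed
  moreover have "openin (mp_topology ord 2 hs) (carrier GG)"
    by (rule openI) (use Ks_carrier in \<open>auto intro!: exI[of _ square_level] mp_closed\<close>)
  then have "carrier GG \<subseteq> topspace (mp_topology ord 2 hs)" by (rule openin_subset)
  then have "Ks l \<subseteq> topspace (mp_topology ord 2 hs)" using Ks_carrier[OF l] by blast
  ultimately show ?thesis unfolding compactin_def by blast
qed

lemma openin_Ks: "openin (mp_topology ord 2 hs) (Ks l)"
  by (rule openI) (use l Ks_carrier[OF l] Ks_mult[OF l] in blast)+

end

end

section \<open>The involution is dualizing for the double cover\<close>

lemma vector_space_fun_scale: "vector_space fun_scale"
  by unfold_locales (auto simp: fun_scale_def fun_eq_iff algebra_simps)

lemma sum_fun_apply: "(\<Sum>i\<in>A. f i :: 'a \<Rightarrow> 'b::comm_monoid_add) x = (\<Sum>i\<in>A. f i x)"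
  by (induction A rule: infinite_finite_induct) auto

context double_cover
begin

text \<open>
  Orbits are finite since the sets of group elements with a given value at \<open>v\<close> form an open partition
  of the compact group \<open>K\<^sub>l\<^sup>*\<close>.
\<close>

lemma smooth_averaging_group:
  assumes rep: "complex_group_rep smul GG \<pi>" and smooth: "smooth_rep GG (mp_topology ord 2 hs) \<pi>"
    and l: "square_level \<le> l"
  shows "averaging_group smul GG \<pi> (Ks l)"
proof -
  interpret complex_group_rep smul GG \<pi> by (rule rep)
  show ?thesis
  proof (intro averaging_group.intro rep averaging_group_axioms.intro)
    show "subgroup (Ks l) GG" by (rule Ks_subgroup[OF l])
    fix v
    let ?T = "mp_topology ord 2 hs"
    have "openin ?T {g \<in> carrier GG. \<pi> g v = v}"
      using smooth by (simp add: smooth_rep_def)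
    then obtain m where m: "square_level \<le> m" "Ks m \<subseteq> {g \<in> carrier GG. \<pi> g v = v}"
      by (rule open_at_one) (simp add: rep_one)
    define U where "U y = {g \<in> carrier GG. \<pi> g v = y}" for y
    have open_U: "openin ?T (U y)" for y
    proof (rule openI)
      show "U y \<subseteq> carrier GG" by (auto simp: U_def)
      fix x assume x: "x \<in> U y"
      have "x \<otimes>\<^bsub>GG\<^esub> k \<in> U y" if "k \<in> Ks m" for k
        using x subsetD[OF m(2) that] by (simp add: U_def rep_mult)
      then show "\<exists>l\<ge>square_level. \<forall>k\<in>Ks l. x \<otimes>\<^bsub>GG\<^esub> k \<in> U y"
        using m(1) by blast
    qed
    have cover: "Ks l \<subseteq> \<Union>(U ` orbit (Ks l) v)"
      using Ks_carrier[OF l] by (auto simp: U_def orbit_def)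
    obtain \<F> where \<F>: "finite \<F>" "\<F> \<subseteq> U ` orbit (Ks l) v" "Ks l \<subseteq> \<Union>\<F>"
      using compactinD[OF compactin_Ks[OF l] _ cover] open_U by (metis imageE)
    obtain Y where Y: "finite Y" "\<F> = U ` Y"
      using finite_subset_image[OF \<F>(1,2)] by blast
    have "orbit (Ks l) v \<subseteq> Y"
      using \<F>(3) unfolding Y(2) orbit_def U_def by blast
    then show "finite (orbit (Ks l) v)" using Y(1) finite_subset by blast
  qed
qed

lemma admissible_fixed_finite:
  assumes rep: "complex_group_rep smul GG \<pi>"
    and adm: "admissible_rep GG (mp_topology ord 2 hs) smul \<pi>" and l: "square_level \<le> l"
  shows "\<exists>B. finite B \<and> complex_group_rep.fixed \<pi> (Ks l) \<subseteq> module.span smul B"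
proof -
  interpret complex_group_rep smul GG \<pi> by (rule rep)
  show ?thesis
    using adm Ks_subgroup[OF l] openin_Ks[OF l] compactin_Ks[OF l]
    unfolding admissible_rep_def fixed_def by blast
qed

text \<open>
  The invariant form is an equivariant embedding \<open>\<phi>\<close> of the twisted representation into the dual
  space. It takes values in the smooth dual because the involution preserves the congruence subgroups.
  A functional that is fixed by \<open>K\<^sub>m\<^sup>*\<close> is determined by its restriction to the vectors fixed by
  \<open>K\<^sub>m\<^sup>*\<close>; these form a finite-dimensional space, which \<open>\<phi>\<close> embeds into its own dual. Comparing
  dimensions shows that \<open>\<phi>\<close> is onto.
\<close>

theorem involution_dualizes:
  fixes smul :: "complex \<Rightarrow> 'v::ab_group_add \<Rightarrow> 'v"
  assumes rep: "group_rep GG smul \<pi>" and irr: "irreducible_rep GG smul \<pi>"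
    and adm: "admissible_rep GG (mp_topology ord 2 hs) smul \<pi>" and \<alpha>: "\<alpha> \<noteq> 0"
  shows "rep_isomorphic GG smul UNIV (twist GG (mp_sigma 2 hs \<alpha>) \<pi>)
    fun_scale (smooth_dual GG (mp_topology ord 2 hs) smul \<pi>) (contragredient GG \<pi>)"
proof -
  let ?T = "mp_topology ord 2 hs" and ?\<sigma> = "mp_sigma 2 hs \<alpha>"
  have R: "complex_group_rep smul GG \<pi>"
    using rep group_GG unfolding group_rep_def complex_group_rep_def complex_group_rep_axioms_def
      complex_vector_space_def by blast
  interpret complex_group_rep smul GG \<pi> by (rule R)
  have smooth: "smooth_rep GG ?T \<pi>" using adm by (simp add: admissible_rep_def)
  note averaging = smooth_averaging_group[OF R smooth]
  have stabilizer: "\<exists>l\<ge>square_level. \<forall>k\<in>Ks l. \<pi> k v = v" for v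
  proof -
    have "openin ?T {g \<in> carrier GG. \<pi> g v = v}"
      using smooth by (simp add: smooth_rep_def)
    then obtain m where "square_level \<le> m" "Ks m \<subseteq> {g \<in> carrier GG. \<pi> g v = v}"
      by (rule open_at_one) (simp add: rep_one)
    then show ?thesis by blast
  qed
  obtain v0 :: 'v where v0: "v0 \<noteq> 0" using irr by (auto simp: irreducible_rep_def)
  obtain l where l: "square_level \<le> l" and v0_fixed: "\<forall>k\<in>Ks l. \<pi> k v0 = v0"
    using stabilizer by blast
  interpret K: class_preserving_involution smul GG \<pi> "Ks l" ?\<sigma>
  proof (intro class_preserving_involution.intro averaging l class_preserving_involution_axioms.intro)
    show "U = {0} \<or> U = UNIV"
      if "subspace U" "\<And>g v. g \<in> carrier GG \<Longrightarrow> v \<in> U \<Longrightarrow> \<pi> g v \<in> U" for U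
      using irr that unfolding irreducible_rep_def by (metis image_subsetI)
    show "\<exists>x. normalizes x (Ks l) \<and> ?\<sigma> g \<otimes>\<^bsub>GG\<^esub> x = x \<otimes>\<^bsub>GG\<^esub> g" if "g \<in> carrier GG" for g
      using involution_preserves_conjugacy[OF l \<alpha> that] by (simp add: twist_conjugate_def[OF l])
    show "\<exists>B. finite B \<and> fixed (Ks l) \<subseteq> span B"
      by (rule admissible_fixed_finite[OF R adm l])
    show "\<exists>v\<in>fixed (Ks l). v \<noteq> 0"
      using v0 v0_fixed by (auto simp: fixed_def)
  qed (simp_all add: sigma_closed[OF \<alpha>] sigma_mult[OF \<alpha>] sigma_invol[OF \<alpha>] sigma_Ks[OF l _ \<alpha>])
  obtain \<phi> :: "'v \<Rightarrow> 'v \<Rightarrow> complex" where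
    \<phi>_lin: "\<And>w. functional (\<phi> w)"
    and \<phi>_add: "\<And>w w' v. \<phi> (w + w') v = \<phi> w v + \<phi> w' v"
    and \<phi>_scale: "\<And>c w v. \<phi> (smul c w) v = c * \<phi> w v"
    and \<phi>_equiv: "\<And>g w v. g \<in> carrier GG \<Longrightarrow> \<phi> w (\<pi> g v) = \<phi> (\<pi> (?\<sigma> g) w) v"
    and \<phi>_nondeg: "\<And>w. (\<And>v. \<phi> w v = 0) \<Longrightarrow> w = 0"
    by (rule K.invariant_form) blast
  interpret fs: vector_space fun_scale by (rule vector_space_fun_scale)
  interpret \<phi>: Vector_Spaces.linear smul fun_scale \<phi>
    unfolding Vector_Spaces.linear_iff
    using vector_space_axioms fs.vector_space_axioms \<phi>_add \<phi>_scale
    by (auto simp: fun_eq_iff fun_scale_def)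
  have inj: "inj \<phi>"
    unfolding \<phi>.inj_iff_eq_0 using \<phi>_nondeg by (auto simp: fun_eq_iff)
  have in_dual: "\<phi> w \<in> smooth_dual GG ?T smul \<pi>" for w
  proof -
    obtain m where m: "square_level \<le> m" "\<forall>k\<in>Ks m. \<pi> k w = w" using stabilizer by blast
    have "openin ?T {g \<in> carrier GG. contragredient GG \<pi> g (\<phi> w) = \<phi> w}" (is "openin ?T ?S")
    proof (rule openI)
      show "?S \<subseteq> carrier GG" by blast
      fix x assume x: "x \<in> ?S"
      have "x \<otimes>\<^bsub>GG\<^esub> k \<in> ?S" if k: "k \<in> Ks m" for k
      proof -
        have c: "x \<in> carrier GG" "k \<in> carrier GG" using x k Ks_carrier[OF m(1)] by auto
        have \<sigma>k: "\<pi> (?\<sigma> (inv\<^bsub>GG\<^esub> k)) w = w"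
          using m(2) sigma_Ks[OF m(1) Ks_inv[OF m(1) k] \<alpha>] by blast
        have "\<phi> w (\<pi> (inv\<^bsub>GG\<^esub> (x \<otimes>\<^bsub>GG\<^esub> k)) v) = \<phi> w (\<pi> (inv\<^bsub>GG\<^esub> x) v)" for v
          using \<phi>_equiv[of "inv\<^bsub>GG\<^esub> k" w] c by (simp add: inv_mult_group rep_mult \<sigma>k)
        then show ?thesis using x c by (simp add: contragredient_def)
      qed
      then show "\<exists>l\<ge>square_level. \<forall>k\<in>Ks l. x \<otimes>\<^bsub>GG\<^esub> k \<in> ?S" using m(1) by blast
    qed
    then show ?thesis using \<phi>_lin by (simp add: smooth_dual_def)
  qed
  have onto: "f \<in> range \<phi>" if f: "f \<in> smooth_dual GG ?T smul \<pi>" for f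
  proof -
    have f_lin: "functional f" using f by (simp add: smooth_dual_def)
    have "openin ?T {g \<in> carrier GG. contragredient GG \<pi> g f = f}"
      using f by (simp add: smooth_dual_def)
    then obtain m where m: "square_level \<le> m"
      and sub: "Ks m \<subseteq> {g \<in> carrier GG. contragredient GG \<pi> g f = f}"
      by (rule open_at_one) (simp add: contragredient_def rep_one)
    have f_inv: "f (\<pi> k v) = f v" if k: "k \<in> Ks m" for k v
    proof -
      have "contragredient GG \<pi> (inv\<^bsub>GG\<^esub> k) f = f"
        using sub Ks_inv[OF m k] by blast
      from fun_cong[OF this, of v] show ?thesis
        using Ks_carrier[OF m k] by (simp add: contragredient_def)
    qed
    interpret M: averaging_group smul GG \<pi> "Ks m" by (rule averaging[OF m])
    let ?F = "fixed (Ks m)" and ?e = "average (Ks m)"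
    obtain C where C: "C \<subseteq> ?F" "independent C" "?F \<subseteq> span C"
      using maximal_independent_subset[of ?F] by metis
    obtain B where "finite B" "?F \<subseteq> span B"
      using admissible_fixed_finite[OF R adm m] by blast
    then have finC: "finite C" using independent_span_bound[of B C] C by blast
    \<comment> \<open>The functionals fixed by \<open>K\<^sub>m\<^sup>*\<close> are spanned by as many elements as \<open>C\<close> has.\<close>
    define coord where "coord b v = representation C (?e v) b" for b v
    have expand: "h \<in> fs.span (coord ` C)"
      if h: "functional h" "\<And>k v. k \<in> Ks m \<Longrightarrow> h (\<pi> k v) = h v" for h
    proof -
      have pointwise: "h v = (\<Sum>b\<in>C. h b * coord b v)" for v
      proof -
        have "?e v \<in> span C" using M.average_in_fixed C(3) by blast
        then have "h (?e v) = h (\<Sum>b\<in>C. smul (coord b v) b)"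
          unfolding coord_def by (simp add: expand_in_basis[OF finC C(2)])
        then show ?thesis
          using M.invariant_functional_average[of h, OF h]
          by (simp add: functional_sum[OF h(1)] functional_scale[OF h(1)] mult.commute)
      qed
      have "h = (\<Sum>b\<in>C. fun_scale (h b) (coord b))"
        unfolding fun_scale_def by (rule ext) (unfold sum_fun_apply, rule pointwise)
      also have "\<dots> \<in> fs.span (coord ` C)"
        by (intro fs.span_sum fs.span_scale fs.span_base imageI)
      finally show ?thesis .
    qed
    have \<phi>C: "\<phi> ` C \<subseteq> fs.span (coord ` C)"
    proof
      fix h assume "h \<in> \<phi> ` C"
      then obtain w where w: "w \<in> ?F" "h = \<phi> w" using C(1) by blast
      have "\<phi> w (\<pi> k v) = \<phi> w v" if k: "k \<in> Ks m" for k v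
        using \<phi>_equiv[OF Ks_carrier[OF m k]] sigma_Ks[OF m k \<alpha>] w(1) by (simp add: fixed_def)
      then show "h \<in> fs.span (coord ` C)"
        unfolding w(2) by (intro expand \<phi>_lin)
    qed
    have ind: "fs.independent (\<phi> ` C)"
      using C(2) inj by (intro \<phi>.independent_injective_image) (auto intro: inj_on_subset)
    have "f \<in> fs.span (\<phi> ` C)"
    proof (rule ccontr)
      assume f_new: "f \<notin> fs.span (\<phi> ` C)"
      then have "fs.independent (insert f (\<phi> ` C))"
        using ind by (rule fs.independent_insertI)
      moreover have "insert f (\<phi> ` C) \<subseteq> fs.span (coord ` C)"
        using \<phi>C expand[OF f_lin f_inv] by blast
      ultimately have "card (insert f (\<phi> ` C)) \<le> card (coord ` C)"
        using fs.independent_span_bound[of "coord ` C"] finC by blast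
      also have "\<dots> \<le> card C" by (rule card_image_le[OF finC])
      also have "card C = card (\<phi> ` C)"
        using inj by (intro card_image[symmetric]) (rule inj_on_subset, auto)
      finally show False
        using finC f_new fs.span_base[of f "\<phi> ` C"] by (simp add: card_insert_if split: if_splits)
    qed
    moreover have "fs.span (\<phi> ` C) \<subseteq> range \<phi>"
      by (rule fs.span_minimal) (auto intro: \<phi>.subspace_image)
    ultimately show ?thesis by blast
  qed
  show ?thesis
    unfolding rep_isomorphic_def
  proof (intro exI[of _ \<phi>] conjI ballI allI)
    show "bij_betw \<phi> UNIV (smooth_dual GG ?T smul \<pi>)"
      unfolding bij_betw_def using inj in_dual onto by blast
    fix g x assume "g \<in> carrier GG"
    then show "\<phi> (twist GG ?\<sigma> \<pi> g x) = contragredient GG \<pi> g (\<phi> x)"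
      using \<phi>_equiv[of "inv\<^bsub>GG\<^esub> g"] by (simp add: twist_def contragredient_def)
  qed (simp_all add: \<phi>.add \<phi>.scale)
qed

end

section \<open>Central characters and the degree of the cover\<close>

text \<open>
  The involution inverts central elements, so on the centre the twist acts by \<open>\<xi>\<close> and the
  contragredient by \<open>\<xi>\<inverse>\<close>. If they agree, every \<open>n\<close>-th root of unity is its own inverse.
\<close>

lemma (in hilbert_symbol) dualizing_imp_degree_two:
  fixes smul :: "complex \<Rightarrow> 'v::ab_group_add \<Rightarrow> 'v"
  assumes \<xi>: "injective_character n \<xi>" and rep: "group_rep GG smul \<pi>"
    and nz: "(v::'v) \<noteq> 0" and gen: "genuine_rep n hs \<xi> smul \<pi>" and \<alpha>: "\<alpha> \<noteq> 0"
    and iso: "rep_isomorphic GG smul UNIV (twist GG (mp_sigma n hs \<alpha>) \<pi>)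
      fun_scale (smooth_dual GG T smul \<pi>) (contragredient GG \<pi>)"
  shows "n = 2"
proof -
  interpret G: group GG by (rule group_of_genuine_rep[OF \<xi> rep nz gen])
  have vs: "vector_space smul" using rep by (simp add: group_rep_def)
  have central_closed: "mp_central \<epsilon> \<in> carrier GG" if "\<epsilon> \<in> roots_of_unity n" for \<epsilon>
    using that by (simp add: mp_central_def mp_carrier)
  have central_inv: "inv\<^bsub>GG\<^esub> mp_central \<epsilon> = mp_central (inverse \<epsilon>)" if \<epsilon>: "\<epsilon> \<in> roots_of_unity n" for \<epsilon>
    by (rule G.inv_equality[OF _ central_closed[OF \<epsilon>] central_closed[OF roots_inverse[OF \<epsilon>]]])
      (simp add: mp_central_def mp_mult mp_one cocycle_one_left roots_nonzero[OF \<epsilon>])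
  have sigma_central: "mp_sigma n hs \<alpha> (mp_central \<epsilon>) = mp_central (inverse \<epsilon>)"
    if \<epsilon>: "\<epsilon> \<in> roots_of_unity n" for \<epsilon>
  proof -
    have "mp_sigma n hs \<alpha> (mp_central \<epsilon>)
        = mp_central 1 \<otimes>\<^bsub>GG\<^esub> mp_u 1 \<otimes>\<^bsub>GG\<^esub> mp_central (inverse \<epsilon>) \<otimes>\<^bsub>GG\<^esub> mp_u 1"
      unfolding mp_sigma_def central_inv[OF \<epsilon>] by (simp add: mp_det_def mp_central_def hs_one_right \<alpha>)
    also have "\<dots> = mp_central (inverse \<epsilon>)"
      by (simp add: mp_central_def mp_u_def mp_mult cocycle_one_left cocycle_one_right u_mat_mat2)
        (simp add: mat_1_mat2 kubota_cocycle_def hs_one_right)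
    finally show ?thesis .
  qed
  have act: "\<pi> (mp_central \<epsilon>) w = smul (\<xi> \<epsilon>) w" if \<epsilon>: "\<epsilon> \<in> roots_of_unity n" for \<epsilon> w
  proof -
    have "\<pi> (mp_central \<epsilon> \<otimes>\<^bsub>GG\<^esub> \<one>\<^bsub>GG\<^esub>) w = smul (\<xi> \<epsilon>) (\<pi> \<one>\<^bsub>GG\<^esub> w)"
      using gen \<epsilon> G.one_closed unfolding genuine_rep_def by blast
    then show ?thesis
      using rep central_closed[OF \<epsilon>] by (simp add: group_rep_def)
  qed
  obtain \<phi> where bij: "bij_betw \<phi> UNIV (smooth_dual GG T smul \<pi>)"
    and add: "\<And>x y. \<phi> (x + y) = \<phi> x + \<phi> y"
    and scale: "\<And>c x. \<phi> (smul c x) = fun_scale c (\<phi> x)"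
    and equiv: "\<And>g x. g \<in> carrier GG \<Longrightarrow>
      \<phi> (twist GG (mp_sigma n hs \<alpha>) \<pi> g x) = contragredient GG \<pi> g (\<phi> x)"
    using iso unfolding rep_isomorphic_def by blast
  have "\<phi> 0 = 0" using add[of 0 0] by simp
  then have "\<phi> v \<noteq> 0"
    using nz bij by (metis bij_betw_imp_inj_on injD)
  then obtain w where w: "\<phi> v w \<noteq> 0" by (auto simp: fun_eq_iff)
  have lin: "Vector_Spaces.linear smul (*) (\<phi> v)"
    using bij_betwE[OF bij] by (auto simp: smooth_dual_def)
  have "\<epsilon> = inverse \<epsilon>" if \<epsilon>: "\<epsilon> \<in> roots_of_unity n" for \<epsilon> :: 'f
  proof -
    note inv = roots_inverse[OF \<epsilon>]
    have "twist GG (mp_sigma n hs \<alpha>) \<pi> (mp_central \<epsilon>) v = smul (\<xi> \<epsilon>) v"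
      by (simp add: twist_def central_inv[OF \<epsilon>] sigma_central[OF inv] act[OF \<epsilon>])
    moreover have "contragredient GG \<pi> (mp_central \<epsilon>) (\<phi> v) = fun_scale (\<xi> (inverse \<epsilon>)) (\<phi> v)"
      using lin by (simp add: contragredient_def central_inv[OF \<epsilon>] act[OF inv] fun_scale_def
          Vector_Spaces.linear_iff)
    ultimately have "fun_scale (\<xi> \<epsilon>) (\<phi> v) = fun_scale (\<xi> (inverse \<epsilon>)) (\<phi> v)"
      using equiv[OF central_closed[OF \<epsilon>], of v] by (simp add: scale)
    from fun_cong[OF this, of w] have "\<xi> \<epsilon> = \<xi> (inverse \<epsilon>)"
      using w by (simp add: fun_scale_def)
    then show ?thesis
      using \<xi> \<epsilon> inv by (auto simp: injective_character_def dest: inj_onD)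
  qed
  then have "\<epsilon> * \<epsilon> = 1" if "\<epsilon> \<in> roots_of_unity n" for \<epsilon> :: 'f
    using that roots_nonzero[OF that] by (metis right_inverse)
  then have "roots_of_unity n \<subseteq> {1, - 1 :: 'f}"
    by (auto simp: square_eq_1_iff)
  then have "card (roots_of_unity n :: 'f set) \<le> card {1, - 1 :: 'f}"
    by (rule card_mono[rotated]) simp
  also have "\<dots> \<le> 2" by (simp add: card_insert_if)
  finally show ?thesis using card_roots_of_unity n_ge_2 by simp
qed

theorem theorem1p2:
  fixes ord :: "'f::field_char_0 \<Rightarrow> int"
    and n :: nat
    and hs :: "'f \<Rightarrow> 'f \<Rightarrow> 'f"
    and \<xi> :: "'f \<Rightarrow> complex"
    and smul :: "complex \<Rightarrow> 'v::ab_group_add \<Rightarrow> 'v"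
    and \<pi> :: "'f mp \<Rightarrow> 'v \<Rightarrow> 'v"
    and \<alpha> :: 'f
  assumes "hilbert_symbol ord n hs"
    and "injective_character n \<xi>"
    and "group_rep (mp_group n hs) smul \<pi>"
    and "irreducible_rep (mp_group n hs) smul \<pi>"
    and "admissible_rep (mp_group n hs) (mp_topology ord n hs) smul \<pi>"
    and "genuine_rep n hs \<xi> smul \<pi>"
    and "\<alpha> \<noteq> 0"
  shows "rep_isomorphic (mp_group n hs)
           smul UNIV (twist (mp_group n hs) (mp_sigma n hs \<alpha>) \<pi>)
           fun_scale (smooth_dual (mp_group n hs) (mp_topology ord n hs) smul \<pi>)
             (contragredient (mp_group n hs) \<pi>)
         \<longleftrightarrow> n = 2"
proof -
  interpret hilbert_symbol ord n hs by (rule assms(1))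
  obtain v :: 'v where v: "v \<noteq> 0" using assms(4) by (auto simp: irreducible_rep_def)
  show ?thesis
  proof
    assume "n = 2"
    then have "double_cover ord hs"
      using assms(1) group_of_genuine_rep[OF assms(2,3) v assms(6)]
      by (simp add: double_cover_def double_cover_axioms_def)
    then show "rep_isomorphic (mp_group n hs)
           smul UNIV (twist (mp_group n hs) (mp_sigma n hs \<alpha>) \<pi>)
           fun_scale (smooth_dual (mp_group n hs) (mp_topology ord n hs) smul \<pi>)
             (contragredient (mp_group n hs) \<pi>)"
      using double_cover.involution_dualizes assms(3,4,5,7) \<open>n = 2\<close> by blast
  qed (rule dualizing_imp_degree_two[OF assms(2,3) v assms(6,7)])
qed

end
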